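(* Let $k$ be a field of characteristic zero and let $A$ be an involutory dual quasi-Hopf algebra over $k$ which has a non-zero left integral. Then $A$ is cosemisimple.
   Context: All spaces are over the field $k$; $\otimes=\otimes_k$, and Sweedler notation $\Delta(a)=a_1\otimes a_2$ (summation understood) is used. A dual quasi-bialgebra $A$ is a coassociative coalgebra $(A,\Delta,\varepsilon)$ with coalgebra morphisms $m_A:A\otimes A\to A$, $m_A(a\otimes b)=ab$, and $\eta_A:k\to A$, $\eta_A(1)=1$, and a convolution invertible element $\varphi\in(A\otimes A\otimes A)^*$ such that for all $a,b,c,d\in A$: $a_1(b_1c_1)\varphi(a_2,b_2,c_2)=\varphi(a_1,b_1,c_1)(a_2b_2)c_2$; $1a=a1=a$; $\varphi(a_1,b_1,c_1d_1)\varphi(a_2b_2,c_2,d_2)=\varphi(b_1,c_1,d_1)\varphi(a_1,b_2c_2,d_2)\varphi(a_2,b_3,c_3)$; $\varphi(a,1,b)=\varepsilon(a)\varepsilon(b)$. It is a dual quasi-Hopf algebra if moreover there are a coalgebra anti-morphism $S:A\to A$ and $\alpha,\beta\in A^*$ such that for all $a\in A$: $S(a_1)\alpha(a_2)a_3=\alpha(a)1$, $a_1\beta(a_2)S(a_3)=\beta(a)1$, and $\varphi(a_1\beta(a_2),S(a_3),\alpha(a_4)a_5)=\varphi^{-1}(S(a_1),\alpha(a_2)a_3,\beta(a_4)S(a_5))=\varepsilon(a)$. One normalizes (without loss of generality) $\alpha(1)=\beta(1)=1$. $A$ is called involutory if $S^2(a)=\beta(S(a_1))\alpha(a_2)a_3\beta(a_4)\alpha(S(a_5))$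 for all $a\in A$. The dual $A^*$ is an algebra under convolution, with unit $\varepsilon$. A left integral on $A$ is an element $T\in A^*$ such that $a^*T=a^*(1)T$ for all $a^*\in A^*$. Cosemisimple means cosemisimple as a coalgebra (a direct sum of simple subcoalgebras). *)

theory Defs
  imports Main "HOL.Vector_Spaces" "HOL-Library.Poly_Mapping"
begin

section \<open>Free vector spaces\<close>

definition free_scale :: "'k::field \<Rightarrow> ('x \<Rightarrow>\<^sub>0 'k) \<Rightarrow> ('x \<Rightarrow>\<^sub>0 'k)"
  where "free_scale c p = Poly_Mapping.map (\<lambda>t. c * t) p"

lemma lookup_free_scale [simp]: "Poly_Mapping.lookup (free_scale c p) x = c * Poly_Mapping.lookup p x"
  by (simp add: free_scale_def map.rep_eq when_def)

global_interpretation free_vs: vector_space "free_scale :: 'k::field \<Rightarrow> ('x \<Rightarrow>\<^sub>0 'k) \<Rightarrow> _"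
  by unfold_locales (auto intro!: poly_mapping_eqI simp: lookup_add algebra_simps)

abbreviation free_gen :: "'x \<Rightarrow> ('x \<Rightarrow>\<^sub>0 'k::field)"
  where "free_gen x \<equiv> Poly_Mapping.single x 1"


section \<open>Tensor powers of a vector space\<close>

text \<open>
  The library has no tensor products, so we build them as usual: the free vector space on the
  words over \<open>V\<close> modulo the multilinearity relations. The relations preserve the
  length of words, so the quotient is the tensor algebra of \<open>V\<close>; the classes of
  combinations of words of length \<open>n\<close> form the \<open>n\<close>-th tensor power, the
  word \<open>[x1, ..., xn]\<close> standing for the pure tensor of \<open>x1, ..., xn\<close>.
  An element of the quotient is a coset, i.e. a set of formal combinations of words.
\<close>

locale tensor_space = vector_space scale
  for scale :: "'a::field \<Rightarrow> 'b::ab_group_add \<Rightarrow> 'b" (infixr \<open>*s\<close> 75)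
begin

definition tensor_relators :: "('b list \<Rightarrow>\<^sub>0 'a) set"
  where "tensor_relators =
    {free_gen (xs @ (x + y) # ys) - free_gen (xs @ x # ys) - free_gen (xs @ y # ys)
      | xs x y ys. True} \<union>
    {free_gen (xs @ (c *s x) # ys) - free_scale c (free_gen (xs @ x # ys))
      | xs c x ys. True}"

definition tensor_null :: "('b list \<Rightarrow>\<^sub>0 'a) set"
  where "tensor_null = free_vs.span tensor_relators"

text \<open>\<open>tensor [w1, ..., wm]\<close> is the sum of the pure tensors given by the words
  \<open>w1, ..., wm\<close>. Every tensor has this form, since scalars can be absorbed into a
  factor.\<close>

definition tensor :: "'b list list \<Rightarrow> ('b list \<Rightarrow>\<^sub>0 'a) set"
  where "tensor ws = {u. u - (\<Sum>w\<leftarrow>ws. free_gen w) \<in> tensor_null}"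

definition tensor_add ::
    "('b list \<Rightarrow>\<^sub>0 'a) set \<Rightarrow> ('b list \<Rightarrow>\<^sub>0 'a) set \<Rightarrow> ('b list \<Rightarrow>\<^sub>0 'a) set"
  where "tensor_add X Y = {u + v | u v. u \<in> X \<and> v \<in> Y}"

definition tensor_scale :: "'a \<Rightarrow> ('b list \<Rightarrow>\<^sub>0 'a) set \<Rightarrow> ('b list \<Rightarrow>\<^sub>0 'a) set"
  where "tensor_scale c X = {free_scale c u + v | u v. u \<in> X \<and> v \<in> tensor_null}"

text \<open>For a subspace \<open>C\<close> of \<open>V\<close>, the image of the \<open>n\<close>-th tensor power of \<open>C\<close> in that
  of \<open>V\<close>.\<close>

definition tensor_power :: "nat \<Rightarrow> 'b set \<Rightarrow> ('b list \<Rightarrow>\<^sub>0 'a) set set"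
  where "tensor_power n C = {tensor ws | ws. \<forall>w \<in> set ws. length w = n \<and> set w \<subseteq> C}"

definition dual_space :: "('b \<Rightarrow> 'a) set"
  where "dual_space = {f. Vector_Spaces.linear scale (*) f}"

definition bilinear_map :: "('b \<Rightarrow> 'b \<Rightarrow> 'b) \<Rightarrow> bool"
  where "bilinear_map f \<longleftrightarrow>
    (\<forall>y. Vector_Spaces.linear scale scale (\<lambda>x. f x y)) \<and>
    (\<forall>x. Vector_Spaces.linear scale scale (\<lambda>y. f x y))"

definition trilinear_form :: "('b \<Rightarrow> 'b \<Rightarrow> 'b \<Rightarrow> 'a) \<Rightarrow> bool"
  where "trilinear_form f \<longleftrightarrow>
    (\<forall>y z. (\<lambda>x. f x y z) \<in> dual_space) \<and>
    (\<forall>x z. (\<lambda>y. f x y z) \<in> dual_space) \<and>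
    (\<forall>x y. (\<lambda>z. f x y z) \<in> dual_space)"

end

text \<open>Multilinear maps factor through \<^const>\<open>tensor_space.tensor\<close>; this is what makes the
  Sweedler sums below independent of the chosen representatives.\<close>

lemma sum_tensor_cong:
  fixes s1 :: "'a::field \<Rightarrow> 'b::ab_group_add \<Rightarrow> 'b"
    and s2 :: "'a \<Rightarrow> 'c::ab_group_add \<Rightarrow> 'c"
    and f :: "'b list \<Rightarrow> 'c"
  assumes "vector_space s1" and "vector_space s2"
    and add: "\<And>xs x y ys. f (xs @ (x + y) # ys) = f (xs @ x # ys) + f (xs @ y # ys)"
    and scl: "\<And>xs c x ys. f (xs @ (s1 c x) # ys) = s2 c (f (xs @ x # ys))"
    and eq: "tensor_space.tensor s1 ws = tensor_space.tensor s1 ws'"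
  shows "(\<Sum>w\<leftarrow>ws. f w) = (\<Sum>w\<leftarrow>ws'. f w)"
proof -
  interpret vs1: tensor_space s1 by (simp add: tensor_space_def assms(1))
  interpret vs2: vector_space s2 by (rule assms(2))
  define F where "F p = (\<Sum>w\<in>Poly_Mapping.keys p. s2 (Poly_Mapping.lookup p w) (f w))" for p :: "'b list \<Rightarrow>\<^sub>0 'a"
  have F_sup: "F p = (\<Sum>w\<in>K. s2 (Poly_Mapping.lookup p w) (f w))" if "finite K" "Poly_Mapping.keys p \<subseteq> K" for p K
    unfolding F_def by (rule sum.mono_neutral_left) (use that in \<open>auto simp: in_keys_iff\<close>)
  have F_add: "F (p + q) = F p + F q" for p q
  proof -
    let ?K = "Poly_Mapping.keys p \<union> Poly_Mapping.keys q"
    have "F (p + q) = (\<Sum>w\<in>?K. s2 (Poly_Mapping.lookup (p + q) w) (f w))"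
      by (rule F_sup) (auto dest: subsetD[OF Poly_Mapping.keys_add])
    moreover have "F p = (\<Sum>w\<in>?K. s2 (Poly_Mapping.lookup p w) (f w))" by (rule F_sup) auto
    moreover have "F q = (\<Sum>w\<in>?K. s2 (Poly_Mapping.lookup q w) (f w))" by (rule F_sup) auto
    ultimately show ?thesis by (simp add: lookup_add vs2.scale_left_distrib sum.distrib)
  qed
  have F_scale: "F (free_scale c p) = s2 c (F p)" for c p
  proof -
    have "F (free_scale c p) = (\<Sum>w\<in>Poly_Mapping.keys p. s2 (Poly_Mapping.lookup (free_scale c p) w) (f w))"
      by (rule F_sup) (auto simp: in_keys_iff)
    then show ?thesis by (simp add: F_def vs2.scale_sum_right)
  qed
  have F_zero: "F 0 = 0" by (simp add: F_def)
  have F_gen: "F (free_gen w) = f w" for w by (simp add: F_def)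
  have F_diff: "F (p - q) = F p - F q" for p q
    using F_add[of "p - q" q] by simp
  have F_list: "F (\<Sum>w\<leftarrow>vs. free_gen w) = (\<Sum>w\<leftarrow>vs. f w)" for vs
    by (induction vs) (simp_all add: F_zero F_add F_gen)
  have F_null: "F u = 0" if "u \<in> vs1.tensor_null" for u
    using that unfolding vs1.tensor_null_def
  proof (induction rule: free_vs.span_induct_alt)
    case base
    show ?case by (rule F_zero)
  next
    case (step c x y)
    then have "F x = 0"
      by (auto simp: vs1.tensor_relators_def F_diff F_gen F_scale add scl)
    with step show ?case by (simp add: F_add F_scale)
  qed
  have "(\<Sum>w\<leftarrow>ws. free_gen w) \<in> vs1.tensor ws"
    by (simp add: vs1.tensor_def vs1.tensor_null_def free_vs.span_zero)
  then have "(\<Sum>w\<leftarrow>ws. free_gen w) - (\<Sum>w\<leftarrow>ws'. free_gen w) \<in> vs1.tensor_null"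
    unfolding eq by (simp add: vs1.tensor_def)
  from F_null[OF this] show ?thesis by (simp add: F_diff F_list)
qed


section \<open>Coalgebras\<close>

locale comultiplication = tensor_space scale
  for scale :: "'k::field \<Rightarrow> 'a::ab_group_add \<Rightarrow> 'a" (infixr \<open>*s\<close> 75) +
  fixes \<Delta> :: "'a \<Rightarrow> ('a list \<Rightarrow>\<^sub>0 'k) set"
  assumes comult_in: "\<Delta> a \<in> tensor_power 2 UNIV"
    and comult_add: "\<Delta> (a + b) = tensor_add (\<Delta> a) (\<Delta> b)"
    and comult_scale: "\<Delta> (c *s a) = tensor_scale c (\<Delta> a)"
begin

text \<open>Sweedler notation: \<open>sw a\<close> is a choice of finitely many pairs \<open>(a1, a2)\<close> with
  \<open>\<Delta> a = \<Sum> a1 \<otimes> a2\<close>. By coassociativity it does not matter which factor is split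
  to get the iterated versions.\<close>

definition sw :: "'a \<Rightarrow> ('a \<times> 'a) list"
  where "sw a = (SOME ps. \<Delta> a = tensor [[x, y]. (x, y) \<leftarrow> ps])"

definition sw3 :: "'a \<Rightarrow> ('a \<times> 'a \<times> 'a) list"
  where "sw3 a = [(a1, b). (a1, t) \<leftarrow> sw a, b \<leftarrow> sw t]"

definition sw4 :: "'a \<Rightarrow> ('a \<times> 'a \<times> 'a \<times> 'a) list"
  where "sw4 a = [(a1, b). (a1, t) \<leftarrow> sw a, b \<leftarrow> sw3 t]"

definition sw5 :: "'a \<Rightarrow> ('a \<times> 'a \<times> 'a \<times> 'a \<times> 'a) list"
  where "sw5 a = [(a1, b). (a1, t) \<leftarrow> sw a, b \<leftarrow> sw4 t]"

lemma comult_sw: "\<Delta> a = tensor [[x, y]. (x, y) \<leftarrow> sw a]"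
proof -
  obtain ws where ws: "\<Delta> a = tensor ws" "\<forall>w \<in> set ws. length w = 2"
    using comult_in[of a] by (auto simp: tensor_power_def)
  define ps where "ps = map (\<lambda>w. (w ! 0, w ! 1)) ws"
  have "[[x, y]. (x, y) \<leftarrow> ps] = ws"
    unfolding ps_def using ws(2) by (induction ws) (auto simp: length_Suc_conv numeral_2_eq_2)
  then have "\<Delta> a = tensor [[x, y]. (x, y) \<leftarrow> ps]" using ws(1) by simp
  then have "\<exists>ps. \<Delta> a = tensor [[x, y]. (x, y) \<leftarrow> ps]" by (rule exI)
  then show ?thesis unfolding sw_def by (rule someI_ex)
qed

text \<open>Convolution product on the dual space.\<close>

definition conv :: "('a \<Rightarrow> 'k) \<Rightarrow> ('a \<Rightarrow> 'k) \<Rightarrow> ('a \<Rightarrow> 'k)"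
  where "conv f g a = (\<Sum>(a1, a2)\<leftarrow>sw a. f a1 * g a2)"

definition subcoalgebra :: "'a set \<Rightarrow> bool"
  where "subcoalgebra C \<longleftrightarrow> subspace C \<and> (\<forall>c\<in>C. \<Delta> c \<in> tensor_power 2 C)"

definition simple_subcoalgebra :: "'a set \<Rightarrow> bool"
  where "simple_subcoalgebra C \<longleftrightarrow> subcoalgebra C \<and> C \<noteq> {0} \<and>
    (\<forall>D. subcoalgebra D \<and> D \<subseteq> C \<longrightarrow> D = {0} \<or> D = C)"

definition cosemisimple :: bool
  where "cosemisimple \<longleftrightarrow> (\<exists>\<C>.
    (\<forall>C\<in>\<C>. simple_subcoalgebra C) \<and>
    span (\<Union>\<C>) = UNIV \<and>
    (\<forall>C\<in>\<C>. C \<inter> span (\<Union>(\<C> - {C})) = {0}))"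

end

locale coalgebra = comultiplication scale \<Delta>
  for scale :: "'k::field \<Rightarrow> 'a::ab_group_add \<Rightarrow> 'a" (infixr \<open>*s\<close> 75)
    and \<Delta> :: "'a \<Rightarrow> ('a list \<Rightarrow>\<^sub>0 'k) set" +
  fixes \<epsilon> :: "'a \<Rightarrow> 'k"
  assumes coassoc:
    "tensor [[x, y, a2]. (a1, a2) \<leftarrow> sw a, (x, y) \<leftarrow> sw a1] =
     tensor [[a1, x, y]. (a1, a2) \<leftarrow> sw a, (x, y) \<leftarrow> sw a2]"
    and counit_dual: "\<epsilon> \<in> dual_space"
    and counit_left: "(\<Sum>(a1, a2)\<leftarrow>sw a. \<epsilon> a1 *s a2) = a"
    and counit_right: "(\<Sum>(a1, a2)\<leftarrow>sw a. \<epsilon> a2 *s a1) = a"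


section \<open>Dual quasi-Hopf algebras\<close>

text \<open>Linear maps out of a tensor product are given as multilinear maps. The parameter
  \<open>\<psi>\<close> is the convolution inverse of the reassociator \<open>\<phi>\<close>, which is unique.\<close>

locale dual_quasi_bialgebra = coalgebra scale \<Delta> \<epsilon>
  for scale :: "'k::field \<Rightarrow> 'a::ab_group_add \<Rightarrow> 'a" (infixr \<open>*s\<close> 75)
    and \<Delta> :: "'a \<Rightarrow> ('a list \<Rightarrow>\<^sub>0 'k) set"
    and \<epsilon> :: "'a \<Rightarrow> 'k" +
  fixes mult :: "'a \<Rightarrow> 'a \<Rightarrow> 'a" (infixl \<open>\<cdot>\<close> 78)
    and unit :: 'a (\<open>\<one>\<close>)
    and \<phi> \<psi> :: "'a \<Rightarrow> 'a \<Rightarrow> 'a \<Rightarrow> 'k"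
  assumes mult_bilinear: "bilinear_map (\<cdot>)"
    and mult_comult:
      "\<Delta> (a \<cdot> b) = tensor [[a1 \<cdot> b1, a2 \<cdot> b2]. (a1, a2) \<leftarrow> sw a, (b1, b2) \<leftarrow> sw b]"
    and mult_counit: "\<epsilon> (a \<cdot> b) = \<epsilon> a * \<epsilon> b"
    and unit_comult: "\<Delta> \<one> = tensor [[\<one>, \<one>]]"
    and unit_counit: "\<epsilon> \<one> = 1"
    and phi_trilinear: "trilinear_form \<phi>"
    and psi_trilinear: "trilinear_form \<psi>"
    and phi_psi:
      "(\<Sum>(a1, a2)\<leftarrow>sw a. \<Sum>(b1, b2)\<leftarrow>sw b. \<Sum>(c1, c2)\<leftarrow>sw c. \<phi> a1 b1 c1 * \<psi> a2 b2 c2) =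
       \<epsilon> a * \<epsilon> b * \<epsilon> c"
    and psi_phi:
      "(\<Sum>(a1, a2)\<leftarrow>sw a. \<Sum>(b1, b2)\<leftarrow>sw b. \<Sum>(c1, c2)\<leftarrow>sw c. \<psi> a1 b1 c1 * \<phi> a2 b2 c2) =
       \<epsilon> a * \<epsilon> b * \<epsilon> c"
    and quasi_assoc:
      "(\<Sum>(a1, a2)\<leftarrow>sw a. \<Sum>(b1, b2)\<leftarrow>sw b. \<Sum>(c1, c2)\<leftarrow>sw c.
          \<phi> a2 b2 c2 *s (a1 \<cdot> (b1 \<cdot> c1))) =
       (\<Sum>(a1, a2)\<leftarrow>sw a. \<Sum>(b1, b2)\<leftarrow>sw b. \<Sum>(c1, c2)\<leftarrow>sw c.
          \<phi> a1 b1 c1 *s ((a2 \<cdot> b2) \<cdot> c2))"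
    and unit_left: "\<one> \<cdot> a = a"
    and unit_right: "a \<cdot> \<one> = a"
    and phi_cocycle:
      "(\<Sum>(a1, a2)\<leftarrow>sw a. \<Sum>(b1, b2)\<leftarrow>sw b. \<Sum>(c1, c2)\<leftarrow>sw c. \<Sum>(d1, d2)\<leftarrow>sw d.
          \<phi> a1 b1 (c1 \<cdot> d1) * \<phi> (a2 \<cdot> b2) c2 d2) =
       (\<Sum>(a1, a2)\<leftarrow>sw a. \<Sum>(b1, b2, b3)\<leftarrow>sw3 b. \<Sum>(c1, c2, c3)\<leftarrow>sw3 c. \<Sum>(d1, d2)\<leftarrow>sw d.
          \<phi> b1 c1 d1 * \<phi> a1 (b2 \<cdot> c2) d2 * \<phi> a2 b3 c3)"
    and phi_unit: "\<phi> a \<one> b = \<epsilon> a * \<epsilon> b"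
begin

definition left_integral :: "('a \<Rightarrow> 'k) \<Rightarrow> bool"
  where "left_integral T \<longleftrightarrow> T \<in> dual_space \<and>
    (\<forall>f\<in>dual_space. conv f T = (\<lambda>a. f \<one> * T a))"

end

locale dual_quasi_hopf_algebra = dual_quasi_bialgebra scale \<Delta> \<epsilon> mult unit \<phi> \<psi>
  for scale :: "'k::field \<Rightarrow> 'a::ab_group_add \<Rightarrow> 'a" (infixr \<open>*s\<close> 75)
    and \<Delta> :: "'a \<Rightarrow> ('a list \<Rightarrow>\<^sub>0 'k) set"
    and \<epsilon> :: "'a \<Rightarrow> 'k"
    and mult :: "'a \<Rightarrow> 'a \<Rightarrow> 'a" (infixl \<open>\<cdot>\<close> 78)
    and unit :: 'a (\<open>\<one>\<close>)
    and \<phi> \<psi> :: "'a \<Rightarrow> 'a \<Rightarrow> 'a \<Rightarrow> 'k" +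
  fixes S :: "'a \<Rightarrow> 'a"
    and \<alpha> \<beta> :: "'a \<Rightarrow> 'k"
  assumes antipode_linear: "Vector_Spaces.linear scale scale S"
    and antipode_comult: "\<Delta> (S a) = tensor [[S a2, S a1]. (a1, a2) \<leftarrow> sw a]"
    and antipode_counit: "\<epsilon> (S a) = \<epsilon> a"
    and alpha_dual: "\<alpha> \<in> dual_space"
    and beta_dual: "\<beta> \<in> dual_space"
    and antipode_alpha: "(\<Sum>(a1, a2, a3)\<leftarrow>sw3 a. \<alpha> a2 *s (S a1 \<cdot> a3)) = \<alpha> a *s \<one>"
    and antipode_beta: "(\<Sum>(a1, a2, a3)\<leftarrow>sw3 a. \<beta> a2 *s (a1 \<cdot> S a3)) = \<beta> a *s \<one>"
    and phi_antipode:
      "(\<Sum>(a1, a2, a3, a4, a5)\<leftarrow>sw5 a. \<phi> (\<beta> a2 *s a1) (S a3) (\<alpha> a4 *s a5)) = \<epsilon> a"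
    and psi_antipode:
      "(\<Sum>(a1, a2, a3, a4, a5)\<leftarrow>sw5 a. \<psi> (S a1) (\<alpha> a2 *s a3) (\<beta> a4 *s S a5)) = \<epsilon> a"
    \<comment> \<open>the remaining axioms only give \<open>\<alpha> \<one> * \<beta> \<one> = 1\<close>; rescaling the pair
      \<open>(\<alpha>, \<beta>)\<close> to \<open>(c \<alpha>, c\<inverse> \<beta>)\<close> achieves this normalization\<close>
    and alpha_unit: "\<alpha> \<one> = 1"
    and beta_unit: "\<beta> \<one> = 1"
begin

definition involutory :: bool
  where "involutory \<longleftrightarrow> (\<forall>a. S (S a) =
    (\<Sum>(a1, a2, a3, a4, a5)\<leftarrow>sw5 a. (\<beta> (S a1) * \<alpha> a2 * \<beta> a4 * \<alpha> (S a5)) *s a3))"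

end

end

theory Submission
  imports Defs
begin

text \<open>
  An integral \<open>T\<close> with \<open>T(1) = 1\<close> makes \<open>A\<close> coseparable, through the form
  \<open>\<phi>(y1, S(a2), \<alpha>(a3) a4) \<beta>(y3) T(y2 S(a1))\<close>, and a coseparable coalgebra is cosemisimple: the form
  averages a linear projection onto a subcoalgebra to a bicolinear one.

  Such an integral is a trace. If \<open>T\<close> is a nonzero left integral and \<open>T(x) = 1\<close>, then
  \<open>f(a) = \<psi>(S(x1), \<alpha>(x2) x3, a1) T(x4 a2)\<close> satisfies \<open>f(1) = 1\<close> and \<open>a1 f(a2) = S(x1) f'(a)\<close> with \<open>f'\<close>
  formed from \<open>x2\<close>. Hence \<open>a \<mapsto> a1 f(a2)\<close> is a colinear map of finite rank that fixes 1, and by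
  Fitting's lemma there is a colinear projection \<open>P\<close> of \<open>A\<close> onto a nonzero finite-dimensional left
  coideal \<open>M\<close>. Since \<open>A\<close> is involutory, the form \<open>w = \<beta> * (\<alpha> S) * (\<beta> S)\<close> is convolution inverse to
  \<open>\<alpha>\<close> and satisfies \<open>S(a3) w(a2) a1 = w(a) 1\<close>, so that the partial trace of \<open>m \<otimes> a \<mapsto> P(m a)\<close> over
  \<open>M\<close> is a left integral. Its value at 1 is \<open>dim M\<close>, which is nonzero in characteristic zero.
\<close>

section \<open>Dual spaces and tensors of length two\<close>

text \<open>Nonassociativity shapes the argument. In a Hopf algebra, y1 T(y2 S(a)) = T(y S(a1)) a2
  and its companion for T(x a) follow by inserting a pair of the form S(a2) a3 and using invariance
  of T. Here the inserted pair is bracketed differently from what invariance requires, so each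
  pairing carries a coefficient, \<open>psi_alpha\<close> or \<open>phi_alpha\<close>, that pays for
  the rebracketing.

  A left integral is a colinear map from A to k, so traces are natural candidates. As A may have
  infinite dimension, the trace is taken over a direct summand M; the fixed vector 1 keeps M from
  being zero. The pairing that closes the trace has its antipode on the opposite side from the axiom
  for \<beta>. The involutory condition repairs this: it amounts to S^2 being conjugation by u =
  (\<beta> S) * \<alpha> in the sense of convolution, and w is u^-1 * (\<beta> S). Because w cancels
  \<alpha>, the value at 1 is an ordinary dimension and not a quantum dimension, which could
  vanish.\<close>

context tensor_space
begin

lemma dual_space_iff:
  "f \<in> dual_space \<longleftrightarrow> (\<forall>x y. f (x + y) = f x + f y) \<and> (\<forall>c x. f (c *s x) = c * f x)"
proof -
  have *: "vector_space ((*) :: 'a \<Rightarrow> 'a \<Rightarrow> 'a)"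
    by unfold_locales (simp_all add: algebra_simps)
  then interpret vector_space_pair scale "(*) :: 'a \<Rightarrow> 'a \<Rightarrow> 'a"
    by (simp add: vector_space_pair_def vector_space_axioms)
  show ?thesis by (simp add: dual_space_def linear_iff vector_space_axioms *)
qed

lemma linear_self_iff:
  "Vector_Spaces.linear scale scale f \<longleftrightarrow> (\<forall>x y. f (x + y) = f x + f y) \<and> (\<forall>c x. f (c *s x) = c *s f x)"
proof -
  interpret vector_space_pair scale scale
    by (simp add: vector_space_pair_def vector_space_axioms)
  show ?thesis by (simp add: linear_iff vector_space_axioms)
qed

lemma dual_add: "f \<in> dual_space \<Longrightarrow> f (x + y) = f x + f y"
  and dual_scale: "f \<in> dual_space \<Longrightarrow> f (c *s x) = c * f x"
  by (simp_all add: dual_space_iff)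

lemma dual_zero: "f \<in> dual_space \<Longrightarrow> f 0 = 0"
  using dual_scale[of f 0 0] by simp

lemma dual_diff: "f \<in> dual_space \<Longrightarrow> f (x - y) = f x - f y"
  using dual_add[of f "x - y" y] by simp

lemma dual_sum: "f \<in> dual_space \<Longrightarrow> f (\<Sum>i\<in>I. g i) = (\<Sum>i\<in>I. f (g i))"
  by (induction I rule: infinite_finite_induct) (simp_all add: dual_zero dual_add)

lemma dual_sum_list: "f \<in> dual_space \<Longrightarrow> f (\<Sum>i\<leftarrow>is. g i) = (\<Sum>i\<leftarrow>is. f (g i))"
  by (induction "is") (simp_all add: dual_zero dual_add)

lemma linear_add: "Vector_Spaces.linear scale scale g \<Longrightarrow> g (x + y) = g x + g y"
  and linear_scale: "Vector_Spaces.linear scale scale g \<Longrightarrow> g (c *s x) = c *s g x"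
  by (simp_all add: linear_self_iff)

lemma dual_comp:
  "f \<in> dual_space \<Longrightarrow> Vector_Spaces.linear scale scale g \<Longrightarrow> (\<lambda>x. f (g x)) \<in> dual_space"
  by (simp add: dual_space_iff linear_self_iff)

lemma dual_cmult_left: "f \<in> dual_space \<Longrightarrow> (\<lambda>x. c * f x) \<in> dual_space"
  and dual_cmult_right: "f \<in> dual_space \<Longrightarrow> (\<lambda>x. f x * c) \<in> dual_space"
  and dual_plus: "f \<in> dual_space \<Longrightarrow> g \<in> dual_space \<Longrightarrow> (\<lambda>x. f x + g x) \<in> dual_space"
  by (simp_all add: dual_space_iff algebra_simps)

lemma dual_const_zero: "(\<lambda>x. 0) \<in> dual_space"
  by (simp add: dual_space_iff)

lemma dual_sum_fun: "(\<And>i. i \<in> I \<Longrightarrow> f i \<in> dual_space) \<Longrightarrow> (\<lambda>x. \<Sum>i\<in>I. f i x) \<in> dual_space"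
  by (induction I rule: infinite_finite_induct) (simp_all add: dual_const_zero dual_plus)

lemma linear_id_fun: "Vector_Spaces.linear scale scale (\<lambda>x. x)"
  by (simp add: linear_self_iff)

text \<open>A nonzero vector belongs to a basis, so some functional is 1 on it. Identities between
  vectors are tested this way throughout, which lets all Sweedler sums take values in k.\<close>

lemma dual_separates:
  assumes "\<And>f. f \<in> dual_space \<Longrightarrow> f x = f y"
  shows "x = y"
proof (rule ccontr)
  assume "x \<noteq> y"
  have "vector_space ((*) :: 'a \<Rightarrow> 'a \<Rightarrow> 'a)"
    by unfold_locales (simp_all add: algebra_simps)
  then interpret vector_space_pair scale "(*) :: 'a \<Rightarrow> 'a \<Rightarrow> 'a"
    by (simp add: vector_space_pair_def vector_space_axioms)
  have "independent {x - y}" using \<open>x \<noteq> y\<close> by simp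
  from linear_independent_extend[OF this, of "\<lambda>_. 1"] obtain g
    where "Vector_Spaces.linear scale (*) g" "g (x - y) = 1" by auto
  then show False
    using assms[of g] dual_diff[of g x y] by (auto simp: dual_space_def)
qed

text \<open>A basis \<open>B\<close> of \<open>C\<close> is extended to a basis of the whole space,
  and \<open>co\<close> are its coordinates. They must be defined everywhere because the legs of a
  comultiplication are not known in advance to lie in \<open>C\<close>; on \<open>C\<close> only
  coordinates from \<open>B\<close> survive.\<close>

lemma coordinate_functionals:
  assumes "subspace C"
  obtains B co where "B \<subseteq> C" "\<And>b. co b \<in> dual_space"
    "\<And>x. finite {b. co b x \<noteq> 0}" "\<And>x. (\<Sum>b | co b x \<noteq> 0. co b x *s b) = x"
    "\<forall>x\<in>C. \<forall>b. co b x \<noteq> 0 \<longrightarrow> b \<in> B"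
proof -
  obtain B where B: "B \<subseteq> C" "independent B" "C \<subseteq> span B"
    using basis_exists by metis
  obtain B' where B': "B \<subseteq> B'" "independent B'" "span B' = UNIV"
    by (rule maximal_independent_subset_extend[OF subset_UNIV B(2)]) auto
  define co where "co b x = representation B' x b" for b x
  show thesis
  proof (rule that[of B co])
    show "co b \<in> dual_space" for b
      using linear_representation[OF B'(2,3), of b] by (simp add: co_def[abs_def] dual_space_def)
    show "finite {b. co b x \<noteq> 0}" for x
      by (simp add: co_def finite_representation)
    show "(\<Sum>b | co b x \<noteq> 0. co b x *s b) = x" for x
      using sum_nonzero_representation_eq[OF B'(2), of x] B'(3) by (simp add: co_def)
    show "\<forall>x\<in>C. \<forall>b. co b x \<noteq> 0 \<longrightarrow> b \<in> B"
    proof (intro ballI allI impI)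
      fix x b assume that: "x \<in> C" "co b x \<noteq> 0"
      have "representation B' x = representation B x"
        using B B' that by (intro representation_extend) auto
      then show "b \<in> B" using that by (metis co_def representation_ne_zero)
    qed
  qed (use B B' in auto)
qed

lemma linear_projection:
  assumes "subspace C"
  obtains pr where "Vector_Spaces.linear scale scale pr" "\<And>x. pr x \<in> C" "\<And>x. x \<in> C \<Longrightarrow> pr x = x"
proof -
  interpret vector_space_pair scale scale
    by (simp add: vector_space_pair_def vector_space_axioms)
  obtain B where B: "B \<subseteq> C" "independent B" "C \<subseteq> span B"
    using basis_exists by metis
  then have [simp]: "span B = C" using assms by (simp add: span_subspace)
  obtain g where g: "Vector_Spaces.linear scale scale g" "\<forall>x\<in>B. g x = x" "range g = span B"
    using linear_independent_extend_subspace[OF B(2), of "\<lambda>x. x"] by auto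
  have "g x = x" if "x \<in> C" for x
  proof -
    have "x \<in> span B" using that by simp
    from linear_eq_on[OF g(1) linear_id_fun this] g(2) show ?thesis by auto
  qed
  then show thesis using that[of g] g by auto
qed

section \<open>Equality of tensors and expansion of their legs\<close>

lemma tensor_eq_iff:
  "tensor ws = tensor ws' \<longleftrightarrow> (\<Sum>w\<leftarrow>ws. free_gen w) - (\<Sum>w\<leftarrow>ws'. free_gen w) \<in> tensor_null"
  (is "_ \<longleftrightarrow> ?d \<in> _")
proof
  assume "tensor ws = tensor ws'"
  moreover have "(\<Sum>w\<leftarrow>ws. free_gen w) \<in> tensor ws"
    by (simp add: tensor_def tensor_null_def free_vs.span_zero)
  ultimately show "?d \<in> tensor_null" by (simp add: tensor_def)
next
  assume d: "?d \<in> tensor_null"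
  have "u - (\<Sum>w\<leftarrow>ws. free_gen w) \<in> tensor_null \<longleftrightarrow> u - (\<Sum>w\<leftarrow>ws'. free_gen w) \<in> tensor_null" for u
  proof -
    have "u - (\<Sum>w\<leftarrow>ws'. free_gen w) = ?d + (u - (\<Sum>w\<leftarrow>ws. free_gen w))" by simp
    then show ?thesis using d unfolding tensor_null_def by (simp only: free_vs.span_add_eq)
  qed
  then show "tensor ws = tensor ws'" by (simp add: tensor_def)
qed

lemma tensor_null_add: "u \<in> tensor_null \<Longrightarrow> v \<in> tensor_null \<Longrightarrow> u + v \<in> tensor_null"
  and tensor_null_diff: "u \<in> tensor_null \<Longrightarrow> v \<in> tensor_null \<Longrightarrow> u - v \<in> tensor_null"
  and tensor_null_scale: "u \<in> tensor_null \<Longrightarrow> free_scale c u \<in> tensor_null"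
  and tensor_null_zero: "0 \<in> tensor_null"
  by (simp_all add: tensor_null_def free_vs.span_add free_vs.span_diff free_vs.span_scale free_vs.span_zero)

lemma free_gen_add:
  "free_gen (xs @ (x + y) # ys) - free_gen (xs @ x # ys) - free_gen (xs @ y # ys) \<in> tensor_null"
  unfolding tensor_null_def tensor_relators_def by (rule free_vs.span_base) blast

lemma free_gen_scale:
  "free_gen (xs @ (c *s x) # ys) - free_scale c (free_gen (xs @ x # ys)) \<in> tensor_null"
  unfolding tensor_null_def tensor_relators_def by (rule free_vs.span_base) blast

lemma free_gen_zero: "free_gen (xs @ 0 # ys) \<in> tensor_null"
  using free_gen_scale[of xs 0 0 ys] by simp

lemma free_gen_sum_list:
  "free_gen (xs @ (\<Sum>i\<leftarrow>is. h i) # ys) - (\<Sum>i\<leftarrow>is. free_gen (xs @ h i # ys)) \<in> tensor_null"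
proof (induction "is")
  case Nil
  show ?case by (simp add: free_gen_zero)
next
  case (Cons i "is")
  from tensor_null_add[OF this free_gen_add[of xs "h i" "\<Sum>i\<leftarrow>is. h i" ys]]
  show ?case by (simp add: algebra_simps)
qed

lemma free_gen_move_scale:
  "free_gen [c *s x, y] - free_gen [x, c *s y] \<in> tensor_null"
  using tensor_null_diff[OF free_gen_scale[of "[]" c x "[y]"] free_gen_scale[of "[x]" c y "[]"]] by simp

lemma sum_list_null:
  "(\<And>i. i \<in> set is \<Longrightarrow> f i - g i \<in> tensor_null) \<Longrightarrow> (\<Sum>i\<leftarrow>is. f i) - (\<Sum>i\<leftarrow>is. g i) \<in> tensor_null"
proof (induction "is")
  case (Cons i "is")
  then have "(f i - g i) + ((\<Sum>i\<leftarrow>is. f i) - (\<Sum>i\<leftarrow>is. g i)) \<in> tensor_null"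
    by (intro tensor_null_add) auto
  then show ?case by (simp add: algebra_simps)
qed (simp add: tensor_null_zero)

text \<open>Coefficients move across the tensor sign and terms with the same \<open>b\<close> are
  collected. For the legs of \<open>\<Delta> c\<close> the collected right leg is
  \<open>hitL (co b) c\<close>, which is how tensors are controlled by functionals.\<close>

lemma tensor_expand_left:
  assumes "\<And>x y. (x, y) \<in> set ps \<Longrightarrow> x = (\<Sum>b\<leftarrow>bs. co b x *s b)"
  shows "tensor [[x, y]. (x, y) \<leftarrow> ps] = tensor [[b, \<Sum>(x, y)\<leftarrow>ps. co b x *s y]. b \<leftarrow> bs]"
proof -
  have "(\<Sum>p\<leftarrow>ps. free_gen [fst p, snd p]) -
      (\<Sum>b\<leftarrow>bs. free_gen [b, \<Sum>p\<leftarrow>ps. co b (fst p) *s snd p]) \<in> tensor_null"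
    using assms
  proof (induction ps)
    case Nil
    have "(\<Sum>b\<leftarrow>bs. 0) - (\<Sum>b\<leftarrow>bs. free_gen [b, 0]) \<in> tensor_null"
      by (rule sum_list_null)
        (use tensor_null_diff[OF tensor_null_zero free_gen_zero[of "[b]" "[]" for b]] in auto)
    then show ?case by simp
  next
    case (Cons p ps)
    obtain x y where p: "p = (x, y)" by force
    let ?r = "\<lambda>b. \<Sum>p\<leftarrow>ps. co b (fst p) *s snd p"
    let ?t = "\<lambda>b. free_gen [b, co b x *s y] :: 'b list \<Rightarrow>\<^sub>0 'a"
    have IH: "(\<Sum>p\<leftarrow>ps. free_gen [fst p, snd p]) - (\<Sum>b\<leftarrow>bs. free_gen [b, ?r b]) \<in> tensor_null"
      using Cons by auto
    have x: "x = (\<Sum>b\<leftarrow>bs. co b x *s b)" using Cons.prems p by auto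
    have 1: "free_gen [x, y] - (\<Sum>b\<leftarrow>bs. free_gen [co b x *s b, y]) \<in> tensor_null"
      using free_gen_sum_list[of "[]" "\<lambda>b. co b x *s b" bs "[y]"] x by simp
    have 2: "(\<Sum>b\<leftarrow>bs. free_gen [co b x *s b, y]) - (\<Sum>b\<leftarrow>bs. ?t b) \<in> tensor_null"
      by (rule sum_list_null) (rule free_gen_move_scale)
    have 3: "(\<Sum>b\<leftarrow>bs. free_gen [b, co b x *s y + ?r b]) - (\<Sum>b\<leftarrow>bs. ?t b + free_gen [b, ?r b]) \<in> tensor_null"
      by (rule sum_list_null) (use free_gen_add[of "[b]" _ _ "[]" for b] in \<open>simp add: algebra_simps\<close>)
    from tensor_null_diff[OF tensor_null_add[OF tensor_null_add[OF 1 2] IH] 3]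
    show ?case by (simp add: p sum_list_addf algebra_simps)
  qed
  then show ?thesis by (simp add: tensor_eq_iff comp_def case_prod_unfold)
qed

lemma tensor_expand_right:
  assumes "\<And>x y. (x, y) \<in> set ps \<Longrightarrow> y = (\<Sum>b\<leftarrow>bs. co b y *s b)"
  shows "tensor [[x, y]. (x, y) \<leftarrow> ps] = tensor [[\<Sum>(x, y)\<leftarrow>ps. co b y *s x, b]. b \<leftarrow> bs]"
proof -
  have "(\<Sum>p\<leftarrow>ps. free_gen [fst p, snd p]) -
      (\<Sum>b\<leftarrow>bs. free_gen [\<Sum>p\<leftarrow>ps. co b (snd p) *s fst p, b]) \<in> tensor_null"
    using assms
  proof (induction ps)
    case Nil
    have "(\<Sum>b\<leftarrow>bs. 0) - (\<Sum>b\<leftarrow>bs. free_gen [0, b]) \<in> tensor_null"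
      by (rule sum_list_null)
        (use tensor_null_diff[OF tensor_null_zero free_gen_zero[of "[]" "[b]" for b]] in auto)
    then show ?case by simp
  next
    case (Cons p ps)
    obtain x y where p: "p = (x, y)" by force
    let ?r = "\<lambda>b. \<Sum>p\<leftarrow>ps. co b (snd p) *s fst p"
    let ?t = "\<lambda>b. free_gen [co b y *s x, b] :: 'b list \<Rightarrow>\<^sub>0 'a"
    have IH: "(\<Sum>p\<leftarrow>ps. free_gen [fst p, snd p]) - (\<Sum>b\<leftarrow>bs. free_gen [?r b, b]) \<in> tensor_null"
      using Cons by auto
    have y: "y = (\<Sum>b\<leftarrow>bs. co b y *s b)" using Cons.prems p by auto
    have 1: "free_gen [x, y] - (\<Sum>b\<leftarrow>bs. free_gen [x, co b y *s b]) \<in> tensor_null"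
      using free_gen_sum_list[of "[x]" "\<lambda>b. co b y *s b" bs "[]"] y by simp
    have 2: "(\<Sum>b\<leftarrow>bs. ?t b) - (\<Sum>b\<leftarrow>bs. free_gen [x, co b y *s b]) \<in> tensor_null"
      by (rule sum_list_null) (rule free_gen_move_scale)
    have 3: "(\<Sum>b\<leftarrow>bs. free_gen [co b y *s x + ?r b, b]) - (\<Sum>b\<leftarrow>bs. ?t b + free_gen [?r b, b]) \<in> tensor_null"
      by (rule sum_list_null) (use free_gen_add[of "[]" _ _ "[b]" for b] in \<open>simp add: algebra_simps\<close>)
    from tensor_null_diff[OF tensor_null_add[OF tensor_null_diff[OF 1 2] IH] 3]
    show ?case by (simp add: p sum_list_addf algebra_simps)
  qed
  then show ?thesis by (simp add: tensor_eq_iff comp_def case_prod_unfold)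
qed

lemma tensor_add_tensor: "tensor_add (tensor ws) (tensor ws') = tensor (ws @ ws')"
proof (intro equalityI subsetI)
  fix z assume "z \<in> tensor_add (tensor ws) (tensor ws')"
  then obtain u v where uv: "z = u + v" "u - (\<Sum>w\<leftarrow>ws. free_gen w) \<in> tensor_null"
    "v - (\<Sum>w\<leftarrow>ws'. free_gen w) \<in> tensor_null"
    by (auto simp: tensor_add_def tensor_def)
  from tensor_null_add[OF uv(2,3)] show "z \<in> tensor (ws @ ws')"
    by (simp add: tensor_def uv(1) algebra_simps)
next
  fix z assume "z \<in> tensor (ws @ ws')"
  then have "z - (\<Sum>w\<leftarrow>ws'. free_gen w) \<in> tensor ws" by (simp add: tensor_def algebra_simps)
  moreover have "(\<Sum>w\<leftarrow>ws'. free_gen w) \<in> tensor ws'" by (simp add: tensor_def tensor_null_zero)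
  ultimately have "(z - (\<Sum>w\<leftarrow>ws'. free_gen w)) + (\<Sum>w\<leftarrow>ws'. free_gen w) \<in> tensor_add (tensor ws) (tensor ws')"
    unfolding tensor_add_def by blast
  then show "z \<in> tensor_add (tensor ws) (tensor ws')" by simp
qed

lemma tensor_scale_tensor:
  "tensor_scale c (tensor [[x, y]. (x, y) \<leftarrow> ps]) = tensor [[c *s x, y]. (x, y) \<leftarrow> ps]"
proof -
  let ?s = "\<Sum>p\<leftarrow>ps. free_gen [fst p, snd p] :: 'b list \<Rightarrow>\<^sub>0 'a"
  let ?t = "\<Sum>p\<leftarrow>ps. free_gen [c *s fst p, snd p] :: 'b list \<Rightarrow>\<^sub>0 'a"
  have st: "?t - free_scale c ?s \<in> tensor_null"
  proof (induction ps)
    case (Cons p ps)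
    from tensor_null_add[OF this free_gen_scale[of "[]" c "fst p" "[snd p]"]]
    show ?case by (simp add: free_vs.scale_right_distrib algebra_simps)
  qed (simp add: tensor_null_zero)
  have "z \<in> tensor_scale c (tensor [[x, y]. (x, y) \<leftarrow> ps]) \<longleftrightarrow> z - ?t \<in> tensor_null" for z
  proof
    assume "z \<in> tensor_scale c (tensor [[x, y]. (x, y) \<leftarrow> ps])"
    then obtain u v where uv: "z = free_scale c u + v" "u - ?s \<in> tensor_null" "v \<in> tensor_null"
      by (auto simp: tensor_scale_def tensor_def comp_def case_prod_unfold)
    from tensor_null_diff[OF tensor_null_add[OF tensor_null_scale[OF uv(2), of c] uv(3)] st]
    show "z - ?t \<in> tensor_null"
      by (simp add: uv(1) free_vs.scale_right_diff_distrib algebra_simps)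
  next
    assume "z - ?t \<in> tensor_null"
    from tensor_null_add[OF this st] have "z - free_scale c ?s \<in> tensor_null" by simp
    moreover have "?s \<in> tensor [[x, y]. (x, y) \<leftarrow> ps]"
      by (simp add: tensor_def comp_def case_prod_unfold tensor_null_zero)
    ultimately have "free_scale c ?s + (z - free_scale c ?s) \<in> tensor_scale c (tensor [[x, y]. (x, y) \<leftarrow> ps])"
      unfolding tensor_scale_def by blast
    then show "z \<in> tensor_scale c (tensor [[x, y]. (x, y) \<leftarrow> ps])" by simp
  qed
  then show ?thesis by (auto simp: tensor_def comp_def case_prod_unfold)
qed

end

section \<open>Sweedler sums\<close>

context comultiplication
begin

text \<open>The chosen list \<open>sw a\<close> enters, so the value is canonical only for bilinear
  \<open>F\<close>. This is why the rules that change the representative carry linearity conditions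
  on each argument, discharged later by collections of introduction rules.\<close>

definition Sw :: "'a \<Rightarrow> ('a \<Rightarrow> 'a \<Rightarrow> 'k) \<Rightarrow> 'k"
  where "Sw a F = (\<Sum>(x, y)\<leftarrow>sw a. F x y)"

lemma vector_space_mult: "vector_space ((*) :: 'k \<Rightarrow> 'k \<Rightarrow> 'k)"
  by unfold_locales (simp_all add: algebra_simps)

lemma list_cases2: "xs = [] \<or> (\<exists>u. xs = [u]) \<or> (\<exists>u v r. xs = u # v # r)"
  by (cases xs; cases "tl xs") auto

lemma list_cases3:
  "xs = [] \<or> (\<exists>u. xs = [u]) \<or> (\<exists>u v. xs = [u, v]) \<or> (\<exists>u v t r. xs = u # v # t # r)"
  by (cases xs; cases "tl xs"; cases "tl (tl xs)") auto

lemma sum_tensor2_cong: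
  assumes "\<And>y. (\<lambda>x. F x y) \<in> dual_space" "\<And>x. F x \<in> dual_space"
    and "tensor [[x, y]. (x, y) \<leftarrow> ps] = tensor [[x, y]. (x, y) \<leftarrow> qs]"
  shows "(\<Sum>(x, y)\<leftarrow>ps. F x y) = (\<Sum>(x, y)\<leftarrow>qs. F x y)"
proof -
  \<comment> \<open>\<open>sum_tensor_cong\<close> expects a map on words of every length. The value
    0 off length two keeps it additive and homogeneous in each slot, since the relations preserve
    length.\<close>
  define f where "f w = (if length w = 2 then F (w ! 0) (w ! 1) else 0)" for w
  have "(\<Sum>w\<leftarrow>[[x, y]. (x, y) \<leftarrow> ps]. f w) = (\<Sum>w\<leftarrow>[[x, y]. (x, y) \<leftarrow> qs]. f w)"
  proof (rule sum_tensor_cong[OF vector_space_axioms vector_space_mult _ _ assms(3)])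
    fix xs ys :: "'a list" and x y :: 'a and c :: 'k
    have cs: "xs = [] \<or> (\<exists>u. xs = [u]) \<or> (\<exists>u v r. xs = u # v # r)"
      "ys = [] \<or> (\<exists>u. ys = [u]) \<or> (\<exists>u v r. ys = u # v # r)"
      by (rule list_cases2)+
    show "f (xs @ (x + y) # ys) = f (xs @ x # ys) + f (xs @ y # ys)"
      "f (xs @ (c *s x) # ys) = c * f (xs @ x # ys)"
      using cs by (auto simp: f_def dual_add[OF assms(1)] dual_add[OF assms(2)]
          dual_scale[OF assms(1)] dual_scale[OF assms(2)])
  qed
  then show ?thesis by (simp add: comp_def case_prod_unfold f_def)
qed

lemma sum_tensor3_cong:
  assumes "\<And>y z. (\<lambda>x. F x y z) \<in> dual_space" "\<And>x z. (\<lambda>y. F x y z) \<in> dual_space"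
    "\<And>x y. F x y \<in> dual_space"
    and "tensor [[x, y, z]. (x, y, z) \<leftarrow> ps] = tensor [[x, y, z]. (x, y, z) \<leftarrow> qs]"
  shows "(\<Sum>(x, y, z)\<leftarrow>ps. F x y z) = (\<Sum>(x, y, z)\<leftarrow>qs. F x y z)"
proof -
  define f where "f w = (if length w = 3 then F (w ! 0) (w ! 1) (w ! 2) else 0)" for w
  have "(\<Sum>w\<leftarrow>[[x, y, z]. (x, y, z) \<leftarrow> ps]. f w) = (\<Sum>w\<leftarrow>[[x, y, z]. (x, y, z) \<leftarrow> qs]. f w)"
  proof (rule sum_tensor_cong[OF vector_space_axioms vector_space_mult _ _ assms(4)])
    fix xs ys :: "'a list" and x y :: 'a and c :: 'k
    have cs: "xs = [] \<or> (\<exists>u. xs = [u]) \<or> (\<exists>u v. xs = [u, v]) \<or> (\<exists>u v t r. xs = u # v # t # r)"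
      "ys = [] \<or> (\<exists>u. ys = [u]) \<or> (\<exists>u v. ys = [u, v]) \<or> (\<exists>u v t r. ys = u # v # t # r)"
      by (rule list_cases3)+
    show "f (xs @ (x + y) # ys) = f (xs @ x # ys) + f (xs @ y # ys)"
      "f (xs @ (c *s x) # ys) = c * f (xs @ x # ys)"
      using cs by (auto simp: f_def dual_add[OF assms(1)] dual_add[OF assms(2)] dual_add[OF assms(3)]
          dual_scale[OF assms(1)] dual_scale[OF assms(2)] dual_scale[OF assms(3)])
  qed
  then show ?thesis by (simp add: comp_def case_prod_unfold f_def)
qed

lemma Sw_eqI:
  assumes "\<And>y. (\<lambda>x. F x y) \<in> dual_space" "\<And>x. F x \<in> dual_space"
    and "\<Delta> a = tensor [[x, y]. (x, y) \<leftarrow> ps]"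
  shows "Sw a F = (\<Sum>(x, y)\<leftarrow>ps. F x y)"
  unfolding Sw_def
  by (rule sum_tensor2_cong[OF assms(1,2)]) (simp_all add: assms(3) flip: comult_sw)

lemma Sw_product_eqI:
  assumes "f \<in> dual_space" "h \<in> dual_space"
    and "\<Delta> a = tensor [[x, y]. (x, y) \<leftarrow> ps]"
  shows "Sw a (\<lambda>x y. f x * h y) = (\<Sum>(x, y)\<leftarrow>ps. f x * h y)"
  by (rule Sw_eqI[OF dual_cmult_right[OF assms(1)] dual_cmult_left[OF assms(2)] assms(3)])

lemma Sw_linear:
  assumes "\<And>y. (\<lambda>x. F x y) \<in> dual_space" "\<And>x. F x \<in> dual_space"
  shows "(\<lambda>a. Sw a F) \<in> dual_space"
proof -
  have "Sw (a + b) F = Sw a F + Sw b F" for a b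
  proof -
    have "\<Delta> (a + b) = tensor [[x, y]. (x, y) \<leftarrow> sw a @ sw b]"
      by (simp add: comult_add comult_sw[of a] comult_sw[of b] tensor_add_tensor)
    from Sw_eqI[OF assms this] show ?thesis by (simp add: Sw_def)
  qed
  moreover have "Sw (c *s a) F = c * Sw a F" for c a
  proof -
    have "\<Delta> (c *s a) = tensor [[x, y]. (x, y) \<leftarrow> [(c *s x, y). (x, y) \<leftarrow> sw a]]"
      unfolding comult_scale comult_sw[of a] tensor_scale_tensor
      by (simp add: comp_def case_prod_unfold)
    from Sw_eqI[OF assms this] show ?thesis
      by (simp add: Sw_def comp_def case_prod_unfold sum_list_const_mult dual_scale[OF assms(1)])
  qed
  ultimately show ?thesis by (simp add: dual_space_iff)
qed

lemma Sw_dual_inner: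
  assumes "\<And>u v. (\<lambda>x. F x u v) \<in> dual_space"
  shows "(\<lambda>x. Sw a (F x)) \<in> dual_space"
proof -
  have "(\<lambda>x. \<Sum>p\<leftarrow>ps. F x (fst p) (snd p)) \<in> dual_space" for ps
    by (induction ps) (use assms in \<open>auto intro: dual_const_zero dual_plus\<close>)
  then show ?thesis by (simp add: Sw_def case_prod_unfold)
qed

lemma Sw_dual_outer:
  assumes "Vector_Spaces.linear scale scale g"
    and "\<And>y. (\<lambda>x. F x y) \<in> dual_space" "\<And>x. (\<lambda>y. F x y) \<in> dual_space"
  shows "(\<lambda>x. Sw (g x) F) \<in> dual_space"
  using dual_comp[OF Sw_linear assms(1)] assms(2,3) by simp

lemma Sw_swap: "Sw a (\<lambda>x y. Sw b (\<lambda>u v. F x y u v)) = Sw b (\<lambda>u v. Sw a (\<lambda>x y. F x y u v))"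
proof -
  have "(\<Sum>p\<leftarrow>ps. \<Sum>q\<leftarrow>qs. G p q) = (\<Sum>q\<leftarrow>qs. \<Sum>p\<leftarrow>ps. G p q)"
    for ps qs :: "('a \<times> 'a) list" and G :: "_ \<Rightarrow> _ \<Rightarrow> 'k"
    by (induction ps) (simp_all add: sum_list_addf)
  then show ?thesis by (simp add: Sw_def case_prod_unfold)
qed

lemma Sw_mult_left: "c * Sw a F = Sw a (\<lambda>x y. c * F x y)"
  and Sw_mult_right: "Sw a F * c = Sw a (\<lambda>x y. F x y * c)"
  by (simp_all add: Sw_def case_prod_unfold sum_list_const_mult sum_list_mult_const)

lemma Sw_sum: "Sw a (\<lambda>x y. \<Sum>i\<in>I. F i x y) = (\<Sum>i\<in>I. Sw a (F i))"
proof -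
  have "(\<Sum>p\<leftarrow>ps. \<Sum>i\<in>I. G i p) = (\<Sum>i\<in>I. \<Sum>p\<leftarrow>ps. G i p)"
    for ps :: "('a \<times> 'a) list" and G :: "_ \<Rightarrow> _ \<Rightarrow> 'k"
    by (induction ps) (simp_all add: sum.distrib)
  then show ?thesis by (simp add: Sw_def case_prod_unfold)
qed

lemma conv_Sw: "conv f g a = Sw a (\<lambda>x y. f x * g y)"
  by (simp add: conv_def Sw_def)

section \<open>The two actions of the dual algebra on a coalgebra\<close>

text \<open>\<open>hitL f a\<close> is f(a1) a2, a right action of the convolution algebra, and
  \<open>hitR f a\<close> is a1 f(a2), a left action. They commute by coassociativity, and
  subcoalgebras are the subspaces stable under both.\<close>

definition hitL :: "('a \<Rightarrow> 'k) \<Rightarrow> 'a \<Rightarrow> 'a"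
  where "hitL f a = (\<Sum>(x, y)\<leftarrow>sw a. f x *s y)"

definition hitR :: "('a \<Rightarrow> 'k) \<Rightarrow> 'a \<Rightarrow> 'a"
  where "hitR f a = (\<Sum>(x, y)\<leftarrow>sw a. f y *s x)"

lemma dual_hitL: "h \<in> dual_space \<Longrightarrow> h (hitL f a) = Sw a (\<lambda>x y. f x * h y)"
  and dual_hitR: "h \<in> dual_space \<Longrightarrow> h (hitR f a) = Sw a (\<lambda>x y. h x * f y)"
  by (simp_all add: hitL_def hitR_def Sw_def case_prod_unfold dual_sum_list dual_scale mult.commute)

lemma linearI_dual:
  assumes "\<And>h. h \<in> dual_space \<Longrightarrow> (\<lambda>x. h (g x)) \<in> dual_space"
  shows "Vector_Spaces.linear scale scale g"
proof -
  have "g (x + y) = g x + g y" for x y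
    by (rule dual_separates) (use dual_add[OF assms] in \<open>simp add: dual_add\<close>)
  moreover have "g (c *s x) = c *s g x" for c x
    by (rule dual_separates) (use dual_scale[OF assms] in \<open>simp add: dual_scale\<close>)
  ultimately show ?thesis by (simp add: linear_self_iff)
qed

lemma Sw_dual_product:
  assumes "f \<in> dual_space" "h \<in> dual_space"
  shows "(\<lambda>a. Sw a (\<lambda>x y. f x * h y)) \<in> dual_space"
  by (rule Sw_linear) (rule dual_cmult_left dual_cmult_right, rule assms)+

lemma linear_hitL: "f \<in> dual_space \<Longrightarrow> Vector_Spaces.linear scale scale (hitL f)"
  by (rule linearI_dual) (simp add: dual_hitL Sw_dual_product)

lemma linear_hitR: "f \<in> dual_space \<Longrightarrow> Vector_Spaces.linear scale scale (hitR f)"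
  by (rule linearI_dual) (simp add: dual_hitR Sw_dual_product)

lemma conv_dual: "f \<in> dual_space \<Longrightarrow> g \<in> dual_space \<Longrightarrow> conv f g \<in> dual_space"
  unfolding conv_Sw[abs_def] by (rule Sw_dual_product)

text \<open>Writing the left legs of \<open>\<Delta> c\<close> in coordinates makes the right legs
  \<open>hitL (co b) c\<close>, which lie in \<open>C\<close>. These are then written in a basis of
  \<open>C\<close>, which makes the left legs \<open>hitR (co b) c\<close>, again in
  \<open>C\<close>. Two passes are needed to have both legs in \<open>C\<close> at once.\<close>

lemma subcoalgebraI:
  assumes C: "subspace C"
    and L: "\<And>f c. f \<in> dual_space \<Longrightarrow> c \<in> C \<Longrightarrow> hitL f c \<in> C"
    and R: "\<And>f c. f \<in> dual_space \<Longrightarrow> c \<in> C \<Longrightarrow> hitR f c \<in> C"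
  shows "subcoalgebra C"
  unfolding subcoalgebra_def
proof (intro conjI ballI)
  fix c assume c: "c \<in> C"
  obtain B co where co: "B \<subseteq> C" "\<And>b. co b \<in> dual_space"
    "\<And>x. finite {b. co b x \<noteq> 0}" "\<And>x. (\<Sum>b | co b x \<noteq> 0. co b x *s b) = x"
    "\<forall>x\<in>C. \<forall>b. co b x \<noteq> 0 \<longrightarrow> b \<in> B"
    by (rule coordinate_functionals[OF C]) (rule that)
  have exp: "\<exists>bs. (\<forall>x\<in>X. x = (\<Sum>b\<leftarrow>bs. co b x *s b)) \<and> (X \<subseteq> C \<longrightarrow> set bs \<subseteq> B)" if "finite X" for X
  proof -
    let ?K = "\<Union>x\<in>X. {b. co b x \<noteq> 0}"
    have fin: "finite ?K" using that co(3) by blast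
    then obtain bs where bs: "set bs = ?K" "distinct bs"
      using finite_distinct_list by metis
    have "x = (\<Sum>b\<leftarrow>bs. co b x *s b)" if "x \<in> X" for x
    proof -
      have "(\<Sum>b\<leftarrow>bs. co b x *s b) = (\<Sum>b\<in>?K. co b x *s b)"
        using bs by (simp add: sum_list_distinct_conv_sum_set)
      also have "\<dots> = (\<Sum>b | co b x \<noteq> 0. co b x *s b)"
        by (rule sum.mono_neutral_right) (use fin that in auto)
      finally show ?thesis by (simp add: co(4))
    qed
    then show ?thesis using bs co(5) by blast
  qed
  \<comment> \<open>The left legs may still lie anywhere in A, so \<open>bs\<close> is not confined
    to \<open>C\<close> in this first pass.\<close>
  obtain bs where bs: "\<forall>x\<in>fst ` set (sw c). x = (\<Sum>b\<leftarrow>bs. co b x *s b)"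
    using exp[of "fst ` set (sw c)"] by auto
  define ps where "ps = map (\<lambda>b. (b, hitL (co b) c)) bs"
  have 1: "\<Delta> c = tensor [[x, y]. (x, y) \<leftarrow> ps]"
    unfolding comult_sw[of c]
  proof (subst tensor_expand_left[where bs = bs and co = co])
    show "x = (\<Sum>b\<leftarrow>bs. co b x *s b)" if "(x, y) \<in> set (sw c)" for x y
      by (rule bs[rule_format]) (use that in force)
  qed (simp add: ps_def comp_def hitL_def)
  have psC: "snd ` set ps \<subseteq> C" using L[OF co(2) c] by (auto simp: ps_def)
  obtain bs' where bs': "\<forall>x\<in>snd ` set ps. x = (\<Sum>b\<leftarrow>bs'. co b x *s b)" "set bs' \<subseteq> B"
    using exp[of "snd ` set ps"] psC by auto
  have 2: "\<Delta> c = tensor [[\<Sum>(x, y)\<leftarrow>ps. co b y *s x, b]. b \<leftarrow> bs']"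
    unfolding 1
  proof (rule tensor_expand_right)
    show "y = (\<Sum>b\<leftarrow>bs'. co b y *s b)" if "(x, y) \<in> set ps" for x y
      by (rule bs'(1)[rule_format]) (use that in force)
  qed
  have "(\<Sum>(x, y)\<leftarrow>ps. co b y *s x) = hitR (co b) c" for b
  proof (rule dual_separates)
    fix h assume h: "h \<in> dual_space"
    have "h (hitR (co b) c) = (\<Sum>(x, y)\<leftarrow>ps. h x * co b y)"
      unfolding dual_hitR[OF h]
      by (rule Sw_product_eqI[OF h co(2) 1])
    then show "h (\<Sum>(x, y)\<leftarrow>ps. co b y *s x) = h (hitR (co b) c)"
      by (simp add: dual_sum_list[OF h] case_prod_unfold dual_scale[OF h] mult.commute)
  qed
  with 2 have "\<Delta> c = tensor (map (\<lambda>b. [hitR (co b) c, b]) bs')" by (simp add: comp_def)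
  moreover have "\<forall>w\<in>set (map (\<lambda>b. [hitR (co b) c, b]) bs'). length w = 2 \<and> set w \<subseteq> C"
    using R[OF co(2) c] bs'(2) co(1) by auto
  ultimately show "\<Delta> c \<in> tensor_power 2 C" unfolding tensor_power_def by blast
qed (rule C)

lemma subcoalgebra_comult:
  assumes "subcoalgebra C" "c \<in> C"
  obtains ps where "\<Delta> c = tensor [[x, y]. (x, y) \<leftarrow> ps]"
    "\<And>x y. (x, y) \<in> set ps \<Longrightarrow> x \<in> C \<and> y \<in> C"
proof -
  obtain ws where ws: "\<Delta> c = tensor ws" "\<forall>w\<in>set ws. length w = 2 \<and> set w \<subseteq> C"
    using assms by (auto simp: subcoalgebra_def tensor_power_def)
  define ps where "ps = map (\<lambda>w. (w ! 0, w ! 1)) ws"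
  have "[[x, y]. (x, y) \<leftarrow> ps] = ws"
    unfolding ps_def using ws(2) by (induction ws) (auto simp: length_Suc_conv numeral_2_eq_2)
  moreover have "x \<in> C \<and> y \<in> C" if "(x, y) \<in> set ps" for x y
    using that ws(2) by (fastforce simp: ps_def)
  ultimately show thesis using that[of ps] ws(1) by simp
qed

lemma subcoalgebra_hit:
  assumes "subcoalgebra C" "f \<in> dual_space" "c \<in> C"
  shows "hitL f c \<in> C" "hitR f c \<in> C"
proof -
  have C: "subspace C" using assms by (simp add: subcoalgebra_def)
  obtain ps where ps: "\<Delta> c = tensor [[x, y]. (x, y) \<leftarrow> ps]"
    and psC: "\<And>x y. (x, y) \<in> set ps \<Longrightarrow> x \<in> C \<and> y \<in> C"
    using subcoalgebra_comult[OF assms(1,3)] by blast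
  have sumC: "(\<Sum>p\<leftarrow>qs. G p) \<in> C" if "\<And>p. p \<in> set qs \<Longrightarrow> G p \<in> C" for qs :: "('a \<times> 'a) list" and G
    using that by (induction qs) (auto intro: subspace_0[OF C] subspace_add[OF C])
  have "hitL f c = (\<Sum>p\<leftarrow>ps. f (fst p) *s snd p)"
  proof (rule dual_separates)
    fix h assume h: "h \<in> dual_space"
    have "h (hitL f c) = (\<Sum>(x, y)\<leftarrow>ps. f x * h y)"
      unfolding dual_hitL[OF h]
      by (rule Sw_product_eqI[OF assms(2) h ps])
    then show "h (hitL f c) = h (\<Sum>p\<leftarrow>ps. f (fst p) *s snd p)"
      by (simp add: dual_sum_list[OF h] case_prod_unfold dual_scale[OF h])
  qed
  then show "hitL f c \<in> C"
    using psC by (auto intro!: sumC subspace_scale[OF C])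
  have "hitR f c = (\<Sum>p\<leftarrow>ps. f (snd p) *s fst p)"
  proof (rule dual_separates)
    fix h assume h: "h \<in> dual_space"
    have "h (hitR f c) = (\<Sum>(x, y)\<leftarrow>ps. h x * f y)"
      unfolding dual_hitR[OF h]
      by (rule Sw_product_eqI[OF h assms(2) ps])
    then show "h (hitR f c) = h (\<Sum>p\<leftarrow>ps. f (snd p) *s fst p)"
      by (simp add: dual_sum_list[OF h] case_prod_unfold dual_scale[OF h] mult.commute)
  qed
  then show "hitR f c \<in> C"
    using psC by (auto intro!: sumC subspace_scale[OF C])
qed

end

section \<open>Finite-dimensional subspaces\<close>

context vector_space
begin

lemma independent_card_eq_span:
  assumes "B \<subseteq> V" "independent B" "V \<subseteq> span X" "finite X" "card X \<le> card B"
  shows "V \<subseteq> span B"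
proof
  fix v assume v: "v \<in> V"
  show "v \<in> span B"
  proof (rule ccontr)
    assume n: "v \<notin> span B"
    then have "independent (insert v B)" using assms(2) by (rule independent_insertI)
    moreover have "insert v B \<subseteq> span X" using v assms(1,3) by auto
    ultimately have "finite (insert v B) \<and> card (insert v B) \<le> card X"
      by (rule independent_span_bound[OF assms(4)])
    moreover have "v \<notin> B" using n span_base by blast
    ultimately show False using assms(5) by auto
  qed
qed

lemma finite_basis:
  assumes "subspace V" "V \<subseteq> span X" "finite X"
  obtains B where "finite B" "independent B" "B \<subseteq> V" "span B = V"
proof -
  obtain B where B: "B \<subseteq> V" "independent B" "V \<subseteq> span B"
    using basis_exists by metis
  moreover have "finite B"
    using independent_span_bound[OF assms(3) B(2)] B(1) assms(2) by auto
  moreover have "span B = V" using B assms(1) by (simp add: span_subspace)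
  ultimately show thesis using that by blast
qed

lemma injective_imp_surjective_on:
  assumes V: "subspace V" "V \<subseteq> span X" "finite X"
    and h: "Vector_Spaces.linear scale scale h" "h ` V \<subseteq> V" "inj_on h V"
  shows "h ` V = V"
proof -
  interpret vector_space_pair scale scale
    by (simp add: vector_space_pair_def vector_space_axioms)
  obtain B where B: "finite B" "independent B" "B \<subseteq> V" "span B = V"
    using finite_basis[OF V] .
  have "independent (h ` B)"
    by (rule linear_independent_injective_image[OF h(1) B(2)]) (simp add: B(4) h(3))
  moreover have "card (h ` B) = card B"
    by (rule card_image) (rule inj_on_subset[OF h(3) B(3)])
  moreover have "h ` B \<subseteq> V" using B(3) h(2) by blast
  ultimately have "V \<subseteq> span (h ` B)"
    using independent_card_eq_span[of "h ` B" V B] B(1,4) by simp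
  also have "span (h ` B) = h ` V" by (simp add: linear_span_image[OF h(1)] B(4))
  finally show ?thesis using h(2) by blast
qed

lemma surjective_imp_inverse_on:
  assumes V: "subspace V" "V \<subseteq> span X" "finite X"
    and h: "Vector_Spaces.linear scale scale h" "h ` V = V"
  obtains k where "Vector_Spaces.linear scale scale k" "\<And>v. k v \<in> V"
    "\<And>v. v \<in> V \<Longrightarrow> h (k v) = v" "\<And>v. v \<in> V \<Longrightarrow> k (h v) = v"
proof -
  interpret vector_space_pair scale scale
    by (simp add: vector_space_pair_def vector_space_axioms)
  obtain k where k: "Vector_Spaces.linear scale scale k" "range k \<subseteq> V" "\<forall>v\<in>h ` V. h (k v) = v"
    using linear_exists_right_inverse_on[OF h(1) V(1)] by auto
  have hk: "h (k v) = v" if "v \<in> V" for v using k(3) h(2) that by auto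
  have inj: "inj_on k V" by (rule inj_on_inverseI[where g = h]) (rule hk)
  have "k ` V = V" by (rule injective_imp_surjective_on[OF V k(1) _ inj]) (use k(2) in auto)
  have "k (h v) = v" if v: "v \<in> V" for v
  proof -
    obtain u where u: "u \<in> V" "v = k u" using v \<open>k ` V = V\<close> by auto
    then show ?thesis by (simp add: hk)
  qed
  then show thesis using that[OF k(1) _ hk] k(2) by blast
qed

text \<open>\<open>co b\<close> is the \<open>b\<close>-coordinate of \<open>P a\<close>, so
  \<open>P\<close> is the sum of the \<open>co b\<close> tensor \<open>b\<close>. Since
  \<open>P\<close> fixes \<open>b\<close>, each diagonal entry is 1 and the trace counts the basis
  of \<open>M\<close>.\<close>

lemma finite_rank_coordinates:
  assumes P: "Vector_Spaces.linear scale scale P" and M: "subspace M" "M \<subseteq> span X" "finite X"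
    and P_in: "\<And>a. P a \<in> M" and P_id: "\<forall>m\<in>M. P m = m"
  obtains B co where "finite B" "B \<subseteq> M" "\<And>b. Vector_Spaces.linear scale (*) (co b)"
    "\<And>a. P a = (\<Sum>b\<in>B. co b a *s b)" "\<forall>b\<in>B. co b b = 1" "span B = M"
proof -
  obtain B where B: "finite B" "independent B" "B \<subseteq> M" "span B = M"
    by (rule finite_basis[OF M])
  define co where "co b a = representation B (P a) b" for b a
  interpret P: Vector_Spaces.linear scale scale P by (rule P)
  have *: "vector_space ((*) :: 'a \<Rightarrow> 'a \<Rightarrow> 'a)"
    by unfold_locales (simp_all add: algebra_simps)
  interpret vs2: vector_space_pair scale "(*) :: 'a \<Rightarrow> 'a \<Rightarrow> 'a"
    by (simp add: vector_space_pair_def vector_space_axioms *)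
  show thesis
  proof (rule that[of B co])
    show "Vector_Spaces.linear scale (*) (co b)" for b
      unfolding linear_iff using * B(2,4) P_in
      by (simp add: co_def P.add P.scale representation_add representation_scale vector_space_axioms)
    show "P a = (\<Sum>b\<in>B. co b a *s b)" for a
      unfolding co_def using sum_representation_eq[OF B(2) _ B(1) subset_refl] P_in B(4) by simp
    show "\<forall>b\<in>B. co b b = 1"
      using representation_basis[OF B(2)] P_id B(3) by (auto simp: co_def)
  qed (use B in auto)
qed

end

section \<open>Coalgebras\<close>

context coalgebra
begin

lemma sum_list_concat: "sum_list (concat xss) = (\<Sum>xs\<leftarrow>xss. sum_list xs)"
  by (induction xss) simp_all

lemma Sw_coassoc:
  assumes "\<And>y z. (\<lambda>x. G x y z) \<in> dual_space" "\<And>x z. (\<lambda>y. G x y z) \<in> dual_space"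
    "\<And>x y. (\<lambda>z. G x y z) \<in> dual_space"
  shows "Sw a (\<lambda>x y. Sw x (\<lambda>u v. G u v y)) = Sw a (\<lambda>u t. Sw t (\<lambda>v y. G u v y))"
proof -
  let ?ps = "[(x, y, a2). (a1, a2) \<leftarrow> sw a, (x, y) \<leftarrow> sw a1]"
  let ?qs = "[(a1, x, y). (a1, a2) \<leftarrow> sw a, (x, y) \<leftarrow> sw a2]"
  have "(\<Sum>(x, y, z)\<leftarrow>?ps. G x y z) = (\<Sum>(x, y, z)\<leftarrow>?qs. G x y z)"
    by (rule sum_tensor3_cong) (use assms coassoc[of a] in \<open>simp_all add: map_concat comp_def case_prod_unfold\<close>)
  then show ?thesis
    by (simp add: Sw_def map_concat sum_list_concat comp_def case_prod_unfold)
qed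

lemma hitL_counit: "hitL \<epsilon> a = a" and hitR_counit: "hitR \<epsilon> a = a"
  by (simp_all add: hitL_def hitR_def counit_left counit_right)

lemma Sw_counit_left: "f \<in> dual_space \<Longrightarrow> Sw a (\<lambda>x y. \<epsilon> x * f y) = f a"
  and Sw_counit_right: "f \<in> dual_space \<Longrightarrow> Sw a (\<lambda>x y. f x * \<epsilon> y) = f a"
  by (metis dual_hitL hitL_counit, metis dual_hitR hitR_counit)

lemma counit_hitL: "f \<in> dual_space \<Longrightarrow> \<epsilon> (hitL f a) = f a"
  and counit_hitR: "f \<in> dual_space \<Longrightarrow> \<epsilon> (hitR f a) = f a"
  by (simp_all add: dual_hitL dual_hitR counit_dual Sw_counit_left Sw_counit_right)

lemma conv_counit_left: "f \<in> dual_space \<Longrightarrow> conv \<epsilon> f = f"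
  by (simp add: fun_eq_iff conv_Sw Sw_counit_left)

lemma Sw_assoc_product:
  assumes "f \<in> dual_space" "g \<in> dual_space" "h \<in> dual_space"
  shows "Sw a (\<lambda>x y. Sw x (\<lambda>u v. f u * g v) * h y) = Sw a (\<lambda>u t. f u * Sw t (\<lambda>v y. g v * h y))"
proof -
  have "Sw a (\<lambda>x y. Sw x (\<lambda>u v. f u * g v * h y)) = Sw a (\<lambda>u t. Sw t (\<lambda>v y. f u * g v * h y))"
    by (rule Sw_coassoc) (use assms in \<open>auto simp: dual_space_iff algebra_simps\<close>)
  then show ?thesis by (simp add: Sw_mult_left Sw_mult_right mult.assoc)
qed

lemma conv_assoc:
  assumes "f \<in> dual_space" "g \<in> dual_space" "h \<in> dual_space"
  shows "conv (conv f g) h = conv f (conv g h)"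
  using Sw_assoc_product[OF assms] by (simp add: fun_eq_iff conv_Sw)

lemma hitL_hitL:
  assumes "f \<in> dual_space" "g \<in> dual_space"
  shows "hitL f (hitL g a) = hitL (conv g f) a"
proof (rule dual_separates)
  fix h assume h: "h \<in> dual_space"
  have "h (hitL f (hitL g a)) = Sw a (\<lambda>x y. g x * h (hitL f y))"
    by (rule dual_hitL) (rule dual_comp[OF h linear_hitL[OF assms(1)]])
  also have "\<dots> = h (hitL (conv g f) a)"
    by (simp add: dual_hitL h conv_Sw Sw_assoc_product assms)
  finally show "h (hitL f (hitL g a)) = h (hitL (conv g f) a)" .
qed

lemma hitR_hitR:
  assumes "f \<in> dual_space" "g \<in> dual_space"
  shows "hitR f (hitR g a) = hitR (conv f g) a"
proof (rule dual_separates)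
  fix h assume h: "h \<in> dual_space"
  have "h (hitR f (hitR g a)) = Sw a (\<lambda>x y. h (hitR f x) * g y)"
    by (rule dual_hitR) (rule dual_comp[OF h linear_hitR[OF assms(1)]])
  also have "\<dots> = h (hitR (conv f g) a)"
    by (simp add: dual_hitR h conv_Sw Sw_assoc_product assms)
  finally show "h (hitR f (hitR g a)) = h (hitR (conv f g) a)" .
qed

lemma hitL_hitR:
  assumes "f \<in> dual_space" "g \<in> dual_space"
  shows "hitL f (hitR g a) = hitR g (hitL f a)"
proof (rule dual_separates)
  fix h assume h: "h \<in> dual_space"
  have "h (hitL f (hitR g a)) = Sw a (\<lambda>x y. h (hitL f x) * g y)"
    by (rule dual_hitR) (rule dual_comp[OF h linear_hitL[OF assms(1)]])
  also have "\<dots> = Sw a (\<lambda>x y. f x * h (hitR g y))"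
    by (simp add: dual_hitL dual_hitR h Sw_assoc_product assms)
  also have "\<dots> = h (hitR g (hitL f a))"
    by (rule dual_hitL[symmetric]) (rule dual_comp[OF h linear_hitR[OF assms(2)]])
  finally show "h (hitL f (hitR g a)) = h (hitR g (hitL f a))" .
qed

section \<open>Local finiteness and simple subcoalgebras\<close>

lemma subcoalgebra_Int:
  assumes "subcoalgebra C" "subcoalgebra E"
  shows "subcoalgebra (C \<inter> E)"
  by (rule subcoalgebraI)
    (use assms subcoalgebra_hit in \<open>auto simp: subcoalgebra_def intro: subspace_inter\<close>)

lemma subcoalgebra_spanI:
  assumes "\<And>f x. f \<in> dual_space \<Longrightarrow> x \<in> X \<Longrightarrow> hitL f x \<in> span X"
    and "\<And>f x. f \<in> dual_space \<Longrightarrow> x \<in> X \<Longrightarrow> hitR f x \<in> span X"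
  shows "subcoalgebra (span X)"
proof (rule subcoalgebraI)
  have cl: "g c \<in> span X" if "Vector_Spaces.linear scale scale g" "\<And>x. x \<in> X \<Longrightarrow> g x \<in> span X" "c \<in> span X"
    for g c
    using that(3)
  proof (induction rule: span_induct_alt)
    case base
    show ?case using linear_scale[OF that(1), of 0 0] by (simp add: span_zero)
  next
    case (step c x y)
    then show ?case
      using that by (simp add: linear_add linear_scale span_add span_scale)
  qed
  show "hitL f c \<in> span X" "hitR f c \<in> span X" if "f \<in> dual_space" "c \<in> span X" for f c
    using that assms by (auto intro: cl linear_hitL linear_hitR)
qed simp

lemma subcoalgebra_span_Union:
  assumes "\<And>C. C \<in> \<C> \<Longrightarrow> subcoalgebra C"
  shows "subcoalgebra (span (\<Union>\<C>))"
  by (rule subcoalgebra_spanI) (meson UnionE UnionI assms span_base subcoalgebra_hit)+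

text \<open>This is the fundamental theorem of coalgebras. The subcoalgebra generated by x is
  spanned by all f(x1) x2 g(x3), and hence lies in the span of the middle legs.\<close>

lemma finite_subcoalgebra:
  obtains E X where "subcoalgebra E" "x \<in> E" "finite X" "E \<subseteq> span X"
    "\<And>C. subcoalgebra C \<Longrightarrow> x \<in> C \<Longrightarrow> E \<subseteq> C"
proof -
  define G where "G = {hitL f (hitR g x) | f g. f \<in> dual_space \<and> g \<in> dual_space}"
  \<comment> \<open>The middle legs of one chosen representative of x1, x2, x3: finitely many,
    although \<open>f\<close> and \<open>g\<close> run over the whole dual space.\<close>
  define X where "X = (\<Union>u\<in>fst ` set (sw x). snd ` set (sw u))"
  show thesis
  proof (rule that[of "span G" X])
    show "subcoalgebra (span G)"
    proof (rule subcoalgebra_spanI)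
      fix f z assume f: "f \<in> dual_space" and "z \<in> G"
      then obtain g h where z: "z = hitL g (hitR h x)" "g \<in> dual_space" "h \<in> dual_space"
        by (auto simp: G_def)
      have "hitL f z = hitL (conv g f) (hitR h x)" by (simp add: z f hitL_hitL)
      moreover have "hitR f z = hitL g (hitR (conv f h) x)"
        by (simp add: z f hitR_hitR flip: hitL_hitR)
      ultimately have "hitL f z \<in> G" "hitR f z \<in> G"
        using conv_dual f z by (auto simp: G_def)
      then show "hitL f z \<in> span G" "hitR f z \<in> span G" by (auto intro: span_base)
    qed
    show "x \<in> span G"
    proof (rule span_base)
      have "x = hitL \<epsilon> (hitR \<epsilon> x)" by (simp add: hitL_counit hitR_counit)
      then show "x \<in> G" using counit_dual unfolding G_def by blast
    qed
    show "finite X" by (simp add: X_def)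
    have sum: "(\<Sum>p\<leftarrow>ps. F p) \<in> span Y" if "\<And>p. p \<in> set ps \<Longrightarrow> F p \<in> span Y"
      for ps :: "('a \<times> 'a) list" and F Y
      using that by (induction ps) (auto intro: span_zero span_add)
    have "hitL f (hitR g x) \<in> span X" if f: "f \<in> dual_space" for f g
    proof -
      have z: "hitL f 0 = 0" using linear_scale[OF linear_hitL[OF f], of 0 0] by simp
      have "hitL f (\<Sum>p\<leftarrow>ps. g (snd p) *s fst p) = (\<Sum>p\<leftarrow>ps. g (snd p) *s hitL f (fst p))" for ps
        by (induction ps) (simp_all add: z linear_add[OF linear_hitL[OF f]] linear_scale[OF linear_hitL[OF f]])
      then have "hitL f (hitR g x) = (\<Sum>p\<leftarrow>sw x. g (snd p) *s (\<Sum>q\<leftarrow>sw (fst p). f (fst q) *s snd q))"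
        by (simp add: hitR_def hitL_def case_prod_unfold)
      also have "\<dots> \<in> span X"
        by (intro sum span_scale span_base) (auto simp: X_def)
      finally show ?thesis .
    qed
    then have "G \<subseteq> span X" by (auto simp: G_def)
    then show "span G \<subseteq> span X" by (simp add: span_minimal)
    show "span G \<subseteq> C" if "subcoalgebra C" "x \<in> C" for C
    proof (rule span_minimal)
      show "G \<subseteq> C" using that subcoalgebra_hit by (auto simp: G_def)
      show "subspace C" using that by (simp add: subcoalgebra_def)
    qed
  qed
qed

text \<open>By local finiteness the dual algebra inherits from finite-dimensional algebras that a
  one-sided inverse is two-sided: on a finite-dimensional subcoalgebra, \<open>hitR g\<close> has a
  left inverse, so it is injective and therefore surjective.\<close>

lemma conv_left_inverse_imp_right_inverse:
  assumes f: "f \<in> dual_space" and g: "g \<in> dual_space" and fg: "conv f g = \<epsilon>"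
  shows "conv g f = \<epsilon>"
proof
  fix a
  obtain E X where E: "subcoalgebra E" "a \<in> E" "finite X" "E \<subseteq> span X"
    using finite_subcoalgebra by metis
  have inv: "hitR f (hitR g x) = x" for x
    by (simp add: hitR_hitR f g fg hitR_counit)
  have "hitR g ` E = E"
  proof (rule injective_imp_surjective_on)
    show "subspace E" using E by (simp add: subcoalgebra_def)
    show "hitR g ` E \<subseteq> E" using subcoalgebra_hit[OF E(1) g] by auto
    show "inj_on (hitR g) E" by (rule inj_on_inverseI) (rule inv)
  qed (use E linear_hitR[OF g] in auto)
  then obtain c where "a = hitR g c" using E(2) by auto
  then have "hitR (conv g f) a = a" by (simp add: inv flip: hitR_hitR[OF g f])
  then show "conv g f a = \<epsilon> a" using counit_hitR[OF conv_dual[OF g f]] by metis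
qed

text \<open>Local finiteness supplies nonzero finite-dimensional subcoalgebras of \<open>K\<close>.
  One with the smallest possible number of spanning vectors is simple, because a basis of a nonzero
  subcoalgebra inside it already has that many elements.\<close>

lemma simple_subcoalgebra_exists:
  assumes K: "subcoalgebra K" "K \<noteq> {0}"
  obtains C where "simple_subcoalgebra C" "C \<subseteq> K"
proof -
  define Q where "Q n \<longleftrightarrow> (\<exists>E X. subcoalgebra E \<and> E \<noteq> {0} \<and> E \<subseteq> K \<and> finite X \<and> card X = n \<and> E \<subseteq> span X)" for n
  have K0: "0 \<in> K" using K by (simp add: subcoalgebra_def subspace_0)
  then obtain x where x: "x \<in> K" "x \<noteq> 0" using K(2) by auto
  obtain E X where "subcoalgebra E" "x \<in> E" "finite X" "E \<subseteq> span X" "E \<subseteq> K"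
    using finite_subcoalgebra[of x] K(1) x(1) by metis
  then have "Q (card X)" unfolding Q_def using x by blast
  then have "Q (LEAST n. Q n)" by (rule LeastI)
  then obtain E X where E: "subcoalgebra E" "E \<noteq> {0}" "E \<subseteq> K" "finite X"
    "card X = (LEAST n. Q n)" "E \<subseteq> span X"
    unfolding Q_def by blast
  have "F = E" if F: "subcoalgebra F" "F \<subseteq> E" "F \<noteq> {0}" for F
  proof -
    have sF: "subspace F" using F by (simp add: subcoalgebra_def)
    obtain B where B: "finite B" "independent B" "B \<subseteq> F" "span B = F"
      using finite_basis[OF sF _ E(4)] F E by blast
    have "Q (card B)" unfolding Q_def using F E B by blast
    then have "card X \<le> card B" unfolding E(5) by (rule Least_le)
    then have "E \<subseteq> span B"
      using independent_card_eq_span[OF _ B(2) E(6,4)] B(3) F(2) by blast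
    then show ?thesis using F(2) B(4) by blast
  qed
  then have "simple_subcoalgebra E" using E unfolding simple_subcoalgebra_def by blast
  then show thesis using that E(3) by blast
qed

subsection \<open>Coseparability\<close>

text \<open>Such a form is \<epsilon> composed with a bicolinear retraction of \<Delta>. The
  retraction is recovered as y1 B(y2, a) = B(y, a1) a2; the last clause says that it splits
  \<Delta>.\<close>

definition coseparability_form :: "('a \<Rightarrow> 'a \<Rightarrow> 'k) \<Rightarrow> bool"
  where "coseparability_form B \<longleftrightarrow>
    (\<forall>a. (\<lambda>y. B y a) \<in> dual_space) \<and> (\<forall>y. B y \<in> dual_space) \<and>
    (\<forall>f\<in>dual_space. \<forall>y a. Sw y (\<lambda>u v. f u * B v a) = Sw a (\<lambda>u v. B y u * f v)) \<and>
    (\<forall>a. Sw a B = \<epsilon> a)"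

text \<open>With a linear projection \<open>pr\<close> onto \<open>C\<close>, averaging gives q(a) =
  B(pr(a1), a2). Then q(a1) a2 = pr(a1)_1 B(pr(a1)_2, a2) lies in \<open>C\<close>, because
  \<open>C\<close> is stable under the actions. The mirror image \<open>q'\<close> turns out to
  equal \<open>q\<close>, which makes \<open>q\<close> a central idempotent of the dual algebra
  whose action projects A onto \<open>C\<close>.\<close>

lemma coseparable_projection:
  assumes B: "coseparability_form B"
    and C: "subcoalgebra C"
  obtains q where "q \<in> dual_space" "\<And>a. hitL q a = hitR q a" "\<And>a. hitL q a \<in> C"
    "\<And>c. c \<in> C \<Longrightarrow> hitL q c = c"
proof -
  have Bl: "\<And>a. (\<lambda>y. B y a) \<in> dual_space" and Br: "\<And>y. B y \<in> dual_space"
    and Bcol: "\<And>y a f. f \<in> dual_space \<Longrightarrow> Sw y (\<lambda>u v. f u * B v a) = Sw a (\<lambda>u v. B y u * f v)"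
    and Bnorm: "\<And>a. Sw a B = \<epsilon> a"
    using B unfolding coseparability_form_def by blast+
  have sC: "subspace C" using C by (simp add: subcoalgebra_def)
  obtain pr where pr: "Vector_Spaces.linear scale scale pr" "\<And>x. pr x \<in> C" "\<And>x. x \<in> C \<Longrightarrow> pr x = x"
    by (rule linear_projection[OF sC]) (rule that)
  have sumC: "(\<Sum>p\<leftarrow>qs. G p) \<in> C" if "\<And>p. p \<in> set qs \<Longrightarrow> G p \<in> C" for qs :: "('a \<times> 'a) list" and G
    using that by (induction qs) (auto intro: subspace_0[OF sC] subspace_add[OF sC])
  have Bpl: "\<And>a. (\<lambda>y. B (pr y) a) \<in> dual_space" and Bpr: "\<And>y. (\<lambda>a. B y (pr a)) \<in> dual_space"
    using dual_comp[OF Bl pr(1)] dual_comp[OF Br pr(1)] by auto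
  define q where "q a = Sw a (\<lambda>x y. B (pr x) y)" for a
  define q' where "q' a = Sw a (\<lambda>x y. B x (pr y))" for a
  have q: "q \<in> dual_space" and q': "q' \<in> dual_space"
    unfolding q_def[abs_def] q'_def[abs_def] using Sw_linear Bl Br Bpl Bpr by auto
  have qL: "hitL q a \<in> C" for a
  proof -
    have "hitL q a = (\<Sum>p\<leftarrow>sw a. hitR (\<lambda>v. B v (snd p)) (pr (fst p)))" (is "_ = ?z")
    proof (rule dual_separates)
      fix f assume f: "f \<in> dual_space"
      have "f (hitL q a) = Sw a (\<lambda>s z. Sw s (\<lambda>x y. B (pr x) y * f z))"
        by (simp add: dual_hitL f q_def Sw_mult_right)
      also have "\<dots> = Sw a (\<lambda>x t. Sw t (\<lambda>y z. B (pr x) y * f z))"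
        by (rule Sw_coassoc) (intro dual_cmult_left dual_cmult_right f Bpl Br)+
      also have "\<dots> = Sw a (\<lambda>x t. Sw (pr x) (\<lambda>u v. f u * B v t))"
        by (simp add: Bcol f)
      also have "\<dots> = f ?z"
        by (simp add: dual_sum_list[OF f] dual_hitR[OF f] Sw_def[of a] case_prod_unfold)
      finally show "f (hitL q a) = f ?z" .
    qed
    also have "?z \<in> C" by (intro sumC subcoalgebra_hit[OF C] Bl pr)
    finally show ?thesis .
  qed
  have qR: "hitR q' a \<in> C" for a
  proof -
    have "hitR q' a = (\<Sum>p\<leftarrow>sw a. hitL (B (fst p)) (pr (snd p)))" (is "_ = ?z")
    proof (rule dual_separates)
      fix f assume f: "f \<in> dual_space"
      have "f (hitR q' a) = Sw a (\<lambda>x t. Sw t (\<lambda>y z. f x * B y (pr z)))"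
        by (simp add: dual_hitR f q'_def Sw_mult_left)
      also have "\<dots> = Sw a (\<lambda>t z. Sw t (\<lambda>x y. f x * B y (pr z)))"
        by (rule Sw_coassoc[symmetric]) (intro dual_cmult_left dual_cmult_right f Bpr Bl)+
      also have "\<dots> = Sw a (\<lambda>t z. Sw (pr z) (\<lambda>u v. B t u * f v))"
        by (simp add: Bcol f)
      also have "\<dots> = f ?z"
        by (simp add: dual_sum_list[OF f] dual_hitL[OF f] Sw_def[of a] case_prod_unfold)
      finally show "f (hitR q' a) = f ?z" .
    qed
    also have "?z \<in> C" by (intro sumC subcoalgebra_hit[OF C] Br pr)
    finally show ?thesis .
  qed
  \<comment> \<open>The legs in \<open>sw c\<close> need not lie in \<open>C\<close>, so another
    representative with legs in \<open>C\<close> is used; bilinearity makes the sums agree.\<close>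
  have Sw_C: "Sw c F = Sw c G" if cC: "c \<in> C" and F: "\<And>y. (\<lambda>x. F x y) \<in> dual_space" "\<And>x. F x \<in> dual_space"
    and G: "\<And>y. (\<lambda>x. G x y) \<in> dual_space" "\<And>x. G x \<in> dual_space"
    and FG: "\<And>x y. x \<in> C \<Longrightarrow> y \<in> C \<Longrightarrow> F x y = G x y" for c F G
  proof -
    obtain ps where ps: "\<Delta> c = tensor [[x, y]. (x, y) \<leftarrow> ps]"
      "\<And>x y. (x, y) \<in> set ps \<Longrightarrow> x \<in> C \<and> y \<in> C"
      using subcoalgebra_comult[OF C cC] by blast
    have "(\<Sum>(x, y)\<leftarrow>ps. F x y) = (\<Sum>(x, y)\<leftarrow>ps. G x y)"
      by (intro arg_cong[where f = sum_list] map_cong) (use ps(2) FG in auto)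
    then show ?thesis using Sw_eqI[OF F ps(1)] Sw_eqI[OF G ps(1)] by simp
  qed
  have q_C: "q c = \<epsilon> c" and q'_C: "q' c = \<epsilon> c" if "c \<in> C" for c
    unfolding q_def q'_def Bnorm[symmetric] using that Bl Br Bpl Bpr pr(3)
    by (auto intro!: Sw_C)
  \<comment> \<open>As for left and right units: both forms restrict to \<epsilon> on
    \<open>C\<close>, and \<open>conv q q'\<close> evaluated from either side gives
    \<open>q'\<close> and \<open>q\<close>.\<close>
  have "q a = q' a" for a
  proof -
    have "q' a = q (hitR q' a)" by (simp add: q_C qR counit_hitR q')
    also have "\<dots> = q' (hitL q a)" by (simp add: dual_hitL dual_hitR q q')
    also have "\<dots> = q a" by (simp add: q'_C qL counit_hitL q)
    finally show ?thesis ..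
  qed
  then have qR: "hitR q a \<in> C" for a using qR by (metis ext)
  have L_C: "hitL q c = c" if "c \<in> C" for c
  proof (rule dual_separates)
    fix f assume f: "f \<in> dual_space"
    have "Sw c (\<lambda>x y. q x * f y) = Sw c (\<lambda>x y. \<epsilon> x * f y)"
      by (rule Sw_C[OF that]) (auto intro: dual_cmult_left dual_cmult_right f q counit_dual simp: q_C)
    then show "f (hitL q c) = f c" by (simp add: dual_hitL f Sw_counit_left)
  qed
  have R_C: "hitR q c = c" if "c \<in> C" for c
  proof (rule dual_separates)
    fix f assume f: "f \<in> dual_space"
    have "Sw c (\<lambda>x y. f x * q y) = Sw c (\<lambda>x y. f x * \<epsilon> y)"
      by (rule Sw_C[OF that]) (auto intro: dual_cmult_left dual_cmult_right f q counit_dual simp: q_C)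
    then show "f (hitR q c) = f c" by (simp add: dual_hitR f Sw_counit_right)
  qed
  have "hitL q a = hitR q a" for a
    using hitL_hitR[OF q q, of a] by (simp add: L_C qR R_C qL)
  then show thesis using that q qL L_C by blast
qed

text \<open>Let U be the sum of all simple subcoalgebras. The central idempotent for U has as kernel
  a subcoalgebra; if nonzero, it would contain a simple one, on which the idempotent acts both as
  zero and as the identity. So U is everything. The sum is direct because the projection onto
  \<open>C\<close> maps any other simple \<open>E\<close> into the intersection of \<open>C\<close>
  and \<open>E\<close>, which is zero.\<close>

lemma coseparable_imp_cosemisimple:
  assumes "coseparability_form B"
  shows cosemisimple
proof -
  note proj = coseparable_projection[where B = B, OF assms]
  define \<C> where "\<C> = {C. simple_subcoalgebra C}"
  have sub: "subcoalgebra C" if "C \<in> \<C>" for C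
    using that by (simp add: \<C>_def simple_subcoalgebra_def)
  have U: "subcoalgebra (span (\<Union>\<C>))"
    by (rule subcoalgebra_span_Union) (rule sub)
  have "span (\<Union>\<C>) = UNIV"
  proof -
    obtain q where q: "q \<in> dual_space" "\<And>a. hitL q a = hitR q a" "\<And>a. hitL q a \<in> span (\<Union>\<C>)"
      "\<And>c. c \<in> span (\<Union>\<C>) \<Longrightarrow> hitL q c = c"
      using proj[OF U] by blast
    have lin: "Vector_Spaces.linear scale scale (hitL q)" by (rule linear_hitL[OF q(1)])
    have z: "hitL q 0 = 0" using linear_scale[OF lin, of 0 0] by simp
    define K where "K = {a. hitL q a = 0}"
    have K: "subcoalgebra K"
    proof (rule subcoalgebraI)
      show "subspace K"
        by (rule subspaceI) (simp_all add: K_def linear_add[OF lin] linear_scale[OF lin] z)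
      fix f c assume f: "f \<in> dual_space" and "c \<in> K"
      then have c: "hitL q c = 0" "hitR q c = 0" by (simp_all add: K_def flip: q(2))
      have z': "hitL f 0 = 0" "hitR f 0 = 0"
        using linear_scale[OF linear_hitL[OF f], of 0 0] linear_scale[OF linear_hitR[OF f], of 0 0]
        by simp_all
      show "hitL f c \<in> K"
        using hitL_hitR[OF f q(1), of c] by (simp add: K_def q(2) c z')
      show "hitR f c \<in> K"
        using hitL_hitR[OF q(1) f, of c] by (simp add: K_def c z')
    qed
    have "K = {0}"
    proof (rule ccontr)
      assume "K \<noteq> {0}"
      then obtain C where C: "simple_subcoalgebra C" "C \<subseteq> K"
        using simple_subcoalgebra_exists[OF K] by blast
      have "c = 0" if "c \<in> C" for c
      proof -
        have "c \<in> span (\<Union>\<C>)" using C(1) that by (auto simp: \<C>_def intro!: span_base)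
        then show ?thesis using q(4)[of c] C(2) that by (auto simp: K_def)
      qed
      then have "C \<subseteq> {0}" by auto
      moreover have "0 \<in> C"
        using C(1) by (simp add: simple_subcoalgebra_def subcoalgebra_def subspace_0)
      ultimately show False using C(1) by (auto simp: simple_subcoalgebra_def)
    qed
    have "a \<in> span (\<Union>\<C>)" for a
    proof -
      have "hitL q (a - hitL q a) = 0"
        using linear_add[OF lin, of "a - hitL q a" "hitL q a"] q(3,4) by simp
      then have "a - hitL q a \<in> K" by (simp add: K_def)
      then have "a = hitL q a" unfolding \<open>K = {0}\<close> by simp
      then show ?thesis using q(3)[of a] by simp
    qed
    then show ?thesis by auto
  qed
  moreover have "C \<inter> span (\<Union>(\<C> - {C})) = {0}" if C: "C \<in> \<C>" for C
  proof -
    obtain q where q: "q \<in> dual_space" "\<And>a. hitL q a = hitR q a" "\<And>a. hitL q a \<in> C"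
      "\<And>c. c \<in> C \<Longrightarrow> hitL q c = c"
      using proj[OF sub[OF C]] by blast
    have lin: "Vector_Spaces.linear scale scale (hitL q)" by (rule linear_hitL[OF q(1)])
    have z: "hitL q 0 = 0" using linear_scale[OF lin, of 0 0] by simp
    have "hitL q x = 0" if x: "x \<in> E" and E: "E \<in> \<C>" "E \<noteq> C" for x E
    proof -
      have "subcoalgebra (C \<inter> E)" using sub C E by (simp add: subcoalgebra_Int)
      then have "C \<inter> E = {0} \<or> C \<inter> E = F" if "F \<in> \<C>" "C \<inter> E \<subseteq> F" for F
        using that by (simp add: \<C>_def simple_subcoalgebra_def)
      from this[OF C Int_lower1] this[OF E(1) Int_lower2] have "C \<inter> E = {0}" using E(2) by blast
      moreover have "hitL q x \<in> C \<inter> E"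
        using q(3) subcoalgebra_hit(1)[OF sub[OF E(1)] q(1) x] by simp
      ultimately show ?thesis by simp
    qed
    note simple_case = this
    have union_case: "hitL q x = 0" if x: "x \<in> \<Union>(\<C> - {C})" for x
    proof -
      obtain E where "x \<in> E" "E \<in> \<C>" "E \<noteq> C" using x by blast
      then show ?thesis by (rule simple_case)
    qed
    have "hitL q x = 0" if "x \<in> span (\<Union>(\<C> - {C}))" for x
      using that by (induction rule: span_induct_alt) (simp_all add: z union_case linear_add[OF lin] linear_scale[OF lin] del: Union_iff)
    then have "x = 0" if "x \<in> C" "x \<in> span (\<Union>(\<C> - {C}))" for x
      using q(4)[of x] that by simp
    moreover have "0 \<in> C" using sub[OF C] by (simp add: subcoalgebra_def subspace_0)
    ultimately show ?thesis using span_zero[of "\<Union>(\<C> - {C})"] by auto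
  qed
  ultimately show ?thesis unfolding cosemisimple_def
    by (intro exI[of _ \<C>]) (simp add: \<C>_def)
qed

subsection \<open>Iterated Sweedler sums\<close>

lemma Sw_cong: "(\<And>u v. F u v = G u v) \<Longrightarrow> Sw a F = Sw a G"
  by (simp add: Sw_def)

lemma Sw_swap2:
  "Sw a (\<lambda>a1 a2. Sw x (\<lambda>x1 t. Sw t (\<lambda>x2 x3. F a1 a2 x1 x2 x3))) =
   Sw x (\<lambda>x1 t. Sw t (\<lambda>x2 x3. Sw a (\<lambda>a1 a2. F a1 a2 x1 x2 x3)))"
  by (subst Sw_swap) (rule Sw_cong, rule Sw_swap)

lemma Sw_unnest4:
  assumes "\<And>x2 x3 x4. (\<lambda>x1. K x1 x2 x3 x4) \<in> dual_space"
    and "\<And>x1 x3 x4. (\<lambda>x2. K x1 x2 x3 x4) \<in> dual_space"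
    and "\<And>x1 x2 x4. (\<lambda>x3. K x1 x2 x3 x4) \<in> dual_space"
    and "\<And>x1 x2 x3. (\<lambda>x4. K x1 x2 x3 x4) \<in> dual_space"
  shows "Sw x (\<lambda>y x4. Sw y (\<lambda>x1 t. Sw t (\<lambda>x2 x3. K x1 x2 x3 x4))) =
         Sw x (\<lambda>x1 s. Sw s (\<lambda>x2 w. Sw w (\<lambda>x3 x4. K x1 x2 x3 x4)))"
proof -
  have "Sw x (\<lambda>y x4. Sw y (\<lambda>x1 t. Sw t (\<lambda>x2 x3. K x1 x2 x3 x4))) =
        Sw x (\<lambda>x1 s. Sw s (\<lambda>t x4. Sw t (\<lambda>x2 x3. K x1 x2 x3 x4)))"
    by (rule Sw_coassoc) (intro Sw_dual_inner Sw_dual_outer linear_id_fun assms)+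
  also have "\<dots> = Sw x (\<lambda>x1 s. Sw s (\<lambda>x2 w. Sw w (\<lambda>x3 x4. K x1 x2 x3 x4)))"
    by (rule Sw_cong, rule Sw_coassoc) (intro assms)+
  finally show ?thesis .
qed

text \<open>Two ways of splitting five legs. The shape (x1 x2) x3 (x4 x5) presents two elements z
  and w whose legs a reassociator can rebracket; the shape x1 (x2 x3 x4) x5 isolates a middle
  element on which an antipode axiom acts.\<close>

lemma Sw_unnest5:
  assumes "\<And>x2 x3 x4 x5. (\<lambda>x1. K x1 x2 x3 x4 x5) \<in> dual_space"
    and "\<And>x1 x3 x4 x5. (\<lambda>x2. K x1 x2 x3 x4 x5) \<in> dual_space"
    and "\<And>x1 x2 x4 x5. (\<lambda>x3. K x1 x2 x3 x4 x5) \<in> dual_space"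
    and "\<And>x1 x2 x3 x5. (\<lambda>x4. K x1 x2 x3 x4 x5) \<in> dual_space"
    and "\<And>x1 x2 x3 x4. (\<lambda>x5. K x1 x2 x3 x4 x5) \<in> dual_space"
  shows "Sw x (\<lambda>z t. Sw t (\<lambda>x3 w. Sw z (\<lambda>x1 x2. Sw w (\<lambda>x4 x5. K x1 x2 x3 x4 x5)))) =
         Sw x (\<lambda>x1 r. Sw r (\<lambda>m x5. Sw m (\<lambda>x2 s. Sw s (\<lambda>x3 x4. K x1 x2 x3 x4 x5))))"
proof -
  have "Sw x (\<lambda>z t. Sw t (\<lambda>x3 w. Sw z (\<lambda>x1 x2. Sw w (\<lambda>x4 x5. K x1 x2 x3 x4 x5)))) =
        Sw x (\<lambda>z t. Sw z (\<lambda>x1 x2. Sw t (\<lambda>x3 w. Sw w (\<lambda>x4 x5. K x1 x2 x3 x4 x5))))"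
    by (rule Sw_cong, rule Sw_swap)
  also have "\<dots> = Sw x (\<lambda>x1 r. Sw r (\<lambda>x2 t. Sw t (\<lambda>x3 w. Sw w (\<lambda>x4 x5. K x1 x2 x3 x4 x5))))"
    by (rule Sw_coassoc) (intro Sw_dual_inner Sw_dual_outer linear_id_fun assms)+
  also have "\<dots> = Sw x (\<lambda>x1 r. Sw r (\<lambda>m x5. Sw m (\<lambda>x2 s. Sw s (\<lambda>x3 x4. K x1 x2 x3 x4 x5))))"
    by (rule Sw_cong, rule Sw_unnest4[symmetric]) (intro assms)+
  finally show ?thesis .
qed

lemma Sw_counit_right': "f \<in> dual_space \<Longrightarrow> Sw a (\<lambda>x y. \<epsilon> y * f x) = f a"
  using Sw_counit_right[of f a] by (simp add: mult.commute)

lemma Sw_counit_left_outer: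
  assumes "\<And>y. (\<lambda>x. F x y) \<in> dual_space" "\<And>x. F x \<in> dual_space"
  shows "Sw a (\<lambda>u t. \<epsilon> u * Sw t F) = Sw a F"
  by (rule Sw_counit_left) (rule Sw_linear[OF assms])

lemma Sw_hitR:
  assumes "\<And>y. (\<lambda>x. F x y) \<in> dual_space" "\<And>x. F x \<in> dual_space"
  shows "Sw (hitR f a) F = Sw a (\<lambda>t y. Sw t F * f y)"
  by (rule dual_hitR) (rule Sw_linear[OF assms])

lemma sum_list_sw3: "(\<Sum>(x, y, z)\<leftarrow>sw3 a. F x y z) = Sw a (\<lambda>x t. Sw t (\<lambda>y z. F x y z))"
  by (simp add: sw3_def Sw_def map_concat sum_list_concat comp_def case_prod_unfold)

lemma sum_list_sw4: "(\<Sum>(x, y, z, w)\<leftarrow>sw4 a. F x y z w) = Sw a (\<lambda>x t. Sw t (\<lambda>y s. Sw s (\<lambda>z w. F x y z w)))"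
  using sum_list_sw3 by (simp add: sw4_def Sw_def map_concat sum_list_concat comp_def case_prod_unfold)

lemma sum_list_sw5:
  "(\<Sum>(x, y, z, w, v)\<leftarrow>sw5 a. F x y z w v) =
    Sw a (\<lambda>x t. Sw t (\<lambda>y s. Sw s (\<lambda>z r. Sw r (\<lambda>w v. F x y z w v))))"
  using sum_list_sw4 by (simp add: sw5_def Sw_def map_concat sum_list_concat comp_def case_prod_unfold)

section \<open>The convolution algebra of trilinear forms\<close>

definition conv3 ::
    "('a \<Rightarrow> 'a \<Rightarrow> 'a \<Rightarrow> 'k) \<Rightarrow> ('a \<Rightarrow> 'a \<Rightarrow> 'a \<Rightarrow> 'k) \<Rightarrow> 'a \<Rightarrow> 'a \<Rightarrow> 'a \<Rightarrow> 'k"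
  where "conv3 F G a b c = Sw a (\<lambda>a1 a2. Sw b (\<lambda>b1 b2. Sw c (\<lambda>c1 c2. F a1 b1 c1 * G a2 b2 c2)))"

lemma trilinear_dual1: "trilinear_form F \<Longrightarrow> Vector_Spaces.linear scale scale g \<Longrightarrow> (\<lambda>x. F (g x) b c) \<in> dual_space"
  and trilinear_dual2: "trilinear_form F \<Longrightarrow> Vector_Spaces.linear scale scale g \<Longrightarrow> (\<lambda>x. F a (g x) c) \<in> dual_space"
  and trilinear_dual3: "trilinear_form F \<Longrightarrow> Vector_Spaces.linear scale scale g \<Longrightarrow> (\<lambda>x. F a b (g x)) \<in> dual_space"
  unfolding trilinear_form_def
  using dual_comp[of "\<lambda>x. F x b c" g] dual_comp[of "\<lambda>x. F a x c" g] dual_comp[of "\<lambda>x. F a b x" g] by auto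

lemma trilinear_conv3:
  assumes "trilinear_form F" "trilinear_form G"
  shows "trilinear_form (conv3 F G)"
  unfolding trilinear_form_def conv3_def
  by (intro conjI allI; intro Sw_dual_inner Sw_dual_outer linear_id_fun dual_cmult_left dual_cmult_right
      trilinear_dual1[OF assms(1)] trilinear_dual2[OF assms(1)] trilinear_dual3[OF assms(1)]
      trilinear_dual1[OF assms(2)] trilinear_dual2[OF assms(2)] trilinear_dual3[OF assms(2)])

lemma conv3_assoc:
  assumes "trilinear_form F" "trilinear_form G" "trilinear_form H"
  shows "conv3 (conv3 F G) H = conv3 F (conv3 G H)"
proof (intro ext)
  fix a b c
  note tri = trilinear_dual1[OF assms(1)] trilinear_dual2[OF assms(1)] trilinear_dual3[OF assms(1)]
      trilinear_dual1[OF assms(2)] trilinear_dual2[OF assms(2)] trilinear_dual3[OF assms(2)]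
      trilinear_dual1[OF assms(3)] trilinear_dual2[OF assms(3)] trilinear_dual3[OF assms(3)]
  let ?K = "\<lambda>a1 a2 a3 b1 b2 b3 c1 c2 c3. F a1 b1 c1 * (G a2 b2 c2 * H a3 b3 c3)"
  have "conv3 (conv3 F G) H a b c =
      Sw a (\<lambda>s a3. Sw b (\<lambda>t b3. Sw c (\<lambda>r c3. Sw s (\<lambda>a1 a2. Sw t (\<lambda>b1 b2. Sw r (\<lambda>c1 c2.
        ?K a1 a2 a3 b1 b2 b3 c1 c2 c3))))))"
    by (simp add: conv3_def Sw_mult_right mult.assoc)
  also have "\<dots> = Sw a (\<lambda>s a3. Sw b (\<lambda>t b3. Sw s (\<lambda>a1 a2. Sw t (\<lambda>b1 b2. Sw c (\<lambda>r c3. Sw r (\<lambda>c1 c2.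
        ?K a1 a2 a3 b1 b2 b3 c1 c2 c3))))))"
    by (rule Sw_cong, rule Sw_cong, subst Sw_swap, rule Sw_cong, rule Sw_swap)
  also have "\<dots> = Sw a (\<lambda>s a3. Sw s (\<lambda>a1 a2. Sw b (\<lambda>t b3. Sw t (\<lambda>b1 b2. Sw c (\<lambda>r c3. Sw r (\<lambda>c1 c2.
        ?K a1 a2 a3 b1 b2 b3 c1 c2 c3))))))"
    by (rule Sw_cong, rule Sw_swap)
  also have "\<dots> = Sw a (\<lambda>a1 s. Sw s (\<lambda>a2 a3. Sw b (\<lambda>t b3. Sw t (\<lambda>b1 b2. Sw c (\<lambda>r c3. Sw r (\<lambda>c1 c2.
        ?K a1 a2 a3 b1 b2 b3 c1 c2 c3))))))"
    by (rule Sw_coassoc) (intro Sw_dual_inner Sw_dual_outer linear_id_fun dual_cmult_left dual_cmult_right tri)+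
  also have "\<dots> = Sw a (\<lambda>a1 s. Sw s (\<lambda>a2 a3. Sw b (\<lambda>b1 t. Sw t (\<lambda>b2 b3. Sw c (\<lambda>r c3. Sw r (\<lambda>c1 c2.
        ?K a1 a2 a3 b1 b2 b3 c1 c2 c3))))))"
    by (rule Sw_cong, rule Sw_cong, rule Sw_coassoc)
      (intro Sw_dual_inner Sw_dual_outer linear_id_fun dual_cmult_left dual_cmult_right tri)+
  also have "\<dots> = Sw a (\<lambda>a1 s. Sw s (\<lambda>a2 a3. Sw b (\<lambda>b1 t. Sw t (\<lambda>b2 b3. Sw c (\<lambda>c1 r. Sw r (\<lambda>c2 c3.
        ?K a1 a2 a3 b1 b2 b3 c1 c2 c3))))))"
    by (rule Sw_cong, rule Sw_cong, rule Sw_cong, rule Sw_cong, rule Sw_coassoc)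
      (intro Sw_dual_inner Sw_dual_outer linear_id_fun dual_cmult_left dual_cmult_right tri)+
  also have "\<dots> = Sw a (\<lambda>a1 s. Sw b (\<lambda>b1 t. Sw s (\<lambda>a2 a3. Sw t (\<lambda>b2 b3. Sw c (\<lambda>c1 r. Sw r (\<lambda>c2 c3.
        ?K a1 a2 a3 b1 b2 b3 c1 c2 c3))))))"
    by (rule Sw_cong, rule Sw_swap)
  also have "\<dots> = Sw a (\<lambda>a1 s. Sw b (\<lambda>b1 t. Sw c (\<lambda>c1 r. Sw s (\<lambda>a2 a3. Sw t (\<lambda>b2 b3. Sw r (\<lambda>c2 c3.
        ?K a1 a2 a3 b1 b2 b3 c1 c2 c3))))))"
    by (rule Sw_cong, rule Sw_cong, subst Sw_swap[of c], rule Sw_cong, rule Sw_swap)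
  also have "\<dots> = conv3 F (conv3 G H) a b c"
    by (simp add: conv3_def Sw_mult_left)
  finally show "conv3 (conv3 F G) H a b c = conv3 F (conv3 G H) a b c" .
qed

lemma conv3_counit_left:
  assumes "trilinear_form F"
  shows "conv3 (\<lambda>a b c. \<epsilon> a * \<epsilon> b * \<epsilon> c) F = F"
proof (intro ext)
  fix a b c
  note tri = trilinear_dual1[OF assms] trilinear_dual2[OF assms] trilinear_dual3[OF assms]
  have "conv3 (\<lambda>a b c. \<epsilon> a * \<epsilon> b * \<epsilon> c) F a b c =
      Sw a (\<lambda>a1 a2. \<epsilon> a1 * Sw b (\<lambda>b1 b2. \<epsilon> b1 * Sw c (\<lambda>c1 c2. \<epsilon> c1 * F a2 b2 c2)))"
    by (simp add: conv3_def Sw_mult_left mult.assoc)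
  also have "\<dots> = F a b c"
    by (simp add: Sw_counit_left tri linear_id_fun)
  finally show "conv3 (\<lambda>a b c. \<epsilon> a * \<epsilon> b * \<epsilon> c) F a b c = F a b c" .
qed

lemma conv3_counit_right:
  assumes "trilinear_form F"
  shows "conv3 F (\<lambda>a b c. \<epsilon> a * \<epsilon> b * \<epsilon> c) = F"
proof (intro ext)
  fix a b c
  note tri = trilinear_dual1[OF assms] trilinear_dual2[OF assms] trilinear_dual3[OF assms]
  have "conv3 F (\<lambda>a b c. \<epsilon> a * \<epsilon> b * \<epsilon> c) a b c =
      Sw a (\<lambda>a1 a2. \<epsilon> a2 * Sw b (\<lambda>b1 b2. \<epsilon> b2 * Sw c (\<lambda>c1 c2. \<epsilon> c2 * F a1 b1 c1)))"
    by (simp add: conv3_def Sw_mult_left ac_simps)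
  also have "\<dots> = F a b c"
    by (simp add: Sw_counit_right' tri linear_id_fun)
  finally show "conv3 F (\<lambda>a b c. \<epsilon> a * \<epsilon> b * \<epsilon> c) a b c = F a b c" .
qed

subsection \<open>Colinear projections of finite rank\<close>

lemma hitR_colinear:
  assumes f: "f \<in> dual_space"
    and G: "\<And>y. (\<lambda>x. G x y) \<in> dual_space" "\<And>x. G x \<in> dual_space"
  shows "Sw (hitR f a) G = Sw a (\<lambda>u v. G u (hitR f v))"
proof -
  have "Sw (hitR f a) G = Sw a (\<lambda>t y. Sw t (\<lambda>u v. G u v * f y))"
    by (simp add: Sw_hitR[OF G] Sw_mult_right)
  also have "\<dots> = Sw a (\<lambda>u t. Sw t (\<lambda>v y. G u v * f y))"
    by (rule Sw_coassoc) (intro dual_cmult_left dual_cmult_right f G)+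
  finally show ?thesis by (simp add: dual_hitR[OF G(2)])
qed

text \<open>P is a map of left comodules, \<Delta>(P a) = a1 tensor P(a2), with the equality of
  tensors tested on all bilinear forms.\<close>

definition colinear :: "('a \<Rightarrow> 'a) \<Rightarrow> bool"
  where "colinear P \<longleftrightarrow> (\<forall>G a. (\<forall>y. (\<lambda>x. G x y) \<in> dual_space) \<longrightarrow> (\<forall>x. G x \<in> dual_space) \<longrightarrow>
    Sw (P a) G = Sw a (\<lambda>u v. G u (P v)))"

text \<open>Fitting's lemma for the colinear map \<open>hitR f\<close>: \<open>P\<close> projects onto the stable image.\<close>

lemma colinear_projection:
  assumes f: "f \<in> dual_space" and X: "finite X" "\<And>a. hitR f a \<in> span X" and e: "hitR f e = e"
  obtains P M where "Vector_Spaces.linear scale scale P" "subspace M" "M \<subseteq> span X"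
    "\<And>a. P a \<in> M" "\<forall>m\<in>M. P m = m" "P e = e" "colinear P"
proof -
  interpret vector_space_pair scale scale
    by (simp add: vector_space_pair_def vector_space_axioms)
  define F where "F = hitR f"
  have linF: "Vector_Spaces.linear scale scale (F ^^ n)" for n
  proof (induction n)
    case (Suc n)
    then show ?case using linear_hitR[OF f] by (simp add: F_def linear_self_iff)
  qed (simp add: linear_id_fun)
  \<comment> \<open>The shift to \<open>Suc n\<close> puts even \<open>M 0\<close> inside the
    finite-dimensional range of \<open>F\<close>.\<close>
  define M where "M n = range (F ^^ Suc n)" for n
  have subM: "subspace (M n)" for n
    unfolding M_def by (rule linear_subspace_image[OF linF]) simp
  have MX: "M n \<subseteq> span X" for n using X(2) by (auto simp: M_def F_def)
  have FM: "F ` M n = M (Suc n)" for n by (simp add: M_def image_image)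
  have M_Suc: "M (Suc n) \<subseteq> M n" for n
    unfolding M_def funpow_Suc_right[of "Suc n"] by auto
  \<comment> \<open>Least dimension replaces stabilization of the descending chain:
    \<open>M (Suc n)\<close> lies in \<open>M n\<close> and cannot be smaller.\<close>
  obtain n where n: "\<And>i. dim (M n) \<le> dim (M i)"
    using ex_has_least_nat[of "\<lambda>_. True" 0 "\<lambda>i. dim (M i)"] by auto
  have stable: "F ` M n = M n"
  proof -
    obtain B where B: "finite B" "independent B" "B \<subseteq> M (Suc n)" "span B = M (Suc n)"
      by (rule finite_basis[OF subM MX X(1)])
    obtain B' where B': "finite B'" "independent B'" "B' \<subseteq> M n" "span B' = M n"
      by (rule finite_basis[OF subM MX X(1)])
    have "card B' \<le> card B"
      using n[of "Suc n"] basis_card_eq_dim[of B "M (Suc n)"] basis_card_eq_dim[of B' "M n"] B B' by auto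
    moreover have "B \<subseteq> M n" using B(3) M_Suc[of n] by blast
    ultimately have "M n \<subseteq> span B"
      using independent_card_eq_span[of B "M n" B'] B(2) B'(1,4) by simp
    then show ?thesis using FM M_Suc B(4) by blast
  qed
  define G where "G = F ^^ Suc n"
  have GM: "G ` M n = M n"
  proof -
    have "(F ^^ i) ` M n = M n" for i
    proof (induction i)
      case (Suc i)
      then show ?case by (simp add: stable flip: image_image image_comp)
    qed simp
    then show ?thesis by (simp only: G_def)
  qed
  have G_in: "G a \<in> M n" for a by (simp add: G_def M_def)
  obtain k where k: "Vector_Spaces.linear scale scale k" "\<And>v. k v \<in> M n"
    "\<And>v. v \<in> M n \<Longrightarrow> G (k v) = v" "\<And>v. v \<in> M n \<Longrightarrow> k (G v) = v"
    by (rule surjective_imp_inverse_on[OF subM MX X(1) linF[of "Suc n", folded G_def] GM]) (rule that)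
  define P where "P a = k (G a)" for a
  have linP: "Vector_Spaces.linear scale scale P"
    using k(1) linF[of "Suc n"] by (simp add: P_def[abs_def] G_def linear_self_iff)
  have G_col: "Sw (G a) H = Sw a (\<lambda>u v. H u (G v))"
    if "\<And>y. (\<lambda>x. H x y) \<in> dual_space" "\<And>x. H x \<in> dual_space" for a H
  proof -
    have "Sw ((F ^^ i) a) H = Sw a (\<lambda>u v. H u ((F ^^ i) v))" for i
    proof (induction i arbitrary: a)
      case (Suc i)
      have "Sw ((F ^^ Suc i) a) H = Sw (F a) (\<lambda>u v. H u ((F ^^ i) v))"
        by (simp add: funpow_Suc_right Suc del: funpow.simps)
      also have "\<dots> = Sw a (\<lambda>u v. H u ((F ^^ i) (F v)))"
        unfolding F_def by (rule hitR_colinear[OF f]) (use that dual_comp[OF _ linF] in \<open>auto simp: F_def\<close>)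
      finally show ?case by (simp add: funpow_Suc_right del: funpow.simps)
    qed simp
    then show ?thesis by (simp only: G_def)
  qed
  show thesis
  proof (rule that[of P "M n"])
    show Pm: "\<forall>m\<in>M n. P m = m" by (simp add: P_def k(4))
    have "(F ^^ i) e = e" for i by (induction i) (simp_all add: F_def e)
    then have "e \<in> M n" using G_in[of e] unfolding G_def by metis
    then show "P e = e" using Pm by blast
    show "colinear P"
      unfolding colinear_def
    proof (intro allI impI)
      fix H a
      assume "\<forall>y. (\<lambda>x. H x y) \<in> dual_space" "\<forall>x. H x \<in> dual_space"
      then have H: "\<And>y. (\<lambda>x. H x y) \<in> dual_space" "\<And>x. H x \<in> dual_space" by blast+
      have Hk: "\<And>x. (\<lambda>y. H x (k y)) \<in> dual_space" and HP: "\<And>x. (\<lambda>y. H x (P y)) \<in> dual_space"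
        using dual_comp[OF H(2)] k(1) linP by auto
      \<comment> \<open>Colinearity is known for \<open>G\<close> but not for its partial inverse
        \<open>k\<close>. It passes to \<open>P\<close> since \<open>G (P a) = G a\<close>, and
        since \<open>P a\<close> itself lies in the range of \<open>G\<close>, so that
        \<open>P\<close> meets only right legs \<open>G v\<close>, which it fixes.\<close>
      obtain m where m: "P a = G m"
        using k(2) by (auto simp: P_def M_def G_def)
      have "Sw a (\<lambda>u v. H u (P v)) = Sw (G a) (\<lambda>u v. H u (k v))"
        by (simp add: G_col[OF H(1) Hk] P_def)
      also have "\<dots> = Sw (G (P a)) (\<lambda>u v. H u (k v))"
        by (simp add: P_def k(3) G_in)
      also have "\<dots> = Sw (P a) (\<lambda>u v. H u (P v))"
        by (simp add: G_col[OF H(1) Hk] P_def)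
      also have "\<dots> = Sw m (\<lambda>u v. H u (P (G v)))"
        unfolding m by (rule G_col[OF H(1) HP])
      also have "\<dots> = Sw (P a) H"
        by (simp add: m G_col[OF H] Pm G_in)
      finally show "Sw (P a) H = Sw a (\<lambda>u v. H u (P v))" ..
    qed
  qed (use linP subM MX k(2) in \<open>auto simp: P_def\<close>)
qed

end

section \<open>Dual quasi-bialgebras\<close>

context dual_quasi_bialgebra
begin

lemma linear_mult_left: "Vector_Spaces.linear scale scale g \<Longrightarrow> Vector_Spaces.linear scale scale (\<lambda>x. g x \<cdot> b)"
  and linear_mult_right: "Vector_Spaces.linear scale scale g \<Longrightarrow> Vector_Spaces.linear scale scale (\<lambda>x. b \<cdot> g x)"
  using mult_bilinear by (auto simp: bilinear_map_def linear_self_iff)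

lemmas multilinear_intros = Sw_dual_inner Sw_dual_outer dual_cmult_left dual_cmult_right
  linear_id_fun linear_mult_left linear_mult_right dual_comp[OF counit_dual]
  trilinear_dual1[OF phi_trilinear] trilinear_dual2[OF phi_trilinear] trilinear_dual3[OF phi_trilinear]
  trilinear_dual1[OF psi_trilinear] trilinear_dual2[OF psi_trilinear] trilinear_dual3[OF psi_trilinear]

lemma Sw_unit:
  assumes "\<And>y. (\<lambda>x. F x y) \<in> dual_space" "\<And>x. F x \<in> dual_space"
  shows "Sw \<one> F = F \<one> \<one>"
  using Sw_eqI[OF assms, of \<one> "[(\<one>, \<one>)]"] unit_comult by simp

lemma Sw_mult:
  assumes "\<And>y. (\<lambda>x. F x y) \<in> dual_space" "\<And>x. F x \<in> dual_space"
  shows "Sw (a \<cdot> b) F = Sw a (\<lambda>a1 a2. Sw b (\<lambda>b1 b2. F (a1 \<cdot> b1) (a2 \<cdot> b2)))"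
proof -
  have "\<Delta> (a \<cdot> b) = tensor [[x, y]. (x, y) \<leftarrow> [(a1 \<cdot> b1, a2 \<cdot> b2). (a1, a2) \<leftarrow> sw a, (b1, b2) \<leftarrow> sw b]]"
    by (simp add: mult_comult map_concat comp_def case_prod_unfold)
  from Sw_eqI[OF assms this] show ?thesis
    by (simp add: Sw_def map_concat sum_list_concat comp_def case_prod_unfold)
qed

lemma phi_assoc:
  assumes \<theta>: "\<theta> \<in> dual_space"
  shows "Sw a (\<lambda>a1 a2. Sw b (\<lambda>b1 b2. Sw c (\<lambda>c1 c2. \<theta> (a1 \<cdot> (b1 \<cdot> c1)) * \<phi> a2 b2 c2))) =
         Sw a (\<lambda>a1 a2. Sw b (\<lambda>b1 b2. Sw c (\<lambda>c1 c2. \<phi> a1 b1 c1 * \<theta> (a2 \<cdot> b2 \<cdot> c2))))"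
  using arg_cong[OF quasi_assoc[where a = a and b = b and c = c], of \<theta>]
  by (simp add: dual_sum_list[OF \<theta>] dual_scale[OF \<theta>] Sw_def case_prod_unfold mult.commute)

text \<open>In the algebra of trilinear forms, quasi-associativity reads P * \<phi> = \<phi> * Q for
  the two bracketings P and Q. Multiplying by \<psi> on both sides gives \<psi> * P = Q *
  \<psi>.\<close>

lemma psi_assoc:
  assumes \<theta>: "\<theta> \<in> dual_space"
  shows "Sw a (\<lambda>a1 a2. Sw b (\<lambda>b1 b2. Sw c (\<lambda>c1 c2. \<theta> (a1 \<cdot> b1 \<cdot> c1) * \<psi> a2 b2 c2))) =
         Sw a (\<lambda>a1 a2. Sw b (\<lambda>b1 b2. Sw c (\<lambda>c1 c2. \<psi> a1 b1 c1 * \<theta> (a2 \<cdot> (b2 \<cdot> c2)))))"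
proof -
  let ?e = "\<lambda>a b c. \<epsilon> a * \<epsilon> b * \<epsilon> c"
  let ?P = "\<lambda>a b c. \<theta> (a \<cdot> (b \<cdot> c))"
  let ?Q = "\<lambda>a b c. \<theta> (a \<cdot> b \<cdot> c)"
  have P: "trilinear_form ?P" and Q: "trilinear_form ?Q"
    unfolding trilinear_form_def by (intro conjI allI; intro multilinear_intros dual_comp[OF \<theta>])+
  note tri = P Q phi_trilinear psi_trilinear trilinear_conv3
  have \<phi>\<psi>: "conv3 \<phi> \<psi> = ?e" and \<psi>\<phi>: "conv3 \<psi> \<phi> = ?e"
    using phi_psi psi_phi by (simp_all add: fun_eq_iff conv3_def Sw_def)
  have *: "conv3 ?P \<phi> = conv3 \<phi> ?Q"
    using phi_assoc[OF \<theta>] by (simp add: fun_eq_iff conv3_def)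
  have "conv3 \<psi> ?P = conv3 \<psi> (conv3 ?P (conv3 \<phi> \<psi>))"
    unfolding \<phi>\<psi> by (simp only: conv3_counit_right tri)
  also have "\<dots> = conv3 \<psi> (conv3 (conv3 \<phi> ?Q) \<psi>)"
    by (simp only: conv3_assoc[symmetric] tri *)
  also have "\<dots> = conv3 (conv3 (conv3 \<psi> \<phi>) ?Q) \<psi>"
    by (simp only: conv3_assoc tri)
  also have "\<dots> = conv3 ?Q \<psi>"
    unfolding \<psi>\<phi> by (simp only: conv3_counit_left tri)
  finally show ?thesis by (simp add: fun_eq_iff conv3_def)
qed

text \<open>The axiom \<open>phi_unit\<close> normalizes the middle argument. The cocycle identity
  with 1 in the third place becomes \<phi> = \<phi> * X, where X(a, b, c) = \<phi>(a, b, 1)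
  \<epsilon>(c). Cancelling \<phi> normalizes its last argument, and hence that of the inverse
  \<psi>.\<close>

lemma psi_unit_right: "\<psi> a b \<one> = \<epsilon> a * \<epsilon> b"
proof -
  let ?e = "\<lambda>a b c. \<epsilon> a * \<epsilon> b * \<epsilon> c"
  let ?X = "\<lambda>a b c. \<phi> a b \<one> * \<epsilon> c"
  have X: "trilinear_form ?X"
    unfolding trilinear_form_def by (intro conjI allI; intro multilinear_intros)
  have \<psi>\<phi>: "conv3 \<psi> \<phi> = ?e"
    using psi_phi by (simp add: fun_eq_iff conv3_def Sw_def)
  have "conv3 \<phi> ?X = \<phi>"
  proof (intro ext)
    fix a b d
    have "Sw a (\<lambda>a1 a2. Sw b (\<lambda>b1 b2. Sw \<one> (\<lambda>c1 c2. Sw d (\<lambda>d1 d2. \<phi> a1 b1 (c1 \<cdot> d1) * \<phi> (a2 \<cdot> b2) c2 d2)))) =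
      Sw a (\<lambda>a1 a2. Sw b (\<lambda>b1 t. Sw t (\<lambda>b2 b3. Sw \<one> (\<lambda>c1 s. Sw s (\<lambda>c2 c3. Sw d (\<lambda>d1 d2.
        \<phi> b1 c1 d1 * \<phi> a1 (b2 \<cdot> c2) d2 * \<phi> a2 b3 c3))))))"
      using phi_cocycle[where a = a and b = b and c = \<one> and d = d] unfolding sum_list_sw3 Sw_def .
    also have "Sw a (\<lambda>a1 a2. Sw b (\<lambda>b1 b2. Sw \<one> (\<lambda>c1 c2. Sw d (\<lambda>d1 d2. \<phi> a1 b1 (c1 \<cdot> d1) * \<phi> (a2 \<cdot> b2) c2 d2)))) =
      Sw a (\<lambda>a1 a2. \<epsilon> a2 * Sw b (\<lambda>b1 b2. \<epsilon> b2 * Sw d (\<lambda>d1 d2. \<epsilon> d2 * \<phi> a1 b1 d1)))"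
      by (subst Sw_unit, (intro multilinear_intros)+)
        (simp add: unit_left phi_unit mult_counit Sw_mult_left ac_simps)
    also have "\<dots> = \<phi> a b d"
      by (simp add: Sw_counit_right' multilinear_intros)
    also have "Sw a (\<lambda>a1 a2. Sw b (\<lambda>b1 t. Sw t (\<lambda>b2 b3. Sw \<one> (\<lambda>c1 s. Sw s (\<lambda>c2 c3. Sw d (\<lambda>d1 d2.
        \<phi> b1 c1 d1 * \<phi> a1 (b2 \<cdot> c2) d2 * \<phi> a2 b3 c3)))))) =
      Sw a (\<lambda>a1 a2. Sw b (\<lambda>b1 t. \<epsilon> b1 * Sw t (\<lambda>b2 b3. \<phi> a2 b3 \<one> * Sw d (\<lambda>d1 d2. \<epsilon> d1 * \<phi> a1 b2 d2))))"
      by (subst Sw_unit, (intro multilinear_intros)+, subst Sw_unit, (intro multilinear_intros)+)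
        (simp add: unit_right phi_unit Sw_mult_left ac_simps)
    also have "\<dots> = Sw a (\<lambda>a1 a2. Sw b (\<lambda>b2 b3. \<phi> a2 b3 \<one> * \<phi> a1 b2 d))"
      by (simp add: Sw_counit_left Sw_counit_left_outer multilinear_intros)
    also have "\<dots> = Sw a (\<lambda>a1 a2. Sw b (\<lambda>b2 b3. \<phi> a2 b3 \<one> * Sw d (\<lambda>d1 d2. \<epsilon> d2 * \<phi> a1 b2 d1)))"
      by (simp add: Sw_counit_right' multilinear_intros)
    also have "\<dots> = conv3 \<phi> ?X a b d"
      by (simp add: conv3_def Sw_mult_left ac_simps)
    finally show "conv3 \<phi> ?X a b d = \<phi> a b d" ..
  qed
  then have "conv3 (conv3 \<psi> \<phi>) ?X = conv3 \<psi> \<phi>"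
    by (simp only: conv3_assoc psi_trilinear phi_trilinear X)
  then have "?X = ?e" unfolding \<psi>\<phi> by (simp only: conv3_counit_left X)
  then have "?X a b \<one> = ?e a b \<one>" for a b by (auto simp: fun_eq_iff)
  then have \<phi>1: "\<phi> a b \<one> = \<epsilon> a * \<epsilon> b" for a b
    by (simp add: unit_counit)
  have "Sw a (\<lambda>a1 a2. Sw b (\<lambda>b1 b2. Sw \<one> (\<lambda>c1 c2. \<phi> a1 b1 c1 * \<psi> a2 b2 c2))) = \<epsilon> a * \<epsilon> b"
    using phi_psi[where a = a and b = b and c = \<one>] by (simp add: Sw_def unit_counit)
  moreover have "Sw a (\<lambda>a1 a2. Sw b (\<lambda>b1 b2. Sw \<one> (\<lambda>c1 c2. \<phi> a1 b1 c1 * \<psi> a2 b2 c2))) =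
      Sw a (\<lambda>a1 a2. \<epsilon> a1 * Sw b (\<lambda>b1 b2. \<epsilon> b1 * \<psi> a2 b2 \<one>))"
    by (subst Sw_unit, (intro multilinear_intros)+) (simp add: \<phi>1 Sw_mult_left ac_simps)
  ultimately show ?thesis by (simp add: Sw_counit_left multilinear_intros)
qed

end

section \<open>Dual quasi-Hopf algebras\<close>

context dual_quasi_hopf_algebra
begin

lemma linear_S: "Vector_Spaces.linear scale scale g \<Longrightarrow> Vector_Spaces.linear scale scale (\<lambda>x. S (g x))"
  using antipode_linear by (auto simp: linear_self_iff)

lemmas hopf_intros = multilinear_intros linear_S dual_comp[OF alpha_dual] dual_comp[OF beta_dual]

lemma Sw_S:
  assumes "\<And>y. (\<lambda>x. F x y) \<in> dual_space" "\<And>x. F x \<in> dual_space"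
  shows "Sw (S a) F = Sw a (\<lambda>u v. F (S v) (S u))"
proof -
  have "\<Delta> (S a) = tensor [[x, y]. (x, y) \<leftarrow> [(S a2, S a1). (a1, a2) \<leftarrow> sw a]]"
    by (simp add: antipode_comult comp_def case_prod_unfold)
  from Sw_eqI[OF assms this] show ?thesis
    by (simp add: Sw_def comp_def case_prod_unfold)
qed

lemma Sw_swap_in: "Sw a (\<lambda>a1 a2. Sw x (\<lambda>x1 x2. Sw (y x1 x2) (\<lambda>y1 y2. F a1 a2 x1 x2 y1 y2))) =
    Sw x (\<lambda>x1 x2. Sw (y x1 x2) (\<lambda>y1 y2. Sw a (\<lambda>a1 a2. F a1 a2 x1 x2 y1 y2)))"
  by (subst Sw_swap) (rule Sw_cong, rule Sw_swap)

lemma Sw_antipode_alpha: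
  assumes \<theta>: "\<theta> \<in> dual_space"
  shows "Sw a (\<lambda>u t. Sw t (\<lambda>v w. \<alpha> v * \<theta> (S u \<cdot> w))) = \<alpha> a * \<theta> \<one>"
proof -
  have "Sw a (\<lambda>u t. Sw t (\<lambda>v w. \<alpha> v * \<theta> (S u \<cdot> w))) = \<theta> (\<Sum>(a1, a2, a3)\<leftarrow>sw3 a. \<alpha> a2 *s (S a1 \<cdot> a3))"
    by (simp add: dual_sum_list[OF \<theta>] case_prod_unfold dual_scale[OF \<theta>]
        flip: sum_list_sw3)
  then show ?thesis by (simp add: antipode_alpha dual_scale[OF \<theta>])
qed

lemma Sw_antipode_beta:
  assumes \<theta>: "\<theta> \<in> dual_space"
  shows "Sw a (\<lambda>u t. Sw t (\<lambda>v w. \<beta> v * \<theta> (u \<cdot> S w))) = \<beta> a * \<theta> \<one>"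
proof -
  have "Sw a (\<lambda>u t. Sw t (\<lambda>v w. \<beta> v * \<theta> (u \<cdot> S w))) = \<theta> (\<Sum>(a1, a2, a3)\<leftarrow>sw3 a. \<beta> a2 *s (a1 \<cdot> S a3))"
    by (simp add: dual_sum_list[OF \<theta>] case_prod_unfold dual_scale[OF \<theta>]
        flip: sum_list_sw3)
  then show ?thesis by (simp add: antipode_beta dual_scale[OF \<theta>])
qed

text \<open>The coefficients that appear when the products in \<open>S(x1) \<alpha>(x2) (x3 a)\<close> and
  \<open>(y S(a1)) \<alpha>(a2) a3\<close> are reassociated so that the antipode axiom applies.\<close>

definition psi_alpha :: "'a \<Rightarrow> 'a \<Rightarrow> 'k"
  where "psi_alpha x a = Sw x (\<lambda>x1 t. Sw t (\<lambda>x2 x3. \<alpha> x2 * \<psi> (S x1) x3 a))"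

definition phi_alpha :: "'a \<Rightarrow> 'a \<Rightarrow> 'k"
  where "phi_alpha y a = Sw a (\<lambda>a1 t. Sw t (\<lambda>a2 a3. \<alpha> a2 * \<phi> y (S a1) a3))"

lemma psi_alpha_dual1: "Vector_Spaces.linear scale scale g \<Longrightarrow> (\<lambda>x. psi_alpha (g x) a) \<in> dual_space"
  and psi_alpha_dual2: "Vector_Spaces.linear scale scale g \<Longrightarrow> (\<lambda>a. psi_alpha x (g a)) \<in> dual_space"
  and phi_alpha_dual1: "Vector_Spaces.linear scale scale g \<Longrightarrow> (\<lambda>x. phi_alpha (g x) a) \<in> dual_space"
  and phi_alpha_dual2: "Vector_Spaces.linear scale scale g \<Longrightarrow> (\<lambda>a. phi_alpha x (g a)) \<in> dual_space"
  unfolding psi_alpha_def phi_alpha_def by (intro hopf_intros; assumption)+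

lemmas forms_intros = hopf_intros psi_alpha_dual1 psi_alpha_dual2 phi_alpha_dual1 phi_alpha_dual2

lemma psi_alpha_unit: "psi_alpha x \<one> = \<alpha> x"
proof -
  have "psi_alpha x \<one> = Sw x (\<lambda>x1 t. \<epsilon> x1 * Sw t (\<lambda>x2 x3. \<epsilon> x3 * \<alpha> x2))"
    by (simp add: psi_alpha_def psi_unit_right antipode_counit Sw_mult_left ac_simps)
  then show ?thesis by (simp add: Sw_counit_left Sw_counit_right' alpha_dual)
qed

text \<open>A unit in front of \<open>a1\<close> is opened as \<alpha>(x3) S(x2) x4 by the antipode
  axiom; \<open>psi_assoc\<close> then moves the bracket, which turns (S(x2) x4) a1 into S(x1) (x5
  a2). This is the substitute for inserting S(x1) x2 in front of a.\<close>

lemma psi_alpha_assoc: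
  assumes \<theta>: "\<theta> \<in> dual_space"
  shows "Sw a (\<lambda>a1 a2. \<theta> a1 * psi_alpha x a2) =
    Sw x (\<lambda>x1 t. Sw t (\<lambda>x2 x3. Sw a (\<lambda>a1 a2. psi_alpha x2 a1 * \<theta> (S x1 \<cdot> (x3 \<cdot> a2)))))"
proof -
  note intros = hopf_intros dual_comp[OF \<theta>]
  have \<alpha>_collapse: "Sw m (\<lambda>x2 s. Sw s (\<lambda>x3 x4. \<alpha> x3 * Sw a (\<lambda>a1 a2. \<theta> (S x2 \<cdot> x4 \<cdot> a1) * \<psi> (S x1) x5 a2)))
      = \<alpha> m * Sw a (\<lambda>a1 a2. \<theta> a1 * \<psi> (S x1) x5 a2)" for x1 m x5
    using Sw_antipode_alpha[of "\<lambda>w. Sw a (\<lambda>a1 a2. \<theta> (w \<cdot> a1) * \<psi> (S x1) x5 a2)" m, OF Sw_dual_inner]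
    by (simp add: unit_left intros)
  have assoc: "Sw z (\<lambda>x1 x2. Sw w (\<lambda>x4 x5. Sw a (\<lambda>a1 a2. \<theta> (S x2 \<cdot> x4 \<cdot> a1) * \<psi> (S x1) x5 a2))) =
      Sw z (\<lambda>x1 x2. Sw w (\<lambda>x4 x5. Sw a (\<lambda>a1 a2. \<psi> (S x2) x4 a1 * \<theta> (S x1 \<cdot> (x5 \<cdot> a2)))))" for z w
  proof -
    have "Sw (S z) (\<lambda>z1 z2. Sw w (\<lambda>x4 x5. Sw a (\<lambda>a1 a2. \<theta> (z1 \<cdot> x4 \<cdot> a1) * \<psi> z2 x5 a2))) =
        Sw z (\<lambda>x1 x2. Sw w (\<lambda>x4 x5. Sw a (\<lambda>a1 a2. \<theta> (S x2 \<cdot> x4 \<cdot> a1) * \<psi> (S x1) x5 a2)))"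
      by (rule Sw_S) (intro intros)+
    moreover have "Sw (S z) (\<lambda>z1 z2. Sw w (\<lambda>x4 x5. Sw a (\<lambda>a1 a2. \<psi> z1 x4 a1 * \<theta> (z2 \<cdot> (x5 \<cdot> a2))))) =
        Sw z (\<lambda>x1 x2. Sw w (\<lambda>x4 x5. Sw a (\<lambda>a1 a2. \<psi> (S x2) x4 a1 * \<theta> (S x1 \<cdot> (x5 \<cdot> a2)))))"
      by (rule Sw_S) (intro intros)+
    ultimately show ?thesis using psi_assoc[OF \<theta>, of "S z" w a] by simp
  qed
  have "Sw a (\<lambda>a1 a2. \<theta> a1 * psi_alpha x a2) =
      Sw x (\<lambda>x1 r. Sw r (\<lambda>m x5. \<alpha> m * Sw a (\<lambda>a1 a2. \<theta> a1 * \<psi> (S x1) x5 a2)))"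
    by (simp add: psi_alpha_def Sw_mult_left Sw_swap2[of a] mult.left_commute)
  also have "\<dots> = Sw x (\<lambda>x1 r. Sw r (\<lambda>m x5. Sw m (\<lambda>x2 s. Sw s (\<lambda>x3 x4.
      \<alpha> x3 * Sw a (\<lambda>a1 a2. \<theta> (S x2 \<cdot> x4 \<cdot> a1) * \<psi> (S x1) x5 a2)))))"
    by (simp only: \<alpha>_collapse)
  also have "\<dots> = Sw x (\<lambda>z t. Sw t (\<lambda>x3 w. Sw z (\<lambda>x1 x2. Sw w (\<lambda>x4 x5.
      \<alpha> x3 * Sw a (\<lambda>a1 a2. \<theta> (S x2 \<cdot> x4 \<cdot> a1) * \<psi> (S x1) x5 a2)))))"
    by (rule Sw_unnest5[symmetric]) (intro intros)+
  also have "\<dots> = Sw x (\<lambda>z t. Sw t (\<lambda>x3 w. Sw z (\<lambda>x1 x2. Sw w (\<lambda>x4 x5.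
      \<alpha> x3 * Sw a (\<lambda>a1 a2. \<psi> (S x2) x4 a1 * \<theta> (S x1 \<cdot> (x5 \<cdot> a2)))))))"
    by (simp only: Sw_mult_left[symmetric] assoc)
  also have "\<dots> = Sw x (\<lambda>x1 r. Sw r (\<lambda>m x5. Sw m (\<lambda>x2 s. Sw s (\<lambda>x3 x4.
      \<alpha> x3 * Sw a (\<lambda>a1 a2. \<psi> (S x2) x4 a1 * \<theta> (S x1 \<cdot> (x5 \<cdot> a2)))))))"
    by (rule Sw_unnest5) (intro intros)+
  also have "\<dots> = Sw x (\<lambda>x1 t. Sw t (\<lambda>x2 x3. Sw a (\<lambda>a1 a2. psi_alpha x2 a1 * \<theta> (S x1 \<cdot> (x3 \<cdot> a2)))))"
    by (simp add: psi_alpha_def Sw_mult_left Sw_mult_right Sw_swap2[of a] mult.assoc)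
  finally show ?thesis .
qed

text \<open>The mirror image of \<open>psi_alpha_assoc\<close>: the unit is opened to the right of
  \<open>y1\<close>, and \<phi> instead of \<psi> moves the bracket towards
  \<open>y\<close>.\<close>

lemma phi_alpha_assoc:
  assumes \<theta>: "\<theta> \<in> dual_space"
  shows "Sw y (\<lambda>y1 y2. \<theta> y1 * phi_alpha y2 a) =
    Sw a (\<lambda>a1 t. Sw t (\<lambda>a2 a3. Sw y (\<lambda>y1 y2. phi_alpha y1 a2 * \<theta> (y2 \<cdot> S a1 \<cdot> a3))))"
proof -
  note intros = hopf_intros dual_comp[OF \<theta>]
  have \<alpha>_collapse: "Sw m (\<lambda>x2 s. Sw s (\<lambda>x3 x4. \<alpha> x3 * Sw y (\<lambda>y1 y2. \<theta> (y1 \<cdot> (S x2 \<cdot> x4)) * \<phi> y2 (S x1) x5)))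
      = \<alpha> m * Sw y (\<lambda>y1 y2. \<theta> y1 * \<phi> y2 (S x1) x5)" for x1 m x5
    using Sw_antipode_alpha[of "\<lambda>w. Sw y (\<lambda>y1 y2. \<theta> (y1 \<cdot> w) * \<phi> y2 (S x1) x5)" m, OF Sw_dual_inner]
    by (simp add: unit_right intros)
  have assoc: "Sw z (\<lambda>x1 x2. Sw w (\<lambda>x4 x5. Sw y (\<lambda>y1 y2. \<theta> (y1 \<cdot> (S x2 \<cdot> x4)) * \<phi> y2 (S x1) x5))) =
      Sw z (\<lambda>x1 x2. Sw w (\<lambda>x4 x5. Sw y (\<lambda>y1 y2. \<phi> y1 (S x2) x4 * \<theta> (y2 \<cdot> S x1 \<cdot> x5))))" for z w
  proof -
    have "Sw (S z) (\<lambda>z1 z2. Sw w (\<lambda>x4 x5. Sw y (\<lambda>y1 y2. \<theta> (y1 \<cdot> (z1 \<cdot> x4)) * \<phi> y2 z2 x5))) =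
        Sw z (\<lambda>x1 x2. Sw w (\<lambda>x4 x5. Sw y (\<lambda>y1 y2. \<theta> (y1 \<cdot> (S x2 \<cdot> x4)) * \<phi> y2 (S x1) x5)))"
      by (rule Sw_S) (intro intros)+
    moreover have "Sw (S z) (\<lambda>z1 z2. Sw w (\<lambda>x4 x5. Sw y (\<lambda>y1 y2. \<phi> y1 z1 x4 * \<theta> (y2 \<cdot> z2 \<cdot> x5)))) =
        Sw z (\<lambda>x1 x2. Sw w (\<lambda>x4 x5. Sw y (\<lambda>y1 y2. \<phi> y1 (S x2) x4 * \<theta> (y2 \<cdot> S x1 \<cdot> x5))))"
      by (rule Sw_S) (intro intros)+
    ultimately show ?thesis using phi_assoc[OF \<theta>, of y "S z" w] by (simp add: Sw_swap_in[of y])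
  qed
  have "Sw y (\<lambda>y1 y2. \<theta> y1 * phi_alpha y2 a) =
      Sw a (\<lambda>x1 r. Sw r (\<lambda>m x5. \<alpha> m * Sw y (\<lambda>y1 y2. \<theta> y1 * \<phi> y2 (S x1) x5)))"
    by (simp add: phi_alpha_def Sw_mult_left Sw_swap2[of y] mult.left_commute)
  also have "\<dots> = Sw a (\<lambda>x1 r. Sw r (\<lambda>m x5. Sw m (\<lambda>x2 s. Sw s (\<lambda>x3 x4.
      \<alpha> x3 * Sw y (\<lambda>y1 y2. \<theta> (y1 \<cdot> (S x2 \<cdot> x4)) * \<phi> y2 (S x1) x5)))))"
    by (simp only: \<alpha>_collapse)
  also have "\<dots> = Sw a (\<lambda>z t. Sw t (\<lambda>x3 w. Sw z (\<lambda>x1 x2. Sw w (\<lambda>x4 x5.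
      \<alpha> x3 * Sw y (\<lambda>y1 y2. \<theta> (y1 \<cdot> (S x2 \<cdot> x4)) * \<phi> y2 (S x1) x5)))))"
    by (rule Sw_unnest5[symmetric]) (intro intros)+
  also have "\<dots> = Sw a (\<lambda>z t. Sw t (\<lambda>x3 w. Sw z (\<lambda>x1 x2. Sw w (\<lambda>x4 x5.
      \<alpha> x3 * Sw y (\<lambda>y1 y2. \<phi> y1 (S x2) x4 * \<theta> (y2 \<cdot> S x1 \<cdot> x5))))))"
    by (simp only: Sw_mult_left[symmetric] assoc)
  also have "\<dots> = Sw a (\<lambda>x1 r. Sw r (\<lambda>m x5. Sw m (\<lambda>x2 s. Sw s (\<lambda>x3 x4.
      \<alpha> x3 * Sw y (\<lambda>y1 y2. \<phi> y1 (S x2) x4 * \<theta> (y2 \<cdot> S x1 \<cdot> x5))))))"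
    by (rule Sw_unnest5) (intro intros)+
  also have "\<dots> = Sw a (\<lambda>a1 t. Sw t (\<lambda>a2 a3. Sw y (\<lambda>y1 y2. phi_alpha y1 a2 * \<theta> (y2 \<cdot> S a1 \<cdot> a3))))"
    by (simp add: phi_alpha_def Sw_mult_left Sw_mult_right Sw_swap2[of y] mult.assoc)
  finally show ?thesis .
qed

text \<open>In a Hopf algebra \<open>bra t x a\<close> is \<open>t(x a)\<close>, and lemma \<open>bra_coaction\<close> reads
  \<open>a1 t(x a2) = S(x1) (x2 a)1 t((x2 a)2)\<close>.\<close>

definition bra :: "('a \<Rightarrow> 'k) \<Rightarrow> 'a \<Rightarrow> 'a \<Rightarrow> 'k"
  where "bra t x a = Sw x (\<lambda>x1 x2. Sw a (\<lambda>a1 a2. psi_alpha x1 a1 * t (x2 \<cdot> a2)))"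

lemma bra_dual:
  assumes "t \<in> dual_space" "Vector_Spaces.linear scale scale g"
  shows "(\<lambda>a. bra t x (g a)) \<in> dual_space"
  unfolding bra_def by (intro forms_intros dual_comp[OF assms(1)] assms(2))+

text \<open>At 1 the reassociator drops out and the correction reduces to \<alpha>. This governs
  both values at 1 that matter: for an integral \<alpha> is absorbed by invariance, and in the trace
  it is cancelled by \<open>pivot\<close>.\<close>

lemma bra_unit:
  assumes t: "t \<in> dual_space"
  shows "bra t x \<one> = conv \<alpha> t x"
proof -
  have "Sw \<one> (\<lambda>a1 a2. psi_alpha x1 a1 * t (x2 \<cdot> a2)) = \<alpha> x1 * t x2" for x1 x2
    by (subst Sw_unit) ((intro forms_intros dual_comp[OF t])+, simp add: psi_alpha_unit unit_right)
  then show ?thesis by (simp add: bra_def conv_Sw)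
qed

lemma bra_coaction:
  assumes t: "t \<in> dual_space" and \<theta>: "\<theta> \<in> dual_space"
  shows "Sw a (\<lambda>a1 a2. \<theta> a1 * bra t x a2) =
    Sw x (\<lambda>x1 s. Sw s (\<lambda>x2 x3. Sw a (\<lambda>a1 b. psi_alpha x2 a1 * Sw (x3 \<cdot> b) (\<lambda>u v. \<theta> (S x1 \<cdot> u) * t v))))"
proof -
  note intros = forms_intros dual_comp[OF \<theta>] dual_comp[OF t]
  have "Sw a (\<lambda>a1 a2. \<theta> a1 * bra t x a2) =
      Sw a (\<lambda>a1 s. Sw x (\<lambda>x1 x4. Sw s (\<lambda>a2 a3. \<theta> a1 * (psi_alpha x1 a2 * t (x4 \<cdot> a3)))))"
    by (simp add: bra_def Sw_mult_left)
  also have "\<dots> = Sw x (\<lambda>x1 x4. Sw a (\<lambda>a1 s. Sw s (\<lambda>a2 a3. \<theta> a1 * (psi_alpha x1 a2 * t (x4 \<cdot> a3)))))"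
    by (rule Sw_swap)
  also have "\<dots> = Sw x (\<lambda>x1 x4. Sw a (\<lambda>s a3. Sw s (\<lambda>a1 a2. \<theta> a1 * (psi_alpha x1 a2 * t (x4 \<cdot> a3)))))"
    by (rule Sw_cong, rule Sw_coassoc[symmetric]) (intro intros)+
  \<comment> \<open>\<open>psi_alpha_assoc\<close> is applied to the first legs \<open>y\<close> and
    \<open>s\<close> only; \<open>x4\<close> and \<open>a3\<close> wait until they can be recombined
    into a leg of a product.\<close>
  also have "\<dots> = Sw x (\<lambda>y x4. Sw a (\<lambda>s a3. Sw y (\<lambda>x1 r. Sw r (\<lambda>x2 x3. Sw s (\<lambda>a1 a2.
      psi_alpha x2 a1 * \<theta> (S x1 \<cdot> (x3 \<cdot> a2))))) * t (x4 \<cdot> a3)))"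
    by (simp add: psi_alpha_assoc[OF \<theta>, symmetric] Sw_mult_right mult.assoc)
  also have "\<dots> = Sw x (\<lambda>y x4. Sw y (\<lambda>x1 r. Sw r (\<lambda>x2 x3. Sw a (\<lambda>s a3. Sw s (\<lambda>a1 a2.
      psi_alpha x2 a1 * (\<theta> (S x1 \<cdot> (x3 \<cdot> a2)) * t (x4 \<cdot> a3)))))))"
    by (simp add: Sw_mult_right mult.assoc Sw_swap2[of a])
  also have "\<dots> = Sw x (\<lambda>x1 r. Sw r (\<lambda>x2 w. Sw w (\<lambda>x3 x4. Sw a (\<lambda>s a3. Sw s (\<lambda>a1 a2.
      psi_alpha x2 a1 * (\<theta> (S x1 \<cdot> (x3 \<cdot> a2)) * t (x4 \<cdot> a3)))))))"
    by (rule Sw_unnest4) (intro intros)+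
  also have "\<dots> = Sw x (\<lambda>x1 r. Sw r (\<lambda>x2 w. Sw w (\<lambda>x3 x4. Sw a (\<lambda>a1 b. Sw b (\<lambda>a2 a3.
      psi_alpha x2 a1 * (\<theta> (S x1 \<cdot> (x3 \<cdot> a2)) * t (x4 \<cdot> a3)))))))"
    by (rule Sw_cong, rule Sw_cong, rule Sw_cong, rule Sw_coassoc) (intro intros)+
  also have "\<dots> = Sw x (\<lambda>x1 r. Sw r (\<lambda>x2 w. Sw a (\<lambda>a1 b. psi_alpha x2 a1 * Sw w (\<lambda>x3 x4. Sw b (\<lambda>a2 a3.
      \<theta> (S x1 \<cdot> (x3 \<cdot> a2)) * t (x4 \<cdot> a3))))))"
    by (rule Sw_cong, rule Sw_cong, subst Sw_swap) (simp add: Sw_mult_left)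
  also have "\<dots> = Sw x (\<lambda>x1 r. Sw r (\<lambda>x2 w. Sw a (\<lambda>a1 b. psi_alpha x2 a1 * Sw (w \<cdot> b) (\<lambda>u v. \<theta> (S x1 \<cdot> u) * t v))))"
  proof -
    have "Sw (w \<cdot> b) (\<lambda>u v. \<theta> (S x1 \<cdot> u) * t v) =
        Sw w (\<lambda>x3 x4. Sw b (\<lambda>a2 a3. \<theta> (S x1 \<cdot> (x3 \<cdot> a2)) * t (x4 \<cdot> a3)))" for w b x1
      by (rule Sw_mult) (intro intros)+
    then show ?thesis by simp
  qed
  finally show ?thesis .
qed

lemma integral_Sw:
  assumes T: "left_integral T" and \<theta>: "\<theta> \<in> dual_space"
  shows "Sw a (\<lambda>u v. \<theta> u * T v) = \<theta> \<one> * T a"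
  using assms by (simp add: left_integral_def fun_eq_iff flip: conv_Sw)

text \<open>Invariance of \<open>T\<close> absorbs the leg \<open>u\<close> in
  \<open>bra_coaction\<close> and leaves S(x1) alone. The vectors then come from a fixed finite sum
  for x, whatever a is: this is the source of finite rank.\<close>

lemma integral_bra_coaction:
  assumes T: "left_integral T" and \<theta>: "\<theta> \<in> dual_space"
  shows "Sw a (\<lambda>a1 a2. \<theta> a1 * bra T x a2) = Sw x (\<lambda>x1 x2. \<theta> (S x1) * bra T x2 a)"
proof -
  have t: "T \<in> dual_space" using T by (simp add: left_integral_def)
  note intros = forms_intros dual_comp[OF \<theta>] dual_comp[OF t]
  have collapse: "Sw b (\<lambda>u v. \<theta> (S x1 \<cdot> u) * T v) = \<theta> (S x1) * T b" for x1 b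
    using integral_Sw[OF T, of "\<lambda>u. \<theta> (S x1 \<cdot> u)" b] by (simp add: unit_right intros)
  show ?thesis
    unfolding bra_coaction[OF t \<theta>] collapse
    by (simp add: bra_def Sw_mult_left mult.left_commute)
qed

subsection \<open>From integrals to coseparability\<close>

text \<open>In a Hopf algebra \<open>cosep0 T y a\<close> is \<open>T(y S(a))\<close>.\<close>

definition cosep0 :: "('a \<Rightarrow> 'k) \<Rightarrow> 'a \<Rightarrow> 'a \<Rightarrow> 'k"
  where "cosep0 T y a = Sw y (\<lambda>y1 y2. Sw a (\<lambda>a1 a2. phi_alpha y1 a2 * T (y2 \<cdot> S a1)))"

lemma
  assumes "T \<in> dual_space" "Vector_Spaces.linear scale scale g"
  shows cosep0_dual1: "(\<lambda>y. cosep0 T (g y) a) \<in> dual_space"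
    and cosep0_dual2: "(\<lambda>a. cosep0 T y (g a)) \<in> dual_space"
  unfolding cosep0_def by (intro forms_intros dual_comp[OF assms(1)] assms(2))+

text \<open>In a Hopf algebra y1 T(y2 S(a)) = y1 S(a2) a3 T(y2 S(a1)) = T(y S(a1)) a2, the last step
  by invariance at y S(a1). Here \<open>phi_alpha_assoc\<close> inserts the pair with the bracket
  (y2 S(u)) w, the one in which invariance applies.\<close>

lemma cosep0_coaction:
  assumes T: "left_integral T" and \<theta>: "\<theta> \<in> dual_space"
  shows "Sw y (\<lambda>y1 y2. \<theta> y1 * cosep0 T y2 a) = Sw a (\<lambda>a1 a2. cosep0 T y a1 * \<theta> a2)"
proof -
  have t: "T \<in> dual_space" using T by (simp add: left_integral_def)
  note intros = forms_intros dual_comp[OF \<theta>] dual_comp[OF t]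
  have collapse: "Sw r (\<lambda>y2 y3. Sw m (\<lambda>a1 u. \<theta> (y2 \<cdot> S u \<cdot> w) * T (y3 \<cdot> S a1))) = \<theta> w * T (r \<cdot> S m)" for r m w
  proof -
    have "Sw (r \<cdot> S m) (\<lambda>b c. \<theta> (b \<cdot> w) * T c) =
        Sw r (\<lambda>y2 y3. Sw (S m) (\<lambda>m1 m2. \<theta> (y2 \<cdot> m1 \<cdot> w) * T (y3 \<cdot> m2)))"
      by (rule Sw_mult) (intro intros)+
    also have "\<dots> = Sw r (\<lambda>y2 y3. Sw m (\<lambda>a1 u. \<theta> (y2 \<cdot> S u \<cdot> w) * T (y3 \<cdot> S a1)))"
      by (rule Sw_cong, rule Sw_S) (intro intros)+
    finally show ?thesis
      using integral_Sw[OF T, of "\<lambda>b. \<theta> (b \<cdot> w)" "r \<cdot> S m"] by (simp add: unit_left intros)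
  qed
  have "Sw y (\<lambda>y1 y2. \<theta> y1 * cosep0 T y2 a) =
      Sw y (\<lambda>y1 s. Sw s (\<lambda>y2 y3. Sw a (\<lambda>a1 a2. \<theta> y1 * (phi_alpha y2 a2 * T (y3 \<cdot> S a1)))))"
    by (simp add: cosep0_def Sw_mult_left)
  also have "\<dots> = Sw y (\<lambda>s y3. Sw s (\<lambda>y1 y2. Sw a (\<lambda>a1 a2. \<theta> y1 * (phi_alpha y2 a2 * T (y3 \<cdot> S a1)))))"
    by (rule Sw_coassoc[symmetric]) (intro intros)+
  also have "\<dots> = Sw y (\<lambda>s y3. Sw a (\<lambda>a1 a2. Sw s (\<lambda>y1 y2. \<theta> y1 * (phi_alpha y2 a2 * T (y3 \<cdot> S a1)))))"
    by (rule Sw_cong, rule Sw_swap)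
  also have "\<dots> = Sw y (\<lambda>s y3. Sw a (\<lambda>a1 a2. Sw a2 (\<lambda>u t. Sw t (\<lambda>v w. Sw s (\<lambda>y1 y2.
      phi_alpha y1 v * \<theta> (y2 \<cdot> S u \<cdot> w)))) * T (y3 \<cdot> S a1)))"
    by (simp add: phi_alpha_assoc[OF \<theta>, symmetric] Sw_mult_right mult.assoc)
  also have "\<dots> = Sw y (\<lambda>s y3. Sw a (\<lambda>a1 a2. Sw a2 (\<lambda>u t. Sw t (\<lambda>v w. Sw s (\<lambda>y1 y2.
      phi_alpha y1 v * (\<theta> (y2 \<cdot> S u \<cdot> w) * T (y3 \<cdot> S a1)))))))"
    by (simp add: Sw_mult_right mult.assoc)
  also have "\<dots> = Sw y (\<lambda>s y3. Sw a (\<lambda>m t. Sw m (\<lambda>a1 u. Sw t (\<lambda>v w. Sw s (\<lambda>y1 y2.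
      phi_alpha y1 v * (\<theta> (y2 \<cdot> S u \<cdot> w) * T (y3 \<cdot> S a1)))))))"
    by (rule Sw_cong, rule Sw_coassoc[symmetric]) (intro intros)+
  also have "\<dots> = Sw a (\<lambda>m t. Sw y (\<lambda>s y3. Sw m (\<lambda>a1 u. Sw t (\<lambda>v w. Sw s (\<lambda>y1 y2.
      phi_alpha y1 v * (\<theta> (y2 \<cdot> S u \<cdot> w) * T (y3 \<cdot> S a1)))))))"
    by (rule Sw_swap)
  also have "\<dots> = Sw a (\<lambda>m t. Sw y (\<lambda>s y3. Sw s (\<lambda>y1 y2. Sw m (\<lambda>a1 u. Sw t (\<lambda>v w.
      phi_alpha y1 v * (\<theta> (y2 \<cdot> S u \<cdot> w) * T (y3 \<cdot> S a1)))))))"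
    by (rule Sw_cong, rule Sw_cong, rule Sw_swap_in[symmetric])
  also have "\<dots> = Sw a (\<lambda>m t. Sw y (\<lambda>y1 r. Sw r (\<lambda>y2 y3. Sw m (\<lambda>a1 u. Sw t (\<lambda>v w.
      phi_alpha y1 v * (\<theta> (y2 \<cdot> S u \<cdot> w) * T (y3 \<cdot> S a1)))))))"
    by (rule Sw_cong, rule Sw_coassoc) (intro intros)+
  also have "\<dots> = Sw a (\<lambda>m t. Sw y (\<lambda>y1 r. Sw t (\<lambda>v w. Sw r (\<lambda>y2 y3. Sw m (\<lambda>a1 u.
      phi_alpha y1 v * (\<theta> (y2 \<cdot> S u \<cdot> w) * T (y3 \<cdot> S a1)))))))"
    by (rule Sw_cong, rule Sw_cong, rule Sw_swap_in[symmetric])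
  also have "\<dots> = Sw a (\<lambda>m t. Sw y (\<lambda>y1 r. Sw t (\<lambda>v w. phi_alpha y1 v * T (r \<cdot> S m) * \<theta> w)))"
    by (simp only: collapse Sw_mult_left[symmetric]) (simp only: ac_simps)
  also have "\<dots> = Sw a (\<lambda>m t. Sw t (\<lambda>v w. Sw y (\<lambda>y1 r. phi_alpha y1 v * T (r \<cdot> S m) * \<theta> w)))"
    by (rule Sw_cong, rule Sw_swap)
  also have "\<dots> = Sw a (\<lambda>s w. Sw s (\<lambda>m v. Sw y (\<lambda>y1 r. phi_alpha y1 v * T (r \<cdot> S m) * \<theta> w)))"
    by (rule Sw_coassoc[symmetric]) (intro intros)+
  also have "\<dots> = Sw a (\<lambda>s w. Sw y (\<lambda>y1 r. Sw s (\<lambda>m v. phi_alpha y1 v * T (r \<cdot> S m) * \<theta> w)))"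
    by (rule Sw_cong, rule Sw_swap)
  also have "\<dots> = Sw a (\<lambda>a1 a2. cosep0 T y a1 * \<theta> a2)"
    by (simp add: cosep0_def Sw_mult_right)
  finally show ?thesis .
qed

text \<open>The twist by \<beta> acts on the right leg of y and leaves colinearity on the left
  intact. It serves the normalization: y2 \<beta>(y3) S(b1) collapses under \<open>T\<close> to
  \<beta>, since T(1) = 1, and what remains is the axiom \<open>phi_antipode\<close>.\<close>

lemma integral_imp_coseparable:
  assumes T: "left_integral T" and T1: "T \<one> = 1"
  shows "coseparability_form (\<lambda>y a. cosep0 T (hitR \<beta> y) a)"
proof -
  have t: "T \<in> dual_space" using T by (simp add: left_integral_def)
  note intros = forms_intros dual_comp[OF t]
  note dual = cosep0_dual1[OF t] cosep0_dual2[OF t linear_id_fun]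
  have "Sw y (\<lambda>u v. \<theta> u * cosep0 T (hitR \<beta> v) a) = Sw a (\<lambda>u v. cosep0 T (hitR \<beta> y) u * \<theta> v)"
    if \<theta>: "\<theta> \<in> dual_space" for \<theta> y a
  proof -
    have "cosep0 T (hitR \<beta> v) a = Sw v (\<lambda>x z. cosep0 T x a * \<beta> z)" for v
      by (rule dual_hitR) (rule dual(1)[OF linear_id_fun])
    then have "Sw y (\<lambda>u v. \<theta> u * cosep0 T (hitR \<beta> v) a) =
        Sw y (\<lambda>u t. Sw t (\<lambda>v z. \<theta> u * cosep0 T v a * \<beta> z))"
      by (simp add: Sw_mult_left mult.assoc)
    also have "\<dots> = Sw y (\<lambda>t z. Sw t (\<lambda>u v. \<theta> u * cosep0 T v a * \<beta> z))"
      by (rule Sw_coassoc[symmetric]) (intro intros dual dual_comp[OF \<theta>])+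
    also have "\<dots> = Sw y (\<lambda>t z. Sw t (\<lambda>u v. \<theta> u * cosep0 T v a) * \<beta> z)"
      by (simp add: Sw_mult_right)
    also have "\<dots> = Sw (hitR \<beta> y) (\<lambda>u v. \<theta> u * cosep0 T v a)"
      by (rule Sw_hitR[symmetric]) (intro intros dual dual_comp[OF \<theta>])+
    also have "\<dots> = Sw a (\<lambda>u v. cosep0 T (hitR \<beta> y) u * \<theta> v)"
      by (rule cosep0_coaction[OF T \<theta>])
    finally show ?thesis .
  qed
  moreover have "Sw a (\<lambda>y b. cosep0 T (hitR \<beta> y) b) = \<epsilon> a" for a
  proof -
    have \<beta>_collapse: "Sw m (\<lambda>y2 s. Sw s (\<lambda>y3 b1. \<beta> y3 * T (y2 \<cdot> S b1))) = \<beta> m" for m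
      using Sw_antipode_beta[OF t, of m] T1 by simp
    have "cosep0 T (hitR \<beta> y) b = Sw y (\<lambda>r y3. Sw r (\<lambda>y1 y2. Sw b (\<lambda>b1 b2. \<beta> y3 * (phi_alpha y1 b2 * T (y2 \<cdot> S b1)))))" for y b
      unfolding cosep0_def
      by (subst Sw_hitR) ((intro intros)+, simp only: Sw_mult_right, simp only: ac_simps)
    then have "Sw a (\<lambda>y b. cosep0 T (hitR \<beta> y) b) =
        Sw a (\<lambda>y b. Sw y (\<lambda>r y3. Sw r (\<lambda>y1 y2. Sw b (\<lambda>b1 b2. \<beta> y3 * (phi_alpha y1 b2 * T (y2 \<cdot> S b1))))))"
      by simp
    also have "\<dots> = Sw a (\<lambda>y b. Sw y (\<lambda>y1 r. Sw r (\<lambda>y2 y3. Sw b (\<lambda>b1 b2. \<beta> y3 * (phi_alpha y1 b2 * T (y2 \<cdot> S b1))))))"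
      by (rule Sw_cong, rule Sw_coassoc) (intro intros)+
    also have "\<dots> = Sw a (\<lambda>y1 s. Sw s (\<lambda>y2 w. Sw w (\<lambda>y3 b. Sw b (\<lambda>b1 b2. \<beta> y3 * (phi_alpha y1 b2 * T (y2 \<cdot> S b1))))))"
      by (rule Sw_unnest4) (intro intros)+
    also have "\<dots> = Sw a (\<lambda>y1 s. Sw s (\<lambda>y2 w. Sw w (\<lambda>r b2. Sw r (\<lambda>y3 b1. \<beta> y3 * (phi_alpha y1 b2 * T (y2 \<cdot> S b1))))))"
      by (rule Sw_cong, rule Sw_cong, rule Sw_coassoc[symmetric]) (intro intros)+
    also have "\<dots> = Sw a (\<lambda>y1 s. Sw s (\<lambda>m b2. Sw m (\<lambda>y2 r. Sw r (\<lambda>y3 b1. \<beta> y3 * (phi_alpha y1 b2 * T (y2 \<cdot> S b1))))))"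
      by (rule Sw_cong, rule Sw_coassoc[symmetric]) (intro intros)+
    also have "\<dots> = Sw a (\<lambda>y1 s. Sw s (\<lambda>m b2. phi_alpha y1 b2 * Sw m (\<lambda>y2 r. Sw r (\<lambda>y3 b1. \<beta> y3 * T (y2 \<cdot> S b1)))))"
      by (simp add: Sw_mult_left mult.left_commute)
    also have "\<dots> = Sw a (\<lambda>y1 s. Sw s (\<lambda>m b2. Sw b2 (\<lambda>b3 t. Sw t (\<lambda>b4 b5. \<beta> m * (\<alpha> b4 * \<phi> y1 (S b3) b5)))))"
      by (simp only: \<beta>_collapse phi_alpha_def Sw_mult_right) (simp only: ac_simps)
    also have "\<dots> = \<epsilon> a"
    proof -
      have "\<phi> (\<beta> m *s y1) (S b3) (\<alpha> b4 *s b5) = \<beta> m * (\<alpha> b4 * \<phi> y1 (S b3) b5)" for m y1 b3 b4 b5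
        using phi_trilinear by (simp add: trilinear_form_def dual_space_iff)
      then show ?thesis using phi_antipode[of a] unfolding sum_list_sw5 by simp
    qed
    finally show ?thesis .
  qed
  ultimately show ?thesis
    unfolding coseparability_form_def
    using dual(1)[OF linear_hitR[OF beta_dual]] dual(2) by simp
qed

section \<open>The pivot of an involutory dual quasi-Hopf algebra\<close>

text \<open>The involutory condition groups into S^2(a) = u(a1) a2 v(a3) with u =
  \<open>beta_alpha\<close> and v = \<open>beta_alpha_S\<close>. In a Hopf algebra with \<alpha> =
  \<beta> = \<epsilon>, both are \<epsilon>.\<close>

definition beta_alpha :: "'a \<Rightarrow> 'k" where "beta_alpha = conv (\<lambda>a. \<beta> (S a)) \<alpha>"
definition beta_alpha_S :: "'a \<Rightarrow> 'k" where "beta_alpha_S = conv \<beta> (\<lambda>a. \<alpha> (S a))"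
definition pivot :: "'a \<Rightarrow> 'k" where "pivot = conv beta_alpha_S (\<lambda>a. \<beta> (S a))"

lemma beta_S_dual: "(\<lambda>a. \<beta> (S a)) \<in> dual_space" and alpha_S_dual: "(\<lambda>a. \<alpha> (S a)) \<in> dual_space"
  by (intro hopf_intros)+

lemma beta_alpha_dual: "beta_alpha \<in> dual_space"
  and beta_alpha_S_dual: "beta_alpha_S \<in> dual_space"
  and pivot_dual: "pivot \<in> dual_space"
  unfolding beta_alpha_def beta_alpha_S_def pivot_def
  by (intro conv_dual alpha_dual beta_dual beta_S_dual alpha_S_dual)+

lemmas pivot_intros = forms_intros dual_comp[OF beta_alpha_dual] dual_comp[OF beta_alpha_S_dual] dual_comp[OF pivot_dual]

lemma involutory_Sw:
  assumes inv: involutory and \<theta>: "\<theta> \<in> dual_space"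
  shows "\<theta> (S (S a)) = Sw a (\<lambda>x r. beta_alpha x * Sw r (\<lambda>y z. \<theta> y * beta_alpha_S z))"
proof -
  note intros = pivot_intros dual_comp[OF \<theta>]
  have "\<theta> (S (S a)) = (\<Sum>(a1, a2, a3, a4, a5)\<leftarrow>sw5 a. \<beta> (S a1) * \<alpha> a2 * \<beta> a4 * \<alpha> (S a5) * \<theta> a3)"
    using inv by (simp add: involutory_def dual_sum_list[OF \<theta>] dual_scale[OF \<theta>] case_prod_unfold)
  also have "\<dots> = Sw a (\<lambda>a1 t. Sw t (\<lambda>a2 s. Sw s (\<lambda>a3 r. Sw r (\<lambda>a4 a5.
      \<beta> (S a1) * \<alpha> a2 * \<beta> a4 * \<alpha> (S a5) * \<theta> a3))))"
    by (rule sum_list_sw5)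
  also have "\<dots> = Sw a (\<lambda>a1 t. Sw t (\<lambda>a2 s. \<beta> (S a1) * \<alpha> a2 * Sw s (\<lambda>a3 r. \<theta> a3 * beta_alpha_S r)))"
    by (simp add: beta_alpha_S_def conv_Sw Sw_mult_left ac_simps)
  also have "\<dots> = Sw a (\<lambda>t s. Sw t (\<lambda>a1 a2. \<beta> (S a1) * \<alpha> a2 * Sw s (\<lambda>a3 r. \<theta> a3 * beta_alpha_S r)))"
    by (rule Sw_coassoc[symmetric]) (intro intros)+
  also have "\<dots> = Sw a (\<lambda>x r. beta_alpha x * Sw r (\<lambda>y z. \<theta> y * beta_alpha_S z))"
    by (simp only: beta_alpha_def conv_Sw Sw_mult_right)
  finally show ?thesis .
qed

text \<open>Applying \<epsilon> to the formula for S^2 makes \<open>beta_alpha_S\<close> a right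
  inverse of \<open>beta_alpha\<close>. The opposite order is the one that cancels below, and local
  finiteness provides it.\<close>

lemma beta_alpha_S_conv:
  assumes involutory
  shows "conv beta_alpha_S beta_alpha = \<epsilon>"
proof (rule conv_left_inverse_imp_right_inverse[OF beta_alpha_dual beta_alpha_S_dual])
  show "conv beta_alpha beta_alpha_S = \<epsilon>"
  proof
    fix a
    have "\<epsilon> a = Sw a (\<lambda>x r. beta_alpha x * Sw r (\<lambda>y z. \<epsilon> y * beta_alpha_S z))"
      using involutory_Sw[OF assms counit_dual, of a] by (simp add: antipode_counit)
    then show "conv beta_alpha beta_alpha_S a = \<epsilon> a" by (simp add: conv_Sw Sw_counit_left beta_alpha_S_dual)
  qed
qed

text \<open>Regrouping \<open>pivot\<close> * \<alpha> gives \<open>beta_alpha_S\<close> *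
  \<open>beta_alpha\<close>, which is \<epsilon>; local finiteness then reverses the
  factors.\<close>

lemma alpha_conv_pivot:
  assumes involutory
  shows "conv \<alpha> pivot = \<epsilon>"
proof (rule conv_left_inverse_imp_right_inverse[OF pivot_dual alpha_dual])
  have "conv pivot \<alpha> = conv beta_alpha_S beta_alpha"
    unfolding pivot_def beta_alpha_def by (rule conv_assoc) (rule beta_alpha_S_dual beta_S_dual alpha_dual)+
  then show "conv pivot \<alpha> = \<epsilon>" by (simp add: beta_alpha_S_conv assms)
qed

text \<open>Together with the coevaluation given by \<open>\<alpha>\<close>, the form \<open>pivot\<close> yields a pivotal structure
  whose traces are the ordinary ones, by the previous lemma.\<close>

lemma pivot_evaluation:
  assumes inv: involutory and \<theta>: "\<theta> \<in> dual_space"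
  shows "Sw a (\<lambda>b s. Sw s (\<lambda>y v. pivot y * \<theta> (S v \<cdot> b))) = \<theta> \<one> * pivot a"
proof -
  note intros = pivot_intros dual_comp[OF \<theta>]
  define X where "X a = Sw a (\<lambda>b s. Sw s (\<lambda>y v. pivot y * \<theta> (S v \<cdot> b)))" for a
  have X: "X \<in> dual_space"
    unfolding X_def[abs_def] by (intro intros)+
  \<comment> \<open>The \<beta> axiom at S(a) yields \<beta>(S(a2)) S(a3) S(S(a1)), with the factors
    already in the desired order. Replacing S(S(a1)) by the involutory formula leaves
    \<open>beta_alpha\<close> in front, and the form on the remaining middle legs is
    \<open>pivot\<close>.\<close>
  have "conv beta_alpha X a = \<theta> \<one> * \<beta> (S a)" for a
  proof -
    have "Sw (S a) (\<lambda>u t. Sw t (\<lambda>v x. \<beta> v * \<theta> (u \<cdot> S x))) =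
        Sw a (\<lambda>u v. Sw (S u) (\<lambda>b c. \<beta> b * \<theta> (S v \<cdot> S c)))"
      by (rule Sw_S) (intro intros)+
    also have "\<dots> = Sw a (\<lambda>u v. Sw u (\<lambda>r u2. \<beta> (S u2) * \<theta> (S v \<cdot> S (S r))))"
      by (rule Sw_cong, rule Sw_S) (intro intros)+
    also have "\<dots> = Sw a (\<lambda>u v. Sw u (\<lambda>r u2. \<beta> (S u2) * Sw r (\<lambda>x t. beta_alpha x * Sw t (\<lambda>y z. \<theta> (S v \<cdot> y) * beta_alpha_S z))))"
    proof -
      have "\<theta> (S v \<cdot> S (S r)) = Sw r (\<lambda>x t. beta_alpha x * Sw t (\<lambda>y z. \<theta> (S v \<cdot> y) * beta_alpha_S z))" for v r
        by (rule involutory_Sw[OF inv]) (intro intros)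
      then show ?thesis by simp
    qed
    also have "\<dots> = Sw a (\<lambda>u v. Sw u (\<lambda>r u2. Sw r (\<lambda>x t. Sw t (\<lambda>y z. beta_alpha x * (\<theta> (S v \<cdot> y) * (beta_alpha_S z * \<beta> (S u2)))))))"
      by (simp only: Sw_mult_left) (simp only: ac_simps)
    also have "\<dots> = Sw a (\<lambda>u v. Sw u (\<lambda>x r. Sw r (\<lambda>y t. Sw t (\<lambda>z u2. beta_alpha x * (\<theta> (S v \<cdot> y) * (beta_alpha_S z * \<beta> (S u2)))))))"
      by (rule Sw_cong, rule Sw_unnest4) (intro intros)+
    also have "\<dots> = Sw a (\<lambda>x s. Sw s (\<lambda>r v. Sw r (\<lambda>y t. Sw t (\<lambda>z u2. beta_alpha x * (\<theta> (S v \<cdot> y) * (beta_alpha_S z * \<beta> (S u2)))))))"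
      by (rule Sw_coassoc) (intro intros)+
    also have "\<dots> = Sw a (\<lambda>x s. Sw s (\<lambda>y r. Sw r (\<lambda>t v. Sw t (\<lambda>z u2. beta_alpha x * (\<theta> (S v \<cdot> y) * (beta_alpha_S z * \<beta> (S u2)))))))"
      by (rule Sw_cong, rule Sw_coassoc) (intro intros)+
    also have "\<dots> = Sw a (\<lambda>x s. beta_alpha x * Sw s (\<lambda>y r. Sw r (\<lambda>t v. \<theta> (S v \<cdot> y) * pivot t)))"
      by (simp only: pivot_def conv_Sw Sw_mult_left)
    also have "\<dots> = conv beta_alpha X a"
      by (simp only: conv_Sw X_def mult.commute[of "pivot _"])
    finally show ?thesis using Sw_antipode_beta[OF \<theta>, of "S a"] by (simp add: mult.commute)
  qed
  \<comment> \<open>Cancelling \<open>beta_alpha\<close> from the left turns \<beta> S into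
    \<open>beta_alpha_S\<close> * (\<beta> S), which is \<open>pivot\<close>.\<close>
  then have "conv beta_alpha_S (conv beta_alpha X) = conv beta_alpha_S (\<lambda>a. \<theta> \<one> * \<beta> (S a))" by presburger
  moreover have "conv beta_alpha_S (conv beta_alpha X) = X"
    using conv_assoc[OF beta_alpha_S_dual beta_alpha_dual X] by (simp add: beta_alpha_S_conv[OF inv] conv_counit_left X)
  ultimately have "X a = conv beta_alpha_S (\<lambda>a. \<theta> \<one> * \<beta> (S a)) a" by simp
  then show ?thesis
    by (simp add: X_def pivot_def conv_Sw Sw_mult_left mult.left_commute)
qed

subsection \<open>The trace of a finite-dimensional injective comodule\<close>

text \<open>For a colinear projection \<open>P = \<Sum> co b \<otimes> b\<close> of finite rank, the functional below is the
  partial trace of \<open>m \<otimes> a \<mapsto> P (m a)\<close> on the range of \<open>P\<close>.\<close>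

lemma trace_integral:
  assumes inv: involutory
    and B: "finite B" and co: "\<And>b. co b \<in> dual_space"
    and P: "\<And>a. P a = (\<Sum>b\<in>B. co b a *s b)" and P_B: "\<And>b. b \<in> B \<Longrightarrow> P b = b"
    and col: "colinear P"
  shows "left_integral (\<lambda>a. \<Sum>b\<in>B. bra (conv pivot (co b)) b a)"
proof -
  have P_col: "Sw (P a) G = Sw a (\<lambda>u v. G u (P v))"
    if "\<And>y. (\<lambda>x. G x y) \<in> dual_space" "\<And>x. G x \<in> dual_space" for a G
    using col that by (simp add: colinear_def)
  define t where "t b = conv pivot (co b)" for b
  have t: "t b \<in> dual_space" for b unfolding t_def by (intro conv_dual pivot_dual co)
  define T where "T a = (\<Sum>b\<in>B. bra (t b) b a)" for a
  note intros = pivot_intros dual_comp[OF co] dual_comp[OF t]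
  \<comment> \<open>Contraction of a dual basis: summing over \<open>B\<close> turns the pair
    \<open>co b\<close>, \<open>b\<close> back into \<open>P\<close>.\<close>
  have sum_co: "(\<Sum>b\<in>B. F b * t b z) = Sw z (\<lambda>u v. pivot u * F (P v))" if F: "F \<in> dual_space" for F z
  proof -
    have "(\<Sum>b\<in>B. F b * t b z) = Sw z (\<lambda>u v. \<Sum>b\<in>B. pivot u * (co b v * F b))"
      unfolding Sw_sum by (simp add: t_def conv_Sw Sw_mult_left ac_simps)
    then show ?thesis by (simp add: P dual_sum[OF F] dual_scale[OF F] sum_distrib_left)
  qed
  \<comment> \<open>Since \<open>P\<close> is colinear and fixes \<open>b\<close>, the right leg of
    \<open>\<Delta> b\<close> may be replaced by its image under \<open>P\<close> and written in the
    basis.\<close>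
  have expand: "Sw b H = (\<Sum>l\<in>B. Sw b (\<lambda>u v. co l v * H u l))"
    if b: "b \<in> B" and H: "\<And>y. (\<lambda>x. H x y) \<in> dual_space" "\<And>x. H x \<in> dual_space" for b H
  proof -
    have "Sw b H = Sw b (\<lambda>u v. H u (P v))" using P_col[of H b, OF H] P_B[OF b] by simp
    then show ?thesis by (simp add: P dual_sum[OF H(2)] dual_scale[OF H(2)] Sw_sum)
  qed
  define \<Psi> where "\<Psi> l a r = Sw r (\<lambda>x y. psi_alpha x a * co l y)" for l a r
  have \<Psi>: "Vector_Spaces.linear scale scale f \<Longrightarrow> (\<lambda>r. \<Psi> l a (f r)) \<in> dual_space" for l a f
    unfolding \<Psi>_def by (intro intros; assumption)
  have \<Psi>': "Vector_Spaces.linear scale scale f \<Longrightarrow> (\<lambda>a. \<Psi> l (f a) r) \<in> dual_space" for l r f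
    unfolding \<Psi>_def by (intro intros; assumption)
  \<comment> \<open>Cyclicity of the trace: expanding \<open>\<Delta> k\<close> introduces a new
    index \<open>l\<close>, after which \<open>sum_co\<close> removes the traced index
    \<open>k\<close>. The result contains \<open>P (l \<cdot> b)\<close>, to which colinearity
    applies.\<close>
  have T_eq: "T a = (\<Sum>l\<in>B. Sw a (\<lambda>a1 b. Sw (P (l \<cdot> b)) (\<lambda>u v. pivot u * \<Psi> l a1 v)))" for a
  proof -
    have "bra (t k) k a = (\<Sum>l\<in>B. Sw a (\<lambda>a1 b. \<Psi> l a1 k * t k (l \<cdot> b)))" if "k \<in> B" for k
    proof -
      have "bra (t k) k a = (\<Sum>l\<in>B. Sw k (\<lambda>u v. co l v * Sw a (\<lambda>a1 b. psi_alpha u a1 * t k (l \<cdot> b))))"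
        unfolding bra_def by (rule expand[OF that]) (intro intros)+
      also have "\<dots> = (\<Sum>l\<in>B. Sw a (\<lambda>a1 b. Sw k (\<lambda>u v. co l v * (psi_alpha u a1 * t k (l \<cdot> b)))))"
        by (simp add: Sw_mult_left Sw_swap[of k])
      also have "\<dots> = (\<Sum>l\<in>B. Sw a (\<lambda>a1 b. \<Psi> l a1 k * t k (l \<cdot> b)))"
        by (simp only: \<Psi>_def Sw_mult_right) (simp only: ac_simps)
      finally show ?thesis .
    qed
    then have "T a = (\<Sum>k\<in>B. \<Sum>l\<in>B. Sw a (\<lambda>a1 b. \<Psi> l a1 k * t k (l \<cdot> b)))"
      by (simp add: T_def)
    also have "\<dots> = (\<Sum>l\<in>B. \<Sum>k\<in>B. Sw a (\<lambda>a1 b. \<Psi> l a1 k * t k (l \<cdot> b)))"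
      by (rule sum.swap)
    also have "\<dots> = (\<Sum>l\<in>B. Sw a (\<lambda>a1 b. Sw (l \<cdot> b) (\<lambda>u v. pivot u * \<Psi> l a1 (P v))))"
      by (simp only: Sw_sum[symmetric] sum_co[OF \<Psi>[OF linear_id_fun]])
    also have "\<dots> = (\<Sum>l\<in>B. Sw a (\<lambda>a1 b. Sw (P (l \<cdot> b)) (\<lambda>u v. pivot u * \<Psi> l a1 v)))"
    proof -
      have "Sw (P z) (\<lambda>u v. pivot u * \<Psi> l a1 v) = Sw z (\<lambda>u v. pivot u * \<Psi> l a1 (P v))" for z l a1
        by (rule P_col) (intro intros \<Psi>)+
      then show ?thesis by simp
    qed
    finally show ?thesis .
  qed
  have "Sw a (\<lambda>a1 a2. \<theta> a1 * T a2) = \<theta> \<one> * T a" if \<theta>: "\<theta> \<in> dual_space" for \<theta> a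
  proof -
    note intros = intros dual_comp[OF \<theta>]
    \<comment> \<open>The counterpart of \<open>\<Psi>\<close> that also carries the factor S(x1)
      produced by \<open>bra_coaction\<close>.\<close>
    define \<Xi> where "\<Xi> l a u k = Sw k (\<lambda>r v. co l v * Sw r (\<lambda>x1 x2. psi_alpha x2 a * \<theta> (S x1 \<cdot> u)))" for l a u k
    have \<Xi>: "\<Xi> l a u \<in> dual_space" for l a u
      unfolding \<Xi>_def[abs_def] by (intro intros)
    have \<Xi>': "Vector_Spaces.linear scale scale f \<Longrightarrow> (\<lambda>u. \<Xi> l a (f u) k) \<in> dual_space" for l a k f
      unfolding \<Xi>_def by (intro intros; assumption)
    \<comment> \<open>Here the trace closes: \<open>u\<close>, the argument of \<open>pivot\<close>
      and S(x1) are three consecutive legs of \<open>m\<close>, in the order that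
      \<open>pivot_evaluation\<close> requires.\<close>
    have collapse: "Sw m (\<lambda>u v. Sw v (\<lambda>v1 v2. pivot v1 * \<Xi> l a u v2)) = \<theta> \<one> * Sw m (\<lambda>u v. pivot u * \<Psi> l a v)" for m l a
    proof -
      let ?K = "\<lambda>u v1 x1 x2 y. pivot v1 * \<theta> (S x1 \<cdot> u) * (psi_alpha x2 a * co l y)"
      have "Sw m (\<lambda>u v. Sw v (\<lambda>v1 v2. pivot v1 * \<Xi> l a u v2)) =
          Sw m (\<lambda>u v. Sw v (\<lambda>v1 v2. Sw v2 (\<lambda>r y. Sw r (\<lambda>x1 x2. ?K u v1 x1 x2 y))))"
        by (simp only: \<Xi>_def Sw_mult_left) (simp only: ac_simps)
      also have "\<dots> = Sw m (\<lambda>u v. Sw v (\<lambda>v1 v2. Sw v2 (\<lambda>x1 s. Sw s (\<lambda>x2 y. ?K u v1 x1 x2 y))))"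
        by (rule Sw_cong, rule Sw_cong, rule Sw_coassoc) (intro intros)+
      also have "\<dots> = Sw m (\<lambda>r s. Sw r (\<lambda>u v. Sw v (\<lambda>v1 x1. Sw s (\<lambda>x2 y. ?K u v1 x1 x2 y))))"
        by (rule Sw_unnest4[symmetric]) (intro intros)+
      also have "\<dots> = Sw m (\<lambda>r s. Sw r (\<lambda>u v. Sw v (\<lambda>v1 x1. pivot v1 * \<theta> (S x1 \<cdot> u))) * \<Psi> l a s)"
        by (simp only: Sw_mult_right) (simp only: \<Psi>_def Sw_mult_left)
      also have "\<dots> = \<theta> \<one> * Sw m (\<lambda>u v. pivot u * \<Psi> l a v)"
        by (simp only: pivot_evaluation[OF inv \<theta>] Sw_mult_left mult.assoc)
      finally show ?thesis .
    qed
    have "Sw a (\<lambda>a1 a2. \<theta> a1 * bra (t k) k a2) =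
        (\<Sum>l\<in>B. Sw a (\<lambda>a1 b. Sw (l \<cdot> b) (\<lambda>u v. \<Xi> l a1 u k * t k v)))" if k: "k \<in> B" for k
    proof -
      have "Sw a (\<lambda>a1 a2. \<theta> a1 * bra (t k) k a2) =
          Sw k (\<lambda>x1 s. Sw s (\<lambda>x2 x3. Sw a (\<lambda>a1 b. psi_alpha x2 a1 * Sw (x3 \<cdot> b) (\<lambda>u v. \<theta> (S x1 \<cdot> u) * t k v))))"
        by (rule bra_coaction[OF t \<theta>])
      also have "\<dots> = Sw k (\<lambda>r x3. Sw r (\<lambda>x1 x2. Sw a (\<lambda>a1 b. psi_alpha x2 a1 * Sw (x3 \<cdot> b) (\<lambda>u v. \<theta> (S x1 \<cdot> u) * t k v))))"
        by (rule Sw_coassoc[symmetric]) (intro intros)+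
      also have "\<dots> = (\<Sum>l\<in>B. Sw k (\<lambda>r y. co l y *
          Sw r (\<lambda>x1 x2. Sw a (\<lambda>a1 b. psi_alpha x2 a1 * Sw (l \<cdot> b) (\<lambda>u v. \<theta> (S x1 \<cdot> u) * t k v)))))"
        by (rule expand[OF k]) (intro intros)+
      also have "\<dots> = (\<Sum>l\<in>B. Sw k (\<lambda>r y. Sw r (\<lambda>x1 x2. Sw a (\<lambda>a1 b. Sw (l \<cdot> b) (\<lambda>u v.
          co l y * (psi_alpha x2 a1 * \<theta> (S x1 \<cdot> u)) * t k v)))))"
        by (simp only: Sw_mult_left mult.assoc)
      also have "\<dots> = (\<Sum>l\<in>B. Sw k (\<lambda>r y. Sw a (\<lambda>a1 b. Sw (l \<cdot> b) (\<lambda>u v. Sw r (\<lambda>x1 x2.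
          co l y * (psi_alpha x2 a1 * \<theta> (S x1 \<cdot> u)) * t k v)))))"
        by (rule sum.cong[OF refl], rule Sw_cong, rule Sw_swap_in)
      also have "\<dots> = (\<Sum>l\<in>B. Sw a (\<lambda>a1 b. Sw (l \<cdot> b) (\<lambda>u v. Sw k (\<lambda>r y. Sw r (\<lambda>x1 x2.
          co l y * (psi_alpha x2 a1 * \<theta> (S x1 \<cdot> u)) * t k v)))))"
        by (rule sum.cong[OF refl], rule Sw_swap_in)
      also have "\<dots> = (\<Sum>l\<in>B. Sw a (\<lambda>a1 b. Sw (l \<cdot> b) (\<lambda>u v. \<Xi> l a1 u k * t k v)))"
        by (simp only: \<Xi>_def Sw_mult_left Sw_mult_right)
      finally show ?thesis .
    qed
    then have "Sw a (\<lambda>a1 a2. \<theta> a1 * T a2) =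
        (\<Sum>k\<in>B. \<Sum>l\<in>B. Sw a (\<lambda>a1 b. Sw (l \<cdot> b) (\<lambda>u v. \<Xi> l a1 u k * t k v)))"
      by (simp add: T_def sum_distrib_left Sw_sum)
    also have "\<dots> = (\<Sum>l\<in>B. \<Sum>k\<in>B. Sw a (\<lambda>a1 b. Sw (l \<cdot> b) (\<lambda>u v. \<Xi> l a1 u k * t k v)))"
      by (rule sum.swap)
    also have "\<dots> = (\<Sum>l\<in>B. Sw a (\<lambda>a1 b. Sw (l \<cdot> b) (\<lambda>u v. Sw v (\<lambda>v1 v2. pivot v1 * \<Xi> l a1 u (P v2)))))"
      by (simp only: Sw_sum[symmetric] sum_co[OF \<Xi>])
    also have "\<dots> = (\<Sum>l\<in>B. Sw a (\<lambda>a1 b. Sw (P (l \<cdot> b)) (\<lambda>u v. Sw v (\<lambda>v1 v2. pivot v1 * \<Xi> l a1 u v2))))"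
    proof -
      have "Sw (P z) (\<lambda>u v. Sw v (\<lambda>v1 v2. pivot v1 * \<Xi> l a1 u v2)) =
          Sw z (\<lambda>u v. Sw (P v) (\<lambda>v1 v2. pivot v1 * \<Xi> l a1 u v2))" for z l a1
        by (rule P_col) (intro intros \<Xi>' dual_comp[OF \<Xi>])+
      moreover have "Sw (P v) (\<lambda>v1 v2. pivot v1 * \<Xi> l a1 u v2) = Sw v (\<lambda>v1 v2. pivot v1 * \<Xi> l a1 u (P v2))" for v l a1 u
        by (rule P_col) (intro intros dual_comp[OF \<Xi>])+
      ultimately show ?thesis by simp
    qed
    also have "\<dots> = \<theta> \<one> * T a"
      by (simp only: collapse T_eq Sw_mult_left sum_distrib_left)
    finally show ?thesis .
  qed
  moreover have "T \<in> dual_space"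
    unfolding T_def[abs_def] by (intro dual_sum_fun bra_dual t linear_id_fun)
  ultimately have "left_integral T"
    by (simp add: left_integral_def fun_eq_iff conv_Sw)
  then show ?thesis by (simp add: T_def[abs_def] t_def)
qed

text \<open>By \<open>bra_unit\<close> the value at 1 carries \<alpha> * \<open>pivot\<close>, which
  is \<epsilon>. What is left is the ordinary trace.\<close>

lemma trace_integral_unit:
  assumes inv: involutory and co: "\<And>b. co b \<in> dual_space"
  shows "(\<Sum>b\<in>B. bra (conv pivot (co b)) b \<one>) = (\<Sum>b\<in>B. co b b)"
proof (rule sum.cong[OF refl])
  fix b
  have "conv \<alpha> (conv pivot (co b)) = co b"
    using conv_assoc[OF alpha_dual pivot_dual co]
    by (simp add: alpha_conv_pivot[OF inv] conv_counit_left co)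
  then show "bra (conv pivot (co b)) b \<one> = co b b"
    by (simp add: bra_unit conv_dual pivot_dual co)
qed

end

section \<open>A normalized integral from an arbitrary nonzero one\<close>

theorem theorem5p4:
  fixes scale :: "'k::field_char_0 \<Rightarrow> 'a::ab_group_add \<Rightarrow> 'a"
    and \<Delta> :: "'a \<Rightarrow> ('a list \<Rightarrow>\<^sub>0 'k) set"
    and \<epsilon> :: "'a \<Rightarrow> 'k"
    and mult :: "'a \<Rightarrow> 'a \<Rightarrow> 'a"
    and unit :: 'a
    and \<phi> \<psi> :: "'a \<Rightarrow> 'a \<Rightarrow> 'a \<Rightarrow> 'k"
    and S :: "'a \<Rightarrow> 'a"
    and \<alpha> \<beta> :: "'a \<Rightarrow> 'k"
  assumes "dual_quasi_hopf_algebra scale \<Delta> \<epsilon> mult unit \<phi> \<psi> S \<alpha> \<beta>"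
    and "dual_quasi_hopf_algebra.involutory scale \<Delta> S \<alpha> \<beta>"
    and "\<exists>T. dual_quasi_bialgebra.left_integral scale \<Delta> unit T \<and> T \<noteq> (\<lambda>a. 0)"
  shows "comultiplication.cosemisimple scale \<Delta>"
proof -
  interpret dual_quasi_hopf_algebra scale \<Delta> \<epsilon> mult unit \<phi> \<psi> S \<alpha> \<beta> by (rule assms(1))
  have inv: involutory by (rule assms(2))
  obtain T where T: "left_integral T" "T \<noteq> (\<lambda>a. 0)" using assms(3) by blast
  have t: "T \<in> dual_space" using T(1) by (simp add: left_integral_def)
  obtain x0 where "T x0 \<noteq> 0" using T(2) by blast
  \<comment> \<open>Scaled so that f(1) = \<alpha>(1) T(x) = 1, by \<open>bra_unit\<close> and
    invariance. As 1 is grouplike, \<open>hitR f\<close> then fixes it.\<close>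
  define x where "x = scale (inverse (T x0)) x0"
  have Tx: "T x = 1" using \<open>T x0 \<noteq> 0\<close> by (simp add: x_def dual_scale[OF t])
  define f where "f = bra T x"
  have f: "f \<in> dual_space" unfolding f_def by (rule bra_dual[OF t linear_id_fun])
  have f1: "f unit = 1"
    using integral_Sw[OF T(1) alpha_dual, of x] by (simp add: f_def bra_unit[OF t] conv_Sw Tx alpha_unit)
  define X where "X = (\<lambda>p. S (fst p)) ` set (sw x)"
  have X: "hitR f a \<in> span X" for a
  proof -
    have "hitR f a = (\<Sum>p\<leftarrow>sw x. scale (bra T (snd p) a) (S (fst p)))"
    proof (rule dual_separates)
      fix \<theta> assume \<theta>: "\<theta> \<in> dual_space"
      have "\<theta> (hitR f a) = Sw x (\<lambda>x1 x2. \<theta> (S x1) * bra T x2 a)"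
        unfolding dual_hitR[OF \<theta>] f_def by (rule integral_bra_coaction[OF T(1) \<theta>])
      then show "\<theta> (hitR f a) = \<theta> (\<Sum>p\<leftarrow>sw x. scale (bra T (snd p) a) (S (fst p)))"
        by (simp add: dual_sum_list[OF \<theta>] dual_scale[OF \<theta>] Sw_def case_prod_unfold mult.commute)
    qed
    moreover have "(\<Sum>p\<leftarrow>ps. scale (bra T (snd p) a) (S (fst p))) \<in> span X" if "set ps \<subseteq> set (sw x)" for ps
      using that
    proof (induction ps)
      case (Cons p ps)
      then have "S (fst p) \<in> X" by (auto simp: X_def)
      then show ?case using Cons by (simp add: span_add span_scale span_base)
    qed (simp add: span_zero)
    ultimately show ?thesis by simp
  qed
  have e: "hitR f unit = unit"
  proof (rule dual_separates)
    fix \<theta> assume \<theta>: "\<theta> \<in> dual_space"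
    have "Sw unit (\<lambda>u v. \<theta> u * f v) = \<theta> unit * f unit"
      by (rule Sw_unit) (rule dual_cmult_left dual_cmult_right, rule \<theta> f)+
    then show "\<theta> (hitR f unit) = \<theta> unit" by (simp add: dual_hitR[OF \<theta>] f1)
  qed
  obtain P M where P: "Vector_Spaces.linear scale scale P" "subspace M" "M \<subseteq> span X"
    "\<And>a. P a \<in> M" "\<forall>m\<in>M. P m = m" "P unit = unit" "colinear P"
    by (rule colinear_projection[OF f _ X e]) (simp add: X_def, rule that)
  obtain B co where B: "finite B" "B \<subseteq> M" "\<And>b. Vector_Spaces.linear scale (*) (co b)"
    "\<And>a. P a = (\<Sum>b\<in>B. scale (co b a) b)" "\<forall>b\<in>B. co b b = 1" "span B = M"
    by (rule finite_rank_coordinates[OF P(1-3) _ P(4,5)]) (simp add: X_def, rule that)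
  have co: "co b \<in> dual_space" for b using B(3) by (simp add: dual_space_def)
  define T' where "T' a = (\<Sum>b\<in>B. bra (conv pivot (co b)) b a)" for a
  have T': "left_integral T'"
    unfolding T'_def[abs_def]
    by (rule trace_integral[OF inv B(1) co B(4)]) (use P(5,7) B(2) in auto)
  have T'1: "T' unit = of_nat (card B)"
    using B(5) by (simp add: T'_def trace_integral_unit[OF inv co])
  \<comment> \<open>M contains the nonzero vector 1, so the number of basis elements is positive;
    characteristic zero keeps its image in k nonzero.\<close>
  have "unit \<noteq> 0" using unit_counit dual_zero[OF counit_dual] by auto
  then have "B \<noteq> {}" using P(4)[of unit] P(6) B(6) by auto
  then have nz: "T' unit \<noteq> 0" using T'1 B(1) by simp
  define T'' where "T'' a = inverse (T' unit) * T' a" for a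
  have "Sw a (\<lambda>u v. \<theta> u * T'' v) = \<theta> unit * T'' a" if "\<theta> \<in> dual_space" for \<theta> a
  proof -
    have "Sw a (\<lambda>u v. \<theta> u * T'' v) = inverse (T' unit) * Sw a (\<lambda>u v. \<theta> u * T' v)"
      by (simp add: T''_def Sw_mult_left mult.left_commute)
    then show ?thesis by (simp add: integral_Sw[OF T' that] T''_def)
  qed
  moreover have "T'' \<in> dual_space"
    using T' unfolding left_integral_def T''_def[abs_def] by (auto intro: dual_cmult_left)
  ultimately have "left_integral T''"
    by (simp add: left_integral_def conv_Sw fun_eq_iff)
  then have "coseparability_form (\<lambda>y a. cosep0 T'' (hitR \<beta> y) a)"
    by (rule integral_imp_coseparable) (simp add: T''_def nz)
  then show ?thesis by (rule coseparable_imp_cosemisimple)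
qed

end
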